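(* (Di Francesco's 2004 conjecture.) Let $\Lambda$ be a dihedral domain with reference side, $N$ the number of black external edges, and $\mathrm{Sym}=\frac1N\sum_{k=0}^{N-1}R^k$. Let \[ |\Psi_\Lambda(t)\rangle=\sum_{\phi\in \mathrm{Fpl}_b(\Lambda)} t^{h(\phi)-1}|\Pi_b(\phi)\rangle,\qquad |\Psi'_\Lambda(t)\rangle=\sum_{\phi\in \mathrm{Fpl}_+(\Lambda)} t^{h(\phi)-1}|\Pi_+(\phi)\rangle . \] Then $\mathrm{Sym}\,|\Psi'_\Lambda(t)\rangle=\mathrm{Sym}\,|\Psi_\Lambda(t)\rangle$.
   Context: Link patterns. For $N=2n$, $\mathcal{LP}(2n)$ is the set of non-crossing perfect matchings of $N$ points labelled $1,\dots,N$ counter-clockwise on the boundary of a disk. $\mathcal{LP}^*(N)$ is the set of punctured link patterns: for $N=2n$, non-crossing perfect matchings of $N$ boundary points of a punctured disk up to isotopy in the punctured disk; for $N=2n-1$, non-crossing perfect matchings of the $N$ boundary points together with the puncture. $\mathbb{C}^{\mathcal{LP}}$ has basis $|\pi\rangle$, and $R|\pi\rangle=|R\pi\rangle$ where $R\pi$ has arc $\{i+1,j+1\}$ (mod $N$) for each arc $\{i,j\}$ of $\pi$. Dihedral domains. Take integers $L_x,L_y\ge1$, $a_1,\dots,a_4\ge0$, at least one $a_i=0$, and $a_1=0$. Start from the $L_x\times L_y$ rectangle of vertices of the square grid, attach pendant edges (to degree-1 external vertices) so that every grid vertex has degree 4; call the corners $A_1$ (bottom-left), $A_2,A_3,A_4$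 counter-clockwise; remove from $A_i$ an $a_i\times a_i$ square of vertices (non-overlapping), and join the $2a_i$ dangling edges pairwise starting from the concave corner, so that all remaining grid vertices have degree 4 (first kind). A domain of the second kind subdivides, by one degree-2 vertex, an internal edge of a first-kind domain whose two adjacent faces have at most 3 sides. Embed in a disk with external vertices on the boundary; there are $2N$ external edges, $N=L_x+L_y-\sum a_i$, labelled $1,\dots,2N$ counter-clockwise, edge $1$ being the downward pendant edge at corner vertex $A_1$. $\mathcal{LP}(\Lambda)$ is $\mathcal{LP}^*(N)$ with puncture at the degree-2 vertex (second kind), $\mathcal{LP}^*(N)$ with puncture in the face with at most 2 sides if a first-kind domain has one, and $\mathcal{LP}(N)$ otherwise. FPLs. An FPL is a black/white edge colouring with two black and two white edges at each degree-4 vertex, one of each at each degree-2 vertex, and external edges $1,\dots,2N$ alternating in colour. $\mathrm{Fpl}_+(\Lambda)$ (resp. $\mathrm{Fpl}_-(\Lambda)$): external edge 1 is black (resp. white). For a black external edge $v$, $\Pi(\phi,v)\in\mathcal{LP}(\Lambda)$ is the pairing induced by the black paths, with black external edges $v,v+2,\dots$ (mod $2N$) relabelled $1,\dots,N$; $\Pi_+(\phi)=\Pi(\phi,1)$ for $\phi\in\mathrm{Fpl}_+$. Refinement position. The reference side is the sequence of vertices $v_1,\dots,v_L$ where $v_j$ is the endpoint of external edge $j$, from $A_1$ to the next vertex carrying two external edges. At $v_j$ name its edges, counter-clockwise from external edge $j$, down, right, up, left; the tile is of type $c$ if the black edges are $\{$down,up$\}$ or $\{$left,right$\}$. Each FPL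 has exactly one $c$-tile on the reference side, at $v_{h(\phi)}$; $h(\phi)$ is the refinement position. $\mathrm{Fpl}_b(\Lambda)$ consists of FPLs whose external edge $h(\phi)$ is black, and $\Pi_b(\phi)=\Pi(\phi,h(\phi))$. *)

theory Defs
  imports
    Complex_Main
    "HOL-Library.Product_Plus"
    "HOL-Library.While_Combinator"
    "HOL-Library.Disjoint_Sets"
begin

section \<open>Link patterns\<close>

text \<open>
  A pattern of an even number of points in the punctured disk is stored as its set of arcs, where
  an arc with end points \<open>i\<close> and \<open>j\<close> is written \<open>(i, j)\<close> if the region cut off by the arc and the
  boundary interval running counter-clockwise from \<open>i\<close> to \<open>j\<close> does not contain the puncture.
  Together with the end points this fixes the isotopy class of the arc in the punctured disk.
  For an odd number of points \<open>None\<close> is the puncture; since the disk may be turned around the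
  puncture, the isotopy class carries no information beyond the matching.
\<close>

datatype link_pattern =
    Disk "nat set set"
  | Punctured_Even "(nat \<times> nat) set"
  | Punctured_Odd "nat option set set"

definition perfect_matching :: "'a set \<Rightarrow> 'a set set \<Rightarrow> bool" where
  "perfect_matching S M \<longleftrightarrow> partition_on S M \<and> (\<forall>e\<in>M. card e = 2)"

definition noncrossing :: "nat set set \<Rightarrow> bool" where
  "noncrossing M \<longleftrightarrow>
     \<not> (\<exists>i j k l. {i, j} \<in> M \<and> {k, l} \<in> M \<and> i < k \<and> k < j \<and> j < l)"

definition LP :: "nat \<Rightarrow> link_pattern set" where
  "LP N = {Disk M | M. perfect_matching {1..N} M \<and> noncrossing M}"

definition ccw_interval :: "nat \<Rightarrow> nat \<times> nat \<Rightarrow> nat set" where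
  "ccw_interval N = (\<lambda>(i, j). if i < j then {i..j} else {i..N} \<union> {1..j})"

text \<open>
  In the even case the puncture-free regions of two disjoint arcs are nested or disjoint.
  In the odd case any non-crossing family of arcs leaves room for the strand to the puncture.
\<close>

definition LP_punctured :: "nat \<Rightarrow> link_pattern set" where
  "LP_punctured N =
     (if even N then
        {Punctured_Even D | D.
           perfect_matching {1..N} ((\<lambda>(i, j). {i, j}) ` D) \<and>
           (\<forall>(i, j)\<in>D. (j, i) \<notin> D) \<and>
           (\<forall>p\<in>D. \<forall>q\<in>D.
              ccw_interval N p \<subseteq> ccw_interval N q \<or>
              ccw_interval N q \<subseteq> ccw_interval N p \<or>
              ccw_interval N p \<inter> ccw_interval N q = {})}
      else
        {Punctured_Odd M | M.
           perfect_matching (insert None (Some ` {1..N})) M \<and>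
           noncrossing {e. Some ` e \<in> M}})"

definition rot_label :: "nat \<Rightarrow> nat \<Rightarrow> nat" where
  "rot_label N i = i mod N + 1"

fun rot_pattern :: "nat \<Rightarrow> link_pattern \<Rightarrow> link_pattern" where
  "rot_pattern N (Disk M) = Disk ((`) (rot_label N) ` M)"
| "rot_pattern N (Punctured_Even D) = Punctured_Even (map_prod (rot_label N) (rot_label N) ` D)"
| "rot_pattern N (Punctured_Odd M) = Punctured_Odd ((`) (map_option (rot_label N)) ` M)"


section \<open>Plane graphs in the disk\<close>

text \<open>
  A graph embedded in the disk is given by its half-edges: \<open>mate\<close> exchanges the two halves of an
  edge, \<open>ccw\<close> sends a half-edge to the next one counter-clockwise around its vertex, and \<open>ext j\<close>
  is the half of the external edge \<open>j\<close> (\<open>1 \<le> j \<le> 2 * nblack\<close>) at its degree-1 vertex on the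
  boundary of the disk.  \<open>Half p d\<close> leaves the lattice point \<open>p\<close> in direction \<open>d\<close>; \<open>Mid p d\<close> is the
  half at the degree-2 vertex facing \<open>Half p d\<close>.
\<close>

datatype half = Half "int \<times> int" "int \<times> int" | Mid "int \<times> int" "int \<times> int"

text \<open>A puncture \<open>In_Face h\<close> lies in the face on the right of \<open>h\<close>, directed away from its vertex.\<close>

datatype puncture = Unpunctured | In_Face half | At_Vertex half

record fpl_domain =
  half_edges :: "half set"
  ccw :: "half \<Rightarrow> half"
  mate :: "half \<Rightarrow> half"
  nblack :: nat
  ext :: "nat \<Rightarrow> half"
  puncture :: puncture

definition vertex_of :: "fpl_domain \<Rightarrow> half \<Rightarrow> half set" where
  "vertex_of \<Lambda> h = range (\<lambda>n. (ccw \<Lambda> ^^ n) h)"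

definition edge_of :: "fpl_domain \<Rightarrow> half \<Rightarrow> half set" where
  "edge_of \<Lambda> h = {h, mate \<Lambda> h}"

definition ext_halves :: "fpl_domain \<Rightarrow> half set" where
  "ext_halves \<Lambda> = ext \<Lambda> ` {1..2 * nblack \<Lambda>}"

text \<open>
  The face on the right of \<open>h\<close>, as the set of half-edges having it on their right; its number of
  sides is the cardinality.  The faces touching the boundary of the disk all fall into the
  single orbit that contains the external half-edges, and are not inner.
\<close>

definition face_of :: "fpl_domain \<Rightarrow> half \<Rightarrow> half set" where
  "face_of \<Lambda> h = range (\<lambda>n. ((ccw \<Lambda> \<circ> mate \<Lambda>) ^^ n) h)"

definition inner_face :: "fpl_domain \<Rightarrow> half set \<Rightarrow> bool" where
  "inner_face \<Lambda> F \<longleftrightarrow> F \<inter> ext_halves \<Lambda> = {}"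


section \<open>Dihedral domains\<close>

definition rectangle :: "int \<Rightarrow> int \<Rightarrow> (int \<times> int) set" where
  "rectangle Lx Ly = {1..Lx} \<times> {1..Ly}"

definition corner_square :: "int \<Rightarrow> int \<Rightarrow> (nat \<Rightarrow> int) \<Rightarrow> nat \<Rightarrow> (int \<times> int) set" where
  "corner_square Lx Ly a i =
     (if i = 1 then {1..a 1} \<times> {1..a 1}
      else if i = 2 then {Lx - a 2 + 1..Lx} \<times> {1..a 2}
      else if i = 3 then {Lx - a 3 + 1..Lx} \<times> {Ly - a 3 + 1..Ly}
      else {1..a 4} \<times> {Ly - a 4 + 1..Ly})"

definition removed :: "int \<Rightarrow> int \<Rightarrow> (nat \<Rightarrow> int) \<Rightarrow> (int \<times> int) set" where
  "removed Lx Ly a = (\<Union>i\<in>{1..4}. corner_square Lx Ly a i)"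

definition grid :: "int \<Rightarrow> int \<Rightarrow> (nat \<Rightarrow> int) \<Rightarrow> (int \<times> int) set" where
  "grid Lx Ly a = rectangle Lx Ly - removed Lx Ly a"

definition dihedral_params :: "int \<Rightarrow> int \<Rightarrow> (nat \<Rightarrow> int) \<Rightarrow> bool" where
  "dihedral_params Lx Ly a \<longleftrightarrow>
     1 \<le> Lx \<and> 1 \<le> Ly \<and> (\<forall>i\<in>{1..4}. 0 \<le> a i \<and> a i \<le> min Lx Ly) \<and> a 1 = 0 \<and>
     (\<forall>i\<in>{1..4}. \<forall>j\<in>{1..4}. i \<noteq> j \<longrightarrow>
        corner_square Lx Ly a i \<inter> corner_square Lx Ly a j = {}) \<and>
     (1, 1) \<in> grid Lx Ly a"

text \<open>
  Joining of dangling edges: an edge that dangles into a removed square is continued straight on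
  up to the diagonal of the square through its concave corner, and is reflected there.  So the
  \<open>k\<close>-th dangling edge on one side, counted from the concave corner, is joined to the \<open>k\<close>-th one on
  the other side, and if two removed squares touch, the joinings are concatenated.
\<close>

definition reflect :: "int \<Rightarrow> int \<Rightarrow> (nat \<Rightarrow> int) \<Rightarrow> int \<times> int \<Rightarrow> int \<times> int \<Rightarrow> int \<times> int" where
  "reflect Lx Ly a p d =
     (let (x, y) = p; (u, v) = d in
      if p \<in> corner_square Lx Ly a 1 \<and> x = y \<or>
         p \<in> corner_square Lx Ly a 3 \<and> Lx - x = Ly - y
      then (- v, - u)
      else if p \<in> corner_square Lx Ly a 2 \<and> Lx - x = y - 1 \<or>
              p \<in> corner_square Lx Ly a 4 \<and> x - 1 = Ly - y
      then (v, u)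
      else (u, v))"

definition strand ::
    "int \<Rightarrow> int \<Rightarrow> (nat \<Rightarrow> int) \<Rightarrow> (int \<times> int) \<times> (int \<times> int) \<Rightarrow> (int \<times> int) \<times> (int \<times> int)" where
  "strand Lx Ly a =
     while (\<lambda>(p, d). p \<in> removed Lx Ly a)
           (\<lambda>(p, d). let e = reflect Lx Ly a p d in (p + e, e))"

fun first_mate :: "int \<Rightarrow> int \<Rightarrow> (nat \<Rightarrow> int) \<Rightarrow> half \<Rightarrow> half" where
  "first_mate Lx Ly a (Half p d) = (let (q, e) = strand Lx Ly a (p + d, d) in Half q (- e))"
| "first_mate Lx Ly a (Mid p d) = Mid p d"

fun first_ccw :: "int \<Rightarrow> int \<Rightarrow> (nat \<Rightarrow> int) \<Rightarrow> half \<Rightarrow> half" where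
  "first_ccw Lx Ly a (Half p (u, v)) =
     (if p \<in> grid Lx Ly a then Half p (- v, u) else Half p (u, v))"
| "first_ccw Lx Ly a (Mid p d) = Mid p d"

definition grid_halves :: "int \<Rightarrow> int \<Rightarrow> (nat \<Rightarrow> int) \<Rightarrow> half set" where
  "grid_halves Lx Ly a =
     {Half p d | p d. p \<in> grid Lx Ly a \<and> d \<in> {(0, -1), (1, 0), (0, 1), (-1, 0)}}"

text \<open>The pendant edges of the full rectangle, counter-clockwise from the bottom-left corner.\<close>

definition rectangle_pendants :: "int \<Rightarrow> int \<Rightarrow> half list" where
  "rectangle_pendants Lx Ly =
     map (\<lambda>x. Half (x, 0) (0, 1)) [1..Lx] @
     map (\<lambda>y. Half (Lx + 1, y) (-1, 0)) [1..Ly] @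
     map (\<lambda>x. Half (x, Ly + 1) (0, -1)) (rev [1..Lx]) @
     map (\<lambda>y. Half (0, y) (1, 0)) (rev [1..Ly])"

text \<open>Those leading to a remaining vertex; the pendant edges of removed vertices are dropped.\<close>

definition pendants :: "int \<Rightarrow> int \<Rightarrow> (nat \<Rightarrow> int) \<Rightarrow> half list" where
  "pendants Lx Ly a =
     filter (\<lambda>h. first_mate Lx Ly a h \<in> grid_halves Lx Ly a) (rectangle_pendants Lx Ly)"

definition first_kind_map :: "int \<Rightarrow> int \<Rightarrow> (nat \<Rightarrow> int) \<Rightarrow> fpl_domain" where
  "first_kind_map Lx Ly a =
     \<lparr>half_edges = grid_halves Lx Ly a \<union> set (pendants Lx Ly a),
      ccw = first_ccw Lx Ly a,
      mate = first_mate Lx Ly a,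
      nblack = nat (Lx + Ly - (\<Sum>i=1..4. a i)),
      ext = (\<lambda>j. pendants Lx Ly a ! (j - 1)),
      puncture = Unpunctured\<rparr>"

definition small_face_halves :: "fpl_domain \<Rightarrow> half set" where
  "small_face_halves \<Lambda> =
     {h \<in> half_edges \<Lambda>. inner_face \<Lambda> (face_of \<Lambda> h) \<and> card (face_of \<Lambda> h) \<le> 2}"

definition first_kind :: "int \<Rightarrow> int \<Rightarrow> (nat \<Rightarrow> int) \<Rightarrow> fpl_domain" where
  "first_kind Lx Ly a =
     (let \<Lambda> = first_kind_map Lx Ly a; S = small_face_halves \<Lambda>
      in \<Lambda>\<lparr>puncture := (if S = {} then Unpunctured else In_Face (SOME h. h \<in> S))\<rparr>)"

fun mid :: "half \<Rightarrow> half" where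
  "mid (Half p d) = Mid p d"
| "mid (Mid p d) = Mid p d"

definition subdivide :: "fpl_domain \<Rightarrow> half \<Rightarrow> fpl_domain" where
  "subdivide \<Lambda> h =
     (let g = mate \<Lambda> h in
      \<Lambda>\<lparr>half_edges := half_edges \<Lambda> \<union> {mid h, mid g},
        ccw := (ccw \<Lambda>)(mid h := mid g, mid g := mid h),
        mate := (mate \<Lambda>)(h := mid h, mid h := h, g := mid g, mid g := g),
        puncture := At_Vertex (mid h)\<rparr>)"

inductive dihedral_domain :: "fpl_domain \<Rightarrow> bool" where
  first: "dihedral_params Lx Ly a \<Longrightarrow> dihedral_domain (first_kind Lx Ly a)"
| second: "\<lbrakk>dihedral_params Lx Ly a; \<Lambda> = first_kind Lx Ly a; h \<in> half_edges \<Lambda>;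
            \<forall>g\<in>edge_of \<Lambda> h. inner_face \<Lambda> (face_of \<Lambda> g) \<and> card (face_of \<Lambda> g) \<le> 3\<rbrakk>
           \<Longrightarrow> dihedral_domain (subdivide \<Lambda> h)"

definition LP_domain :: "fpl_domain \<Rightarrow> link_pattern set" where
  "LP_domain \<Lambda> =
     (if puncture \<Lambda> = Unpunctured then LP (nblack \<Lambda>) else LP_punctured (nblack \<Lambda>))"


section \<open>Fully-packed loop configurations\<close>

definition next_ext :: "fpl_domain \<Rightarrow> nat \<Rightarrow> nat" where
  "next_ext \<Lambda> j = j mod (2 * nblack \<Lambda>) + 1"

text \<open>A colouring is identified with its set \<open>B\<close> of black edges.\<close>

definition black_at :: "fpl_domain \<Rightarrow> half set set \<Rightarrow> half \<Rightarrow> half set" where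
  "black_at \<Lambda> B h = {g \<in> vertex_of \<Lambda> h. edge_of \<Lambda> g \<in> B}"

definition black_ext :: "fpl_domain \<Rightarrow> half set set \<Rightarrow> nat \<Rightarrow> bool" where
  "black_ext \<Lambda> B j \<longleftrightarrow> edge_of \<Lambda> (ext \<Lambda> j) \<in> B"

definition Fpl :: "fpl_domain \<Rightarrow> half set set set" where
  "Fpl \<Lambda> =
     {B. B \<subseteq> edge_of \<Lambda> ` half_edges \<Lambda> \<and>
         (\<forall>h\<in>half_edges \<Lambda>.
            (card (vertex_of \<Lambda> h) = 4 \<longrightarrow> card (black_at \<Lambda> B h) = 2) \<and>
            (card (vertex_of \<Lambda> h) = 2 \<longrightarrow> card (black_at \<Lambda> B h) = 1)) \<and>
         (\<forall>j\<in>{1..2 * nblack \<Lambda>}. black_ext \<Lambda> B (next_ext \<Lambda> j) \<longleftrightarrow> \<not> black_ext \<Lambda> B j)}"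

definition black_step :: "fpl_domain \<Rightarrow> half set set \<Rightarrow> (half \<times> half) set" where
  "black_step \<Lambda> B =
     {(h, g). h \<in> half_edges \<Lambda> \<and> edge_of \<Lambda> h \<in> B \<and> (g = mate \<Lambda> h \<or> g \<in> black_at \<Lambda> B h)}"

definition black_path :: "fpl_domain \<Rightarrow> half set set \<Rightarrow> half \<Rightarrow> half set" where
  "black_path \<Lambda> B h = (black_step \<Lambda> B)\<^sup>* `` {h}"

text \<open>
  \<open>region \<Lambda> C h\<close> is the connected component of the complement in the disk of the path with
  half-edges \<open>C\<close> that lies immediately to the right of \<open>h\<close>.  It is obtained by walking along a face,
  without passing around a vertex on the boundary of the disk, and by crossing edges not in \<open>C\<close>;
  again \<open>g\<close> stands for the face on its right.
\<close>

definition region_step :: "fpl_domain \<Rightarrow> half set \<Rightarrow> (half \<times> half) set" where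
  "region_step \<Lambda> C =
     {(g, ccw \<Lambda> (mate \<Lambda> g)) | g. g \<in> half_edges \<Lambda> \<and> mate \<Lambda> g \<notin> ext_halves \<Lambda>} \<union>
     {(g, mate \<Lambda> g) | g. g \<in> half_edges \<Lambda> - C}"

definition region :: "fpl_domain \<Rightarrow> half set \<Rightarrow> half \<Rightarrow> half set" where
  "region \<Lambda> C h = (region_step \<Lambda> C \<union> (region_step \<Lambda> C)\<inverse>)\<^sup>* `` {h}"

text \<open>
  The external half-edge with new label \<open>k\<close> when \<open>v, v + 2, \<dots>\<close> are relabelled \<open>1, \<dots>, N\<close>.
\<close>

definition relabelled :: "fpl_domain \<Rightarrow> nat \<Rightarrow> nat \<Rightarrow> half" where
  "relabelled \<Lambda> v k = ext \<Lambda> ((v - 1 + 2 * (k - 1)) mod (2 * nblack \<Lambda>) + 1)"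

definition linked_labels :: "fpl_domain \<Rightarrow> half set set \<Rightarrow> nat \<Rightarrow> (nat \<times> nat) set" where
  "linked_labels \<Lambda> B v =
     {(k, l). k \<in> {1..nblack \<Lambda>} \<and> l \<in> {1..nblack \<Lambda>} \<and> k \<noteq> l \<and>
              relabelled \<Lambda> v l \<in> black_path \<Lambda> B (relabelled \<Lambda> v k)}"

text \<open>
  Looking inwards from the external vertex labelled \<open>k\<close>, the boundary interval going
  counter-clockwise from \<open>k\<close> is on the right.  A domain with a puncture in a face (resp. at a
  degree-2 vertex) has configurations only if \<open>N\<close> is even (resp. odd).
\<close>

definition link_pattern_of :: "fpl_domain \<Rightarrow> half set set \<Rightarrow> nat \<Rightarrow> link_pattern" where
  "link_pattern_of \<Lambda> B v =
     (let P = (\<lambda>k. black_path \<Lambda> B (relabelled \<Lambda> v k)) in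
      case puncture \<Lambda> of
        Unpunctured \<Rightarrow> Disk {{k, l} | k l. (k, l) \<in> linked_labels \<Lambda> B v}
      | In_Face p \<Rightarrow>
          Punctured_Even {(k, l) \<in> linked_labels \<Lambda> B v.
                            p \<notin> region \<Lambda> (P k) (relabelled \<Lambda> v k)}
      | At_Vertex p \<Rightarrow>
          Punctured_Odd ({{Some k, Some l} | k l. (k, l) \<in> linked_labels \<Lambda> B v} \<union>
                         {{Some k, None} | k. k \<in> {1..nblack \<Lambda>} \<and> P k \<inter> vertex_of \<Lambda> p \<noteq> {}}))"


section \<open>Refinement position\<close>

text \<open>
  The reference side ends at the first corner, i.e. at the first vertex where two cyclically
  consecutive external edges \<open>j\<close> and \<open>j + 1\<close> leave as neighbours.
\<close>

definition side_length :: "fpl_domain \<Rightarrow> nat" where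
  "side_length \<Lambda> =
     (LEAST j. 1 \<le> j \<and> ccw \<Lambda> (mate \<Lambda> (ext \<Lambda> j)) = mate \<Lambda> (ext \<Lambda> (next_ext \<Lambda> j)))"

definition c_tile :: "fpl_domain \<Rightarrow> half set set \<Rightarrow> nat \<Rightarrow> bool" where
  "c_tile \<Lambda> B j \<longleftrightarrow>
     (let down = mate \<Lambda> (ext \<Lambda> j); right = ccw \<Lambda> down; up = ccw \<Lambda> right; left = ccw \<Lambda> up
      in black_at \<Lambda> B down = {down, up} \<or> black_at \<Lambda> B down = {left, right})"

definition refinement_pos :: "fpl_domain \<Rightarrow> half set set \<Rightarrow> nat" where
  "refinement_pos \<Lambda> B = (THE j. j \<in> {1..side_length \<Lambda>} \<and> c_tile \<Lambda> B j)"

definition Fpl_plus :: "fpl_domain \<Rightarrow> half set set set" where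
  "Fpl_plus \<Lambda> = {B \<in> Fpl \<Lambda>. black_ext \<Lambda> B 1}"

definition Pi_plus :: "fpl_domain \<Rightarrow> half set set \<Rightarrow> link_pattern" where
  "Pi_plus \<Lambda> B = link_pattern_of \<Lambda> B 1"

definition Fpl_b :: "fpl_domain \<Rightarrow> half set set set" where
  "Fpl_b \<Lambda> = {B \<in> Fpl \<Lambda>. black_ext \<Lambda> B (refinement_pos \<Lambda> B)}"

definition Pi_b :: "fpl_domain \<Rightarrow> half set set \<Rightarrow> link_pattern" where
  "Pi_b \<Lambda> B = link_pattern_of \<Lambda> B (refinement_pos \<Lambda> B)"


section \<open>Vectors indexed by link patterns\<close>

definition ket :: "link_pattern \<Rightarrow> link_pattern \<Rightarrow> complex" where
  "ket \<pi> = (\<lambda>\<sigma>. if \<sigma> = \<pi> then 1 else 0)"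

definition rot_op :: "fpl_domain \<Rightarrow> (link_pattern \<Rightarrow> complex) \<Rightarrow> link_pattern \<Rightarrow> complex" where
  "rot_op \<Lambda> \<psi> = (\<lambda>\<sigma>. \<Sum>\<pi>\<in>LP_domain \<Lambda>. \<psi> \<pi> * ket (rot_pattern (nblack \<Lambda>) \<pi>) \<sigma>)"

definition Sym :: "fpl_domain \<Rightarrow> (link_pattern \<Rightarrow> complex) \<Rightarrow> link_pattern \<Rightarrow> complex" where
  "Sym \<Lambda> \<psi> = (\<lambda>\<sigma>. 1 / of_nat (nblack \<Lambda>) * (\<Sum>k<nblack \<Lambda>. (rot_op \<Lambda> ^^ k) \<psi> \<sigma>))"

definition Psi :: "fpl_domain \<Rightarrow> complex \<Rightarrow> link_pattern \<Rightarrow> complex" where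
  "Psi \<Lambda> t = (\<lambda>\<sigma>. \<Sum>B\<in>Fpl_b \<Lambda>. t ^ (refinement_pos \<Lambda> B - 1) * ket (Pi_b \<Lambda> B) \<sigma>)"

definition Psi' :: "fpl_domain \<Rightarrow> complex \<Rightarrow> link_pattern \<Rightarrow> complex" where
  "Psi' \<Lambda> t = (\<lambda>\<sigma>. \<Sum>B\<in>Fpl_plus \<Lambda>. t ^ (refinement_pos \<Lambda> B - 1) * ket (Pi_plus \<Lambda> B) \<sigma>)"

end

theory Submission imports Defs "HOL-Combinatorics.Orbits" begin

text \<open>
  The proof is Wieland's gyration, run on one of the two parity classes of faces.  The half-edges of a
  dihedral domain are two-coloured so that every face is monochromatic and neighbouring faces differ;
  faces have at most four sides once the external vertices are joined along the boundary.
  Complementing the edges of each face of the class that contains the boundary faces next to the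
  black external edges \<open>j\<close> and \<open>j + 1\<close>, except for inner faces whose edges alternate in colour, is a
  bijection of the FPLs that moves the link pattern on by one external edge.

  It moves the refinement position by at most one: a position \<open>h\<close> with white external edge becomes
  either position \<open>h\<close> with black edge or position \<open>h + 1\<close> with white edge, and a position with black
  edge becomes \<open>h\<close> with white edge or \<open>h - 1\<close> with black edge.  Comparing the FPLs of position at most
  \<open>h\<close> before and after gyration, the sum of a quantity that is constant under gyration is the same over
  both colours for each \<open>h\<close>.  The two sides of the theorem differ only in which colour is chosen at
  even \<open>h\<close>.

  For the geometry, the strands crossing the removed squares are followed vertex by vertex: each
  removed vertex can be passed in exactly two directions, and two parallel neighbouring strands stay
  neighbours until they bound a common face.
\<close>

section \<open>Orbits and counting\<close>

lemma orbit_subsetI: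
  assumes "f ` A \<subseteq> A" "x \<in> A"
  shows "orbit f x \<subseteq> A"
proof
  fix y assume "y \<in> orbit f x"
  then show "y \<in> A" by induction (use assms in auto)
qed

lemma self_in_orbit_if_inj_on:
  assumes "finite A" "f ` A \<subseteq> A" "inj_on f A" "x \<in> A"
  shows "x \<in> orbit f x"
proof -
  have "(f ^^ n) x \<in> A" for n by (induction n) (use assms in auto)
  then have "\<not> inj (\<lambda>n. (f ^^ n) x)"
    using assms(1) by (metis finite_imageD finite_subset image_subsetI infinite_UNIV_nat)
  then obtain i j where "i < j" "(f ^^ i) x = (f ^^ j) x" unfolding inj_def by (metis nat_neq_iff)
  moreover have "\<exists>k>0. (f ^^ k) x = x" if "i < j" "(f ^^ i) x = (f ^^ j) x" for i j
    using that
  proof (induction i arbitrary: j)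
    case 0 then show ?case by auto
  next
    case (Suc i)
    then obtain j' where "j = Suc j'" "i < j'" by (cases j) auto
    then show ?case using Suc \<open>\<And>n. (f ^^ n) x \<in> A\<close> inj_onD[OF assms(3)] by simp
  qed
  ultimately show ?thesis by (metis (mono_tags, lifting) mem_Collect_eq orbit_altdef)
qed

lemma orbit_eq_if_in_orbit: "x \<in> orbit f x \<Longrightarrow> y \<in> orbit f x \<Longrightarrow> orbit f y = orbit f x"
  by (meson cyclic_on_def orbit_cyclic_eq3)

lemma orbit_eq_range_funpow:
  assumes "x \<in> orbit f x" shows "orbit f x = range (\<lambda>n. (f ^^ n) x)"
  unfolding orbit_altdef_self_in[OF assms] by auto

lemma self_in_orbit_if_funpow: "(f ^^ n) x = x \<Longrightarrow> 0 < n \<Longrightarrow> x \<in> orbit f x"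
  unfolding orbit_altdef by (intro CollectI exI[of _ n]) simp

lemma orbit_eq_image_funpow:
  assumes "(f ^^ n) x = x" "0 < n" shows "orbit f x = (\<lambda>k. (f ^^ k) x) ` {..<n}"
  unfolding orbit_altdef_bounded[OF assms] by auto

lemma funpow_eq_self_in_orbit: "(f ^^ n) x = x \<Longrightarrow> y \<in> orbit f x \<Longrightarrow> (f ^^ n) y = y"
  unfolding orbit_altdef by clarsimp (metis add.commute comp_apply funpow_add)

lemma funpow_card_orbit:
  assumes "x \<in> orbit f x" shows "(f ^^ card (orbit f x)) x = x"
  using inj_on_funpow_dist1[OF assms] funpow_dist1_prop[OF assms]
  by (simp add: orbit_conv_funpow_dist1[OF assms] card_image del: funpow.simps)

definition exactly_two :: "bool \<Rightarrow> bool \<Rightarrow> bool \<Rightarrow> bool \<Rightarrow> bool" where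
  "exactly_two p q r s \<longleftrightarrow> (if p = q then r = s \<and> r \<noteq> p else r \<noteq> s)"

lemma card_filter_eq_sum: "finite A \<Longrightarrow> card {g \<in> A. P g} = (\<Sum>g\<in>A. if P g then 1 else 0)"
  by (simp flip: sum.inter_filter)

lemma card_filter_four:
  assumes "distinct [w, x, y, z]"
  shows "card {g \<in> {w, x, y, z}. P g} = 2 \<longleftrightarrow> exactly_two (P w) (P x) (P y) (P z)"
    and "even (card {g \<in> {w, x, y, z}. P g}) \<longleftrightarrow> (P w = P x) = (P y = P z)"
  using assms by (subst card_filter_eq_sum; auto simp: exactly_two_def)+

lemma card_filter_two:
  assumes "x \<noteq> y"
  shows "card {g \<in> {x, y}. P g} = 1 \<longleftrightarrow> P x \<noteq> P y"
  using assms by (subst card_filter_eq_sum) auto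

section \<open>Half-edge maps in the disk\<close>

definition prev_ext :: "fpl_domain \<Rightarrow> nat \<Rightarrow> nat" where
  "prev_ext \<Lambda> j = (if j = 1 then 2 * nblack \<Lambda> else j - 1)"

text \<open>External vertices are closed up along the boundary of the disk, so that the boundary faces become
  face orbits as well.\<close>

definition turn :: "fpl_domain \<Rightarrow> half \<Rightarrow> half" where
  "turn \<Lambda> h =
     (if h \<in> ext_halves \<Lambda> then ext \<Lambda> (prev_ext \<Lambda> (inv_into {1..2 * nblack \<Lambda>} (ext \<Lambda>) h))
      else ccw \<Lambda> h)"

definition face_step :: "fpl_domain \<Rightarrow> half \<Rightarrow> half" where
  "face_step \<Lambda> h = turn \<Lambda> (mate \<Lambda> h)"

definition quartic :: "fpl_domain \<Rightarrow> half \<Rightarrow> bool" where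
  "quartic \<Lambda> h \<longleftrightarrow>
     ccw \<Lambda> (ccw \<Lambda> (ccw \<Lambda> (ccw \<Lambda> h))) = h \<and> ccw \<Lambda> (ccw \<Lambda> h) \<noteq> h"

definition bivalent :: "fpl_domain \<Rightarrow> half \<Rightarrow> bool" where
  "bivalent \<Lambda> h \<longleftrightarrow> ccw \<Lambda> (ccw \<Lambda> h) = h \<and> ccw \<Lambda> h \<noteq> h"

lemma quartic_ccw: "quartic \<Lambda> h \<Longrightarrow> quartic \<Lambda> (ccw \<Lambda> h)"
  unfolding quartic_def by metis

lemma quartic_not_bivalent: "quartic \<Lambda> h \<Longrightarrow> \<not> bivalent \<Lambda> h"
  unfolding quartic_def bivalent_def by blast

locale disk_map =
  fixes \<Lambda> :: fpl_domain
  assumes finite_halves: "finite (half_edges \<Lambda>)"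
    and mate_in: "h \<in> half_edges \<Lambda> \<Longrightarrow> mate \<Lambda> h \<in> half_edges \<Lambda>"
    and mate_mate: "h \<in> half_edges \<Lambda> \<Longrightarrow> mate \<Lambda> (mate \<Lambda> h) = h"
    and ccw_in: "h \<in> half_edges \<Lambda> \<Longrightarrow> ccw \<Lambda> h \<in> half_edges \<Lambda>"
    and nblack_pos: "1 \<le> nblack \<Lambda>"
    and ext_in: "j \<in> {1..2 * nblack \<Lambda>} \<Longrightarrow> ext \<Lambda> j \<in> half_edges \<Lambda>"
    and inj_ext: "inj_on (ext \<Lambda>) {1..2 * nblack \<Lambda>}"
    and ccw_ext: "h \<in> ext_halves \<Lambda> \<Longrightarrow> ccw \<Lambda> h = h"
    and quartic_mate_ext: "h \<in> ext_halves \<Lambda> \<Longrightarrow> quartic \<Lambda> (mate \<Lambda> h)"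
    and degree: "h \<in> half_edges \<Lambda> - ext_halves \<Lambda> \<Longrightarrow> quartic \<Lambda> h \<or> bivalent \<Lambda> h"
begin

abbreviation "H \<equiv> half_edges \<Lambda>"
abbreviation "X \<equiv> ext_halves \<Lambda>"
abbreviation "N \<equiv> nblack \<Lambda>"
abbreviation "J \<equiv> {1..2 * nblack \<Lambda>}"
abbreviation "m \<equiv> mate \<Lambda>"
abbreviation "c \<equiv> ccw \<Lambda>"
abbreviation "e \<equiv> ext \<Lambda>"
abbreviation "f \<equiv> face_step \<Lambda>"
abbreviation "nx \<equiv> next_ext \<Lambda>"
abbreviation "face h \<equiv> orbit (face_step \<Lambda>) h"

lemma next_ext_in: "nx j \<in> J"
  using nblack_pos by (auto simp: next_ext_def Suc_le_eq)

lemma prev_ext_in: "j \<in> J \<Longrightarrow> prev_ext \<Lambda> j \<in> J"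
  using nblack_pos by (auto simp: prev_ext_def)

lemma prev_next_ext: "j \<in> J \<Longrightarrow> prev_ext \<Lambda> (nx j) = j"
  by (cases "j = 2 * N") (auto simp: next_ext_def prev_ext_def)

lemma next_prev_ext: "j \<in> J \<Longrightarrow> nx (prev_ext \<Lambda> j) = j"
  by (auto simp: next_ext_def prev_ext_def)

lemma ext_in_X: "j \<in> J \<Longrightarrow> e j \<in> X"
  by (auto simp: ext_halves_def)

lemma ext_next_cases:
  assumes "h \<in> X" obtains j where "j \<in> J" "h = e (nx j)"
  using assms next_prev_ext prev_ext_in by (metis ext_halves_def imageE)

lemma X_subset_H: "h \<in> X \<Longrightarrow> h \<in> H"
  using ext_in by (auto simp: ext_halves_def)

lemma ext_eq_iff: "i \<in> J \<Longrightarrow> j \<in> J \<Longrightarrow> e i = e j \<longleftrightarrow> i = j"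
  by (rule inj_on_eq_iff[OF inj_ext])

lemma turn_ext: "j \<in> J \<Longrightarrow> turn \<Lambda> (e (nx j)) = e j"
  using inv_into_f_f[OF inj_ext next_ext_in[of j]] ext_in_X[OF next_ext_in[of j]] prev_next_ext
  unfolding turn_def by simp

lemma turn_inner: "h \<notin> X \<Longrightarrow> turn \<Lambda> h = c h"
  by (simp add: turn_def)

lemma ccw_notin_X:
  assumes "h \<in> H" "h \<notin> X" shows "c h \<notin> X"
proof
  assume "c h \<in> X"
  then have "c (c h) = c h" by (rule ccw_ext)
  with degree[of h] assms show False
    using \<open>c h \<in> X\<close> by (auto simp: quartic_def bivalent_def)
qed

lemma mate_notin_X:
  assumes "h \<in> X" shows "m h \<notin> X"
proof
  assume "m h \<in> X"
  then have "c (m h) = m h" by (rule ccw_ext)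
  then show False using quartic_mate_ext[OF assms] by (simp add: quartic_def)
qed

lemma turn_in: "h \<in> H \<Longrightarrow> turn \<Lambda> h \<in> H"
  by (metis ext_next_cases turn_ext turn_inner ccw_in ext_in)

lemma turn_in_X_iff: "h \<in> H \<Longrightarrow> turn \<Lambda> h \<in> X \<longleftrightarrow> h \<in> X"
  by (metis ccw_notin_X ext_in_X ext_next_cases turn_ext turn_inner)

lemma ccw_four: "h \<in> H \<Longrightarrow> c (c (c (c h))) = h"
  using degree ccw_ext by (metis DiffI bivalent_def quartic_def)

lemma inj_on_ccw: "inj_on c H"
  using ccw_four by (metis inj_onI)

lemma inj_on_turn: "inj_on (turn \<Lambda>) H"
proof (rule inj_onI)
  fix h g assume hg: "h \<in> H" "g \<in> H" "turn \<Lambda> h = turn \<Lambda> g"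
  show "h = g"
  proof (cases "h \<in> X")
    case True
    then have "g \<in> X" using turn_in_X_iff hg by metis
    with True show ?thesis using hg(3) ext_eq_iff turn_ext by (metis ext_next_cases)
  next
    case False
    then have "g \<notin> X" using turn_in_X_iff hg by metis
    with False show ?thesis using hg inj_onD[OF inj_on_ccw] by (simp add: turn_inner)
  qed
qed

lemma face_step_in: "h \<in> H \<Longrightarrow> f h \<in> H"
  by (simp add: face_step_def turn_in mate_in)

lemma face_step_in_X_iff: "h \<in> H \<Longrightarrow> f h \<in> X \<longleftrightarrow> m h \<in> X"
  by (simp add: face_step_def turn_in_X_iff mate_in)

lemma inj_on_face_step: "inj_on f H"
proof (rule inj_onI)
  fix h g assume hg: "h \<in> H" "g \<in> H" "f h = f g"
  then have "m h = m g" using inj_onD[OF inj_on_turn] mate_in unfolding face_step_def by blast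
  then show "h = g" using mate_mate hg(1,2) by metis
qed

lemma face_step_inner: "m h \<notin> X \<Longrightarrow> f h = c (m h)"
  by (simp add: face_step_def turn_inner)

lemma face_step_mate: "h \<in> H \<Longrightarrow> f (m h) = turn \<Lambda> h"
  by (simp add: face_step_def mate_mate)

lemma face_step_mate_inner: "h \<in> H \<Longrightarrow> h \<notin> X \<Longrightarrow> f (m h) = c h"
  by (simp add: face_step_mate turn_inner)

lemma face_step_mate_ext: "j \<in> J \<Longrightarrow> f (m (e (nx j))) = e j"
  using face_step_mate[OF ext_in[OF next_ext_in]] turn_ext by simp

lemma self_in_face: "h \<in> H \<Longrightarrow> h \<in> face h"
  by (rule self_in_orbit_if_inj_on[OF finite_halves _ inj_on_face_step]) (auto simp: face_step_in)

lemma face_subset_H: "h \<in> H \<Longrightarrow> x \<in> face h \<Longrightarrow> x \<in> H"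
  using orbit_subsetI[of f H h] face_step_in by blast

lemma face_eq: "h \<in> H \<Longrightarrow> x \<in> face h \<Longrightarrow> face x = face h"
  by (rule orbit_eq_if_in_orbit[OF self_in_face])

lemma face_face_step: "h \<in> H \<Longrightarrow> face (f h) = face h"
  by (rule face_eq[OF _ orbit.base])

lemma face_sym: "h \<in> H \<Longrightarrow> x \<in> face h \<Longrightarrow> h \<in> face x"
  using face_eq self_in_face by metis

lemma face_two: "f (f h) = h \<Longrightarrow> face h = {h, f h}"
  using orbit_eq_image_funpow[of 2 f h] by (simp add: numeral_2_eq_2 lessThan_Suc insert_commute)

lemma period_if_invariant:
  assumes "h \<in> S" "f ` S \<subseteq> S" "S \<subseteq> H" "card S \<le> k" shows "\<exists>n\<in>{1..k}. (f ^^ n) h = h"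
proof -
  have h: "h \<in> H" using assms(1,3) by blast
  have "face h \<subseteq> S" by (rule orbit_subsetI[OF assms(2,1)])
  then have finite: "finite (face h)" and "card (face h) \<le> card S"
    using assms(3) finite_halves finite_subset card_mono by metis+
  moreover have "card (face h) > 0" using finite self_in_face[OF h] card_gt_0_iff by blast
  ultimately show ?thesis using funpow_card_orbit[OF self_in_face[OF h]] assms(4)
    by (intro bexI[of _ "card (face h)"]) auto
qed

lemma inner_face_of:
  assumes h: "h \<in> H" and inner: "inner_face \<Lambda> (face_of \<Lambda> h)"
  shows "face_of \<Lambda> h = face h" "face h \<inter> X = {}"
proof -
  have notin_X: "((c \<circ> m) ^^ n) h \<notin> X" for n
    using inner unfolding inner_face_def face_of_def by blast
  have "((c \<circ> m) ^^ n) h = (f ^^ n) h" for n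
  proof (induction n)
    case (Suc n)
    let ?x = "(f ^^ n) h"
    have "c (m ?x) \<notin> X" using notin_X[of "Suc n"] Suc by simp
    then have "m ?x \<notin> X" using ccw_ext by metis
    then show ?case using Suc face_step_inner by simp
  qed simp
  then show "face_of \<Lambda> h = face h"
    unfolding face_of_def orbit_eq_range_funpow[OF self_in_face[OF h]] by simp
  then show "face h \<inter> X = {}" using inner unfolding inner_face_def by simp
qed

lemma vertex_of_eq_orbit:
  assumes "h \<in> H" shows "vertex_of \<Lambda> h = orbit c h"
proof -
  have "h \<in> orbit c h"
    using assms ccw_in by (intro self_in_orbit_if_inj_on[OF finite_halves _ inj_on_ccw]) auto
  then show ?thesis unfolding vertex_of_def by (rule orbit_eq_range_funpow[symmetric])
qed

lemma vertex_of_subset_H: "h \<in> H \<Longrightarrow> g \<in> vertex_of \<Lambda> h \<Longrightarrow> g \<in> H"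
  using orbit_subsetI[of c H h] ccw_in by (auto simp: vertex_of_eq_orbit)

lemma self_in_vertex_of: "h \<in> vertex_of \<Lambda> h"
  unfolding vertex_of_def by (metis funpow_0 rangeI)

lemma ccw_in_vertex_of: "c h \<in> vertex_of \<Lambda> h"
  unfolding vertex_of_def by (rule range_eqI[of _ _ 1]) simp

lemma vertex_of_eq: "h \<in> H \<Longrightarrow> g \<in> vertex_of \<Lambda> h \<Longrightarrow> vertex_of \<Lambda> g = vertex_of \<Lambda> h"
  using orbit_eq_if_in_orbit[of h c g] self_in_vertex_of[of h] vertex_of_subset_H[of h g]
  by (simp add: vertex_of_eq_orbit)

lemma vertex_of_ext: "h \<in> X \<Longrightarrow> vertex_of \<Lambda> h = {h}"
  using orbit_eq_singleton_iff[of c h] ccw_ext by (simp add: vertex_of_eq_orbit X_subset_H)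

lemma vertex_of_notin_X: "h \<in> H \<Longrightarrow> h \<notin> X \<Longrightarrow> g \<in> vertex_of \<Lambda> h \<Longrightarrow> g \<notin> X"
  by (metis self_in_vertex_of singletonD vertex_of_eq vertex_of_ext)

end

lemma vertex_of_quartic:
  assumes "quartic \<Lambda> h"
  shows "vertex_of \<Lambda> h = {h, ccw \<Lambda> h, ccw \<Lambda> (ccw \<Lambda> h), ccw \<Lambda> (ccw \<Lambda> (ccw \<Lambda> h))}"
    "distinct [h, ccw \<Lambda> h, ccw \<Lambda> (ccw \<Lambda> h), ccw \<Lambda> (ccw \<Lambda> (ccw \<Lambda> h))]"
proof -
  have "(ccw \<Lambda> ^^ 4) h = h" using assms by (simp add: quartic_def eval_nat_numeral)
  then have "vertex_of \<Lambda> h = (\<lambda>n. (ccw \<Lambda> ^^ n) h) ` {..<4}"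
    using orbit_eq_range_funpow[OF self_in_orbit_if_funpow] orbit_eq_image_funpow
    unfolding vertex_of_def by (metis zero_less_numeral)
  then show "vertex_of \<Lambda> h = {h, ccw \<Lambda> h, ccw \<Lambda> (ccw \<Lambda> h), ccw \<Lambda> (ccw \<Lambda> (ccw \<Lambda> h))}"
    by (simp add: eval_nat_numeral lessThan_Suc insert_commute)
  show "distinct [h, ccw \<Lambda> h, ccw \<Lambda> (ccw \<Lambda> h), ccw \<Lambda> (ccw \<Lambda> (ccw \<Lambda> h))]"
    using assms by (auto simp: quartic_def)
qed

lemma vertex_of_bivalent:
  assumes "bivalent \<Lambda> h" shows "vertex_of \<Lambda> h = {h, ccw \<Lambda> h}"
proof -
  have "(ccw \<Lambda> ^^ 2) h = h" using assms by (simp add: bivalent_def eval_nat_numeral)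
  then have "vertex_of \<Lambda> h = (\<lambda>n. (ccw \<Lambda> ^^ n) h) ` {..<2}"
    using orbit_eq_range_funpow[OF self_in_orbit_if_funpow] orbit_eq_image_funpow
    unfolding vertex_of_def by (metis zero_less_numeral)
  then show ?thesis by (simp add: eval_nat_numeral lessThan_Suc insert_commute)
qed

section \<open>Plane domains\<close>

text \<open>\<open>C\<close> is the boundary of the set of faces \<open>\<chi>\<close>, where \<open>\<chi> h\<close> refers to the face on the right of \<open>h\<close>.\<close>

definition bounds :: "fpl_domain \<Rightarrow> half set \<Rightarrow> (half \<Rightarrow> bool) \<Rightarrow> bool" where
  "bounds \<Lambda> C \<chi> \<longleftrightarrow>
     (\<forall>h\<in>half_edges \<Lambda>. mate \<Lambda> h \<notin> ext_halves \<Lambda> \<longrightarrow> \<chi> (ccw \<Lambda> (mate \<Lambda> h)) = \<chi> h) \<and>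
     (\<forall>h\<in>half_edges \<Lambda>. \<chi> (mate \<Lambda> h) \<noteq> \<chi> h \<longleftrightarrow> h \<in> C)"

definition puncture_ok :: "fpl_domain \<Rightarrow> bool" where
  "puncture_ok \<Lambda> \<longleftrightarrow>
     (case puncture \<Lambda> of
        Unpunctured \<Rightarrow> \<forall>h\<in>half_edges \<Lambda> - ext_halves \<Lambda>. quartic \<Lambda> h
      | In_Face p \<Rightarrow>
          (\<forall>h\<in>half_edges \<Lambda> - ext_halves \<Lambda>. quartic \<Lambda> h) \<and> p \<in> half_edges \<Lambda> \<and>
          face_step \<Lambda> (face_step \<Lambda> p) = p \<and> p \<notin> ext_halves \<Lambda> \<and> face_step \<Lambda> p \<notin> ext_halves \<Lambda>
      | At_Vertex p \<Rightarrow>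
          p \<in> half_edges \<Lambda> - ext_halves \<Lambda> \<and> bivalent \<Lambda> p \<and>
          (\<forall>h\<in>half_edges \<Lambda> - ext_halves \<Lambda>. h \<notin> {p, ccw \<Lambda> p} \<longrightarrow> quartic \<Lambda> h))"

locale plane_domain = disk_map +
  fixes par :: "half \<Rightarrow> bool"
  assumes par_mate: "h \<in> half_edges \<Lambda> \<Longrightarrow> par (mate \<Lambda> h) \<longleftrightarrow> \<not> par h"
    and par_ccw: "h \<in> half_edges \<Lambda> - ext_halves \<Lambda> \<Longrightarrow> par (ccw \<Lambda> h) \<longleftrightarrow> \<not> par h"
    and boundary_face: "j \<in> {1..2 * nblack \<Lambda>} \<Longrightarrow>
          ccw \<Lambda> (mate \<Lambda> (ext \<Lambda> j)) = mate \<Lambda> (ext \<Lambda> (next_ext \<Lambda> j)) \<or>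
          ccw \<Lambda> (mate \<Lambda> (ccw \<Lambda> (mate \<Lambda> (ext \<Lambda> j)))) = mate \<Lambda> (ext \<Lambda> (next_ext \<Lambda> j))"
    and face_period: "h \<in> half_edges \<Lambda> \<Longrightarrow> \<exists>n\<in>{1..4}. (face_step \<Lambda> ^^ n) h = h"
    and corner: "ccw \<Lambda> (mate \<Lambda> (ext \<Lambda> (2 * nblack \<Lambda>))) = mate \<Lambda> (ext \<Lambda> 1)"
    and connected: "\<lbrakk>\<And>h. h \<in> half_edges \<Lambda> \<Longrightarrow> \<chi> (mate \<Lambda> h) = \<chi> h \<and> \<chi> (ccw \<Lambda> h) = (\<chi> h :: bool);
          h \<in> half_edges \<Lambda>; g \<in> half_edges \<Lambda>\<rbrakk> \<Longrightarrow> \<chi> g = \<chi> h"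
    and planar: "\<lbrakk>C \<subseteq> half_edges \<Lambda>; \<And>h. h \<in> C \<Longrightarrow> mate \<Lambda> h \<in> C;
          \<And>h. h \<in> half_edges \<Lambda> - ext_halves \<Lambda> \<Longrightarrow> even (card (C \<inter> vertex_of \<Lambda> h))\<rbrakk>
          \<Longrightarrow> \<exists>\<chi>. bounds \<Lambda> C \<chi>"
    and puncture_ok: "puncture_ok \<Lambda>"
begin

lemma boundary_cases:
  assumes "j \<in> J"
  obtains (two) "c (m (e j)) = m (e (nx j))" "f (e j) = m (e (nx j))" "f (f (e j)) = e j"
  | (three) "c (m (f (e j))) = m (e (nx j))" "c (m (e j)) = f (e j)"
      "f (f (e j)) = m (e (nx j))" "f (f (f (e j))) = e j" "m (f (e j)) \<notin> X"
proof -
  have first_step: "f (e j) = c (m (e j))" using face_step_inner mate_notin_X ext_in_X[OF assms] by blast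
  show thesis
  proof (cases "c (m (e j)) = m (e (nx j))")
    case True
    then show thesis using two first_step face_step_mate_ext[OF assms] by simp
  next
    case False
    then have second_step: "c (m (f (e j))) = m (e (nx j))"
      using boundary_face[OF assms] first_step by simp
    have inner: "m (f (e j)) \<notin> X"
      using second_step ccw_ext mate_notin_X[OF ext_in_X[OF next_ext_in]] by metis
    then have third_half: "f (f (e j)) = m (e (nx j))" using second_step face_step_inner by simp
    then have "f (f (f (e j))) = e j" using face_step_mate_ext[OF assms] by simp
    then show thesis using three[OF second_step first_step[symmetric] third_half] inner by blast
  qed
qed

lemma par_next_ext:
  assumes "j \<in> J" shows "par (e (nx j)) \<longleftrightarrow> \<not> par (e j)"
proof -
  have in_H: "e j \<in> H" "m (e j) \<in> H" "m (e j) \<notin> X" "e (nx j) \<in> H"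
    using assms ext_in mate_in ext_in_X mate_notin_X next_ext_in by blast+
  then have first_step: "par (c (m (e j))) = par (e j)" using par_ccw par_mate by auto
  from assms show ?thesis
  proof (cases rule: boundary_cases)
    case two
    then show ?thesis using first_step in_H par_mate by metis
  next
    case three
    have "par (c (m (f (e j)))) = par (f (e j))"
      using three(5) in_H(1) par_ccw par_mate face_step_in mate_in by (metis DiffI)
    then show ?thesis using three first_step in_H par_mate by metis
  qed
qed

lemma par_turn:
  assumes "h \<in> H" shows "par (turn \<Lambda> h) \<longleftrightarrow> \<not> par h"
proof (cases "h \<in> X")
  case True
  then show ?thesis using turn_ext par_next_ext by (metis ext_next_cases)
next
  case False
  then show ?thesis using assms par_ccw by (simp add: turn_inner)
qed

lemma par_face_step: "h \<in> H \<Longrightarrow> par (f h) = par h"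
  by (simp add: face_step_def par_turn par_mate mate_in)

lemma par_face: "x \<in> face h \<Longrightarrow> h \<in> H \<Longrightarrow> par x = par h"
proof (induction rule: orbit.induct)
  case base then show ?case by (rule par_face_step)
next
  case (step x) then show ?case using par_face_step face_subset_H by simp
qed

lemma face_cases:
  assumes "h \<in> H" "x \<in> face h"
  obtains (same) "x = h" | (next_step) "x = f h" | (prev_step) "f x = h"
  | (opposite) "x = f (f h)" "f (f x) = h"
proof -
  obtain n where period: "n \<in> {1..4}" "(f ^^ n) h = h" using face_period assms(1) by blast
  then have "face h = (\<lambda>k. (f ^^ k) h) ` {..<n}" by (intro orbit_eq_image_funpow) auto
  then obtain k where k: "x = (f ^^ k) h" "k < n" using assms(2) by auto
  with period(1)
  consider "k = 0" | "k = 1" | "k = 2" "n = 3" | "k = 2" "n = 4" | "k = 3" "n = 4" by force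
  then show thesis
    using that k(1) period(2) by cases (simp_all add: eval_nat_numeral)
qed

section \<open>Fully packed loops as colourings of half-edges\<close>

definition fpl :: "(half \<Rightarrow> bool) \<Rightarrow> bool" where
  "fpl b \<longleftrightarrow> (\<forall>h. b h \<longrightarrow> h \<in> H) \<and> (\<forall>h\<in>H. b (m h) = b h) \<and>
     (\<forall>h\<in>H. h \<notin> X \<longrightarrow>
        (quartic \<Lambda> h \<longrightarrow> exactly_two (b h) (b (c h)) (b (c (c h))) (b (c (c (c h))))) \<and>
        (bivalent \<Lambda> h \<longrightarrow> b (c h) = (\<not> b h))) \<and>
     (\<forall>j\<in>J. b (e (nx j)) = (\<not> b (e j)))"

definition edges_of :: "(half \<Rightarrow> bool) \<Rightarrow> half set set" where
  "edges_of b = edge_of \<Lambda> ` {h \<in> H. b h}"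

definition is_black :: "half set set \<Rightarrow> half \<Rightarrow> bool" where
  "is_black B h \<longleftrightarrow> edge_of \<Lambda> h \<in> B"

context
  fixes b assumes fpl: "fpl b"
begin

lemma fpl_in_H: "b h \<Longrightarrow> h \<in> H"
  and fpl_mate: "h \<in> H \<Longrightarrow> b (m h) = b h"
  and fpl_quartic: "h \<in> H \<Longrightarrow> h \<notin> X \<Longrightarrow> quartic \<Lambda> h \<Longrightarrow>
    exactly_two (b h) (b (c h)) (b (c (c h))) (b (c (c (c h))))"
  and fpl_bivalent: "h \<in> H \<Longrightarrow> h \<notin> X \<Longrightarrow> bivalent \<Lambda> h \<Longrightarrow> b (c h) = (\<not> b h)"
  and fpl_next_ext: "j \<in> J \<Longrightarrow> b (e (nx j)) = (\<not> b (e j))"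
  using fpl unfolding fpl_def by blast+

lemma fpl_mate_black: "b h \<Longrightarrow> b (m h)"
  using fpl_in_H fpl_mate by blast

lemma fpl_ext_parity:
  assumes "j \<in> J" shows "b (e j) \<longleftrightarrow> (b (e 1) \<longleftrightarrow> odd j)"
proof -
  have "1 \<le> j" "j \<le> 2 * N" using assms by auto
  then show ?thesis
  proof (induction j rule: dec_induct)
    case base then show ?case by simp
  next
    case (step n)
    then have "n \<in> J" "nx n = Suc n" by (auto simp: next_ext_def)
    then show ?case using step fpl_next_ext[of n] by auto
  qed
qed

end

lemma edge_of_mate: "h \<in> H \<Longrightarrow> edge_of \<Lambda> (m h) = edge_of \<Lambda> h"
  by (auto simp: edge_of_def mate_mate)

lemma edge_of_eqD: "edge_of \<Lambda> h = edge_of \<Lambda> g \<Longrightarrow> h = g \<or> h = m g"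
  by (auto simp: edge_of_def)

lemma is_black_edges_of:
  assumes "\<And>h. b h \<Longrightarrow> h \<in> H" "\<And>h. h \<in> H \<Longrightarrow> b (m h) = b h"
  shows "is_black (edges_of b) = b"
proof (intro ext iffI)
  fix h assume "is_black (edges_of b) h"
  then obtain g where "g \<in> H" "b g" "edge_of \<Lambda> h = edge_of \<Lambda> g"
    by (auto simp: is_black_def edges_of_def)
  then show "b h" using edge_of_eqD assms by metis
next
  fix h assume "b h"
  then show "is_black (edges_of b) h" using assms by (auto simp: is_black_def edges_of_def)
qed

lemma edges_of_is_black: "B \<subseteq> edge_of \<Lambda> ` H \<Longrightarrow> edges_of (is_black B) = B"
  by (auto simp: edges_of_def is_black_def)

lemma black_at_eq: "black_at \<Lambda> B h = {g \<in> vertex_of \<Lambda> h. is_black B g}"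
  by (simp add: black_at_def is_black_def)

lemma black_at_quartic:
  assumes "quartic \<Lambda> h"
  shows "card (black_at \<Lambda> B h) = 2 \<longleftrightarrow>
    exactly_two (is_black B h) (is_black B (c h)) (is_black B (c (c h))) (is_black B (c (c (c h))))"
  unfolding black_at_eq vertex_of_quartic(1)[OF assms]
  by (rule card_filter_four(1)[OF vertex_of_quartic(2)[OF assms]])

lemma black_at_bivalent:
  assumes "bivalent \<Lambda> h"
  shows "card (black_at \<Lambda> B h) = 1 \<longleftrightarrow> is_black B (c h) = (\<not> is_black B h)"
proof -
  have "h \<noteq> c h" using assms by (auto simp: bivalent_def)
  then show ?thesis unfolding black_at_eq vertex_of_bivalent[OF assms] card_filter_two[OF \<open>h \<noteq> c h\<close>] by auto
qed

lemma vertex_condition_iff: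
  assumes "h \<in> H"
  shows "(card (vertex_of \<Lambda> h) = 4 \<longrightarrow> card (black_at \<Lambda> B h) = 2) \<and>
      (card (vertex_of \<Lambda> h) = 2 \<longrightarrow> card (black_at \<Lambda> B h) = 1) \<longleftrightarrow>
    (h \<notin> X \<longrightarrow>
        (quartic \<Lambda> h \<longrightarrow>
          exactly_two (is_black B h) (is_black B (c h)) (is_black B (c (c h))) (is_black B (c (c (c h))))) \<and>
        (bivalent \<Lambda> h \<longrightarrow> is_black B (c h) = (\<not> is_black B h)))"
proof -
  consider (external) "h \<in> X" | (quartic) "h \<notin> X" "quartic \<Lambda> h" | (bivalent) "h \<notin> X" "bivalent \<Lambda> h"
    using degree assms by blast
  then show ?thesis
  proof cases
    case external then show ?thesis by (simp add: vertex_of_ext)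
  next
    case quartic
    then have "card (vertex_of \<Lambda> h) = 4" using vertex_of_quartic by simp
    then show ?thesis using quartic quartic_not_bivalent black_at_quartic by simp
  next
    case bivalent
    then have "card (vertex_of \<Lambda> h) = 2" using vertex_of_bivalent by (auto simp: bivalent_def)
    then show ?thesis using bivalent quartic_not_bivalent black_at_bivalent by auto
  qed
qed

lemma Fpl_iff: "B \<in> Fpl \<Lambda> \<longleftrightarrow> B \<subseteq> edge_of \<Lambda> ` H \<and> fpl (is_black B)"
proof -
  have black_in_H: "\<forall>h. is_black B h \<longrightarrow> h \<in> H" if "B \<subseteq> edge_of \<Lambda> ` H"
    using that edge_of_eqD mate_in unfolding is_black_def by blast
  have black_mate: "\<forall>h\<in>H. is_black B (m h) = is_black B h" by (simp add: is_black_def edge_of_mate)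
  have black_ext: "black_ext \<Lambda> B j = is_black B (e j)" for j by (simp add: black_ext_def is_black_def)
  have "B \<in> Fpl \<Lambda> \<longleftrightarrow> B \<subseteq> edge_of \<Lambda> ` H \<and>
     (\<forall>h\<in>H. h \<notin> X \<longrightarrow>
        (quartic \<Lambda> h \<longrightarrow>
          exactly_two (is_black B h) (is_black B (c h)) (is_black B (c (c h))) (is_black B (c (c (c h))))) \<and>
        (bivalent \<Lambda> h \<longrightarrow> is_black B (c h) = (\<not> is_black B h))) \<and>
     (\<forall>j\<in>J. is_black B (e (nx j)) = (\<not> is_black B (e j)))"
    unfolding Fpl_def mem_Collect_eq black_ext
    by (intro conj_cong refl ball_cong vertex_condition_iff) auto
  then show ?thesis unfolding fpl_def using black_in_H black_mate by blast
qed

lemma fpl_edges_of: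
  assumes "fpl b" shows "edges_of b \<in> Fpl \<Lambda>" "is_black (edges_of b) = b"
proof -
  show "is_black (edges_of b) = b"
    by (rule is_black_edges_of) (fact fpl_in_H[OF assms] fpl_mate[OF assms])+
  then show "edges_of b \<in> Fpl \<Lambda>" using assms Fpl_iff by (auto simp: edges_of_def)
qed

lemma Fpl_is_black:
  assumes "B \<in> Fpl \<Lambda>" shows "fpl (is_black B)" "edges_of (is_black B) = B"
  using assms Fpl_iff edges_of_is_black by auto

lemma finite_Fpl: "finite (Fpl \<Lambda>)"
proof (rule finite_subset)
  show "Fpl \<Lambda> \<subseteq> Pow (edge_of \<Lambda> ` H)" using Fpl_iff by blast
  show "finite (Pow (edge_of \<Lambda> ` H))" using finite_halves by simp
qed

section \<open>Black paths and regions\<close>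

definition path_labelling :: "(half \<Rightarrow> bool) \<Rightarrow> (half \<Rightarrow> bool) \<Rightarrow> bool" where
  "path_labelling b l \<longleftrightarrow>
     (\<forall>h\<in>H. b h \<longrightarrow> l (m h) = l h \<and> (\<forall>g\<in>vertex_of \<Lambda> h. b g \<longrightarrow> l g = l h))"

abbreviation path :: "(half \<Rightarrow> bool) \<Rightarrow> half \<Rightarrow> half set" where
  "path b h \<equiv> black_path \<Lambda> (edges_of b) h"

definition ends :: "(half \<Rightarrow> bool) \<Rightarrow> half set" where
  "ends b = {x \<in> H. b x \<and> (x \<in> X \<or> bivalent \<Lambda> x)}"

definition other_black :: "(half \<Rightarrow> bool) \<Rightarrow> half \<Rightarrow> half" where
  "other_black b h =
     (if h \<in> ends b then h else if b (c h) then c h else if b (c (c h)) then c (c h) else c (c (c h)))"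

definition region_labelling :: "half set \<Rightarrow> (half \<Rightarrow> bool) \<Rightarrow> bool" where
  "region_labelling C \<chi> \<longleftrightarrow>
     (\<forall>g\<in>H. (m g \<notin> X \<longrightarrow> \<chi> (c (m g)) = \<chi> g) \<and> (g \<notin> C \<longrightarrow> \<chi> (m g) = \<chi> g))"

lemma path_labelling_mate: "path_labelling b l \<Longrightarrow> h \<in> H \<Longrightarrow> b h \<Longrightarrow> l (m h) = l h"
  and path_labelling_vertex:
    "path_labelling b l \<Longrightarrow> h \<in> H \<Longrightarrow> b h \<Longrightarrow> g \<in> vertex_of \<Lambda> h \<Longrightarrow> b g \<Longrightarrow> l g = l h"
  unfolding path_labelling_def by blast+

lemma self_in_path: "h \<in> path b h"
  by (simp add: black_path_def)

context
  fixes b :: "half \<Rightarrow> bool"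
  assumes b: "fpl b"
begin

lemma black_step_iff:
  "(h, g) \<in> black_step \<Lambda> (edges_of b) \<longleftrightarrow> h \<in> H \<and> b h \<and> (g = m h \<or> g \<in> vertex_of \<Lambda> h \<and> b g)"
  using fpl_edges_of(2)[OF b] unfolding black_step_def black_at_def is_black_def
  by (auto simp: fun_eq_iff)

lemma path_labelling_on_path:
  assumes "b s" "path_labelling b l" "x \<in> path b s"
  shows "b x \<and> l x = l s"
proof -
  have "(s, x) \<in> (black_step \<Lambda> (edges_of b))\<^sup>*" using assms(3) by (simp add: black_path_def)
  then show ?thesis
  proof (induction rule: rtrancl_induct)
    case base then show ?case using assms(1) by blast
  next
    case (step y z)
    then show ?case
      using assms(2) fpl_mate[OF b] unfolding black_step_iff path_labelling_def by metis
  qed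
qed

lemma path_black: "b s \<Longrightarrow> x \<in> path b s \<Longrightarrow> b x"
  using path_labelling_on_path[of s "\<lambda>_. True"] by (simp add: path_labelling_def)

lemma path_subset_H: "b s \<Longrightarrow> x \<in> path b s \<Longrightarrow> x \<in> H"
  using path_black fpl_in_H[OF b] by blast

lemma path_step: "x \<in> path b s \<Longrightarrow> (x, y) \<in> black_step \<Lambda> (edges_of b) \<Longrightarrow> y \<in> path b s"
  unfolding black_path_def by (auto intro: rtrancl_into_rtrancl)

lemma path_mate_iff: "b s \<Longrightarrow> x \<in> H \<Longrightarrow> m x \<in> path b s \<longleftrightarrow> x \<in> path b s"
  using path_step[of x s "m x"] path_step[of "m x" s x] path_black[of s] fpl_mate[OF b]
    mate_in[of x] mate_mate[of x] black_step_iff by metis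

lemma path_vertex: "b s \<Longrightarrow> x \<in> path b s \<Longrightarrow> g \<in> vertex_of \<Lambda> x \<Longrightarrow> b g \<Longrightarrow> g \<in> path b s"
  using path_step path_black path_subset_H black_step_iff by metis

lemma path_labelling_path:
  assumes "b s" shows "path_labelling b (\<lambda>x. x \<in> path b s)"
  unfolding path_labelling_def
proof (intro ballI impI conjI)
  fix x assume x: "x \<in> H" "b x"
  show "(m x \<in> path b s) = (x \<in> path b s)" by (rule path_mate_iff[OF assms x(1)])
  fix g assume g: "g \<in> vertex_of \<Lambda> x" "b g"
  then have "x \<in> vertex_of \<Lambda> g" using vertex_of_eq[OF x(1)] self_in_vertex_of by blast
  then show "(g \<in> path b s) = (x \<in> path b s)" using path_vertex[OF assms] g x(2) by blast
qed

lemma path_eq: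
  assumes "b s" "t \<in> path b s" shows "path b t = path b s"
proof
  have t: "b t" by (rule path_black[OF assms])
  have "s \<in> path b t"
    using path_labelling_on_path[OF assms(1) path_labelling_path[OF t] assms(2)] self_in_path by simp
  then show "path b s \<subseteq> path b t"
    using path_labelling_on_path[OF assms(1) path_labelling_path[OF t]] by blast
  show "path b t \<subseteq> path b s"
    using path_labelling_on_path[OF t path_labelling_path[OF assms(1)]] assms(2) by blast
qed

context
  fixes h assumes h: "h \<in> H" "b h"
begin

lemma not_end_quartic: "h \<notin> ends b \<Longrightarrow> h \<notin> X \<and> quartic \<Lambda> h"
  using h degree by (auto simp: ends_def)

lemma not_end_ccw: "h \<notin> ends b \<Longrightarrow>
    c h \<in> H \<and> c h \<notin> X \<and> c (c h) \<in> H \<and> c (c h) \<notin> X \<and> c (c (c h)) \<in> H \<and> c (c (c h)) \<notin> X"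
  using h not_end_quartic ccw_in ccw_notin_X by blast

lemma not_end_exactly_two: "h \<notin> ends b \<Longrightarrow> exactly_two (b h) (b (c h)) (b (c (c h))) (b (c (c (c h))))"
  using h not_end_quartic fpl_quartic[OF b] by blast

lemma other_black_in: "other_black b h \<in> H"
  using h not_end_ccw unfolding other_black_def by simp

lemma other_black_black: "b (other_black b h)"
  using h not_end_exactly_two unfolding other_black_def exactly_two_def by (auto split: if_splits)

lemma other_black_in_ends_iff: "other_black b h \<in> ends b \<longleftrightarrow> h \<in> ends b"
proof (cases "h \<in> ends b")
  case True then show ?thesis by (simp add: other_black_def)
next
  case False
  have "other_black b h \<notin> X" using False not_end_ccw unfolding other_black_def by simp
  moreover have "quartic \<Lambda> (other_black b h)"
    using False not_end_quartic quartic_ccw unfolding other_black_def by simp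
  ultimately show ?thesis using False quartic_not_bivalent unfolding ends_def by blast
qed

lemma other_black_eq_self_iff: "other_black b h = h \<longleftrightarrow> h \<in> ends b"
proof (cases "h \<in> ends b")
  case True then show ?thesis by (simp add: other_black_def)
next
  case False
  then show ?thesis
    using not_end_quartic vertex_of_quartic(2)[of \<Lambda> h] unfolding other_black_def by auto
qed

lemma other_black_other_black: "other_black b (other_black b h) = h"
proof (cases "h \<in> ends b")
  case True then show ?thesis by (simp add: other_black_def)
next
  case False
  then have "other_black b h \<notin> ends b" using other_black_in_ends_iff by blast
  moreover have "c (c (c (c h))) = h" by (rule ccw_four[OF h(1)])
  ultimately show ?thesis
    using False not_end_exactly_two h(2) unfolding other_black_def exactly_two_def
    by (auto split: if_splits)
qed

lemma black_at_vertex: "{g \<in> vertex_of \<Lambda> h. b g} = {h, other_black b h}"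
proof (cases "h \<in> ends b")
  case True
  then consider "h \<in> X" | "h \<notin> X" "bivalent \<Lambda> h" by (auto simp: ends_def)
  then show ?thesis
    using True h fpl_bivalent[OF b] by cases (auto simp: other_black_def vertex_of_ext vertex_of_bivalent)
next
  case False
  then show ?thesis
    using not_end_exactly_two not_end_quartic h(2) vertex_of_quartic[of \<Lambda> h]
    unfolding other_black_def exactly_two_def by (auto split: if_splits)
qed

end

end

lemma region_labelling_face: "region_labelling C \<chi> \<Longrightarrow> g \<in> H \<Longrightarrow> m g \<notin> X \<Longrightarrow> \<chi> (c (m g)) = \<chi> g"
  and region_labelling_cross: "region_labelling C \<chi> \<Longrightarrow> g \<in> H \<Longrightarrow> g \<notin> C \<Longrightarrow> \<chi> (m g) = \<chi> g"
  unfolding region_labelling_def by blast+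

lemma region_labelling_turn: "region_labelling C \<chi> \<Longrightarrow> y \<in> H \<Longrightarrow> y \<notin> X \<Longrightarrow> \<chi> (c y) = \<chi> (m y)"
  using region_labelling_face mate_in mate_mate by metis

lemma region_labelling_boundary:
  assumes "region_labelling C \<chi>" "j \<in> J" shows "\<chi> (m (e (nx j))) = \<chi> (e j)"
proof -
  note face = region_labelling_face[OF assms(1)]
  have first_half: "e j \<in> H" "m (e j) \<notin> X" using ext_in mate_notin_X ext_in_X assms(2) by blast+
  from assms(2) show ?thesis
  proof (cases rule: boundary_cases)
    case two then show ?thesis using face[OF first_half] by simp
  next
    case three
    then show ?thesis using face[OF first_half] face[OF face_step_in[OF first_half(1)]] by simp
  qed
qed

lemma region_labelling_next_ext:
  assumes "region_labelling C \<chi>" "j \<in> J" "e (nx j) \<notin> C" shows "\<chi> (e (nx j)) = \<chi> (e j)"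
  using region_labelling_boundary[OF assms(1,2)] region_labelling_cross[OF assms(1) _ assms(3)]
    ext_in[OF next_ext_in] by simp

lemma region_labelling_step:
  "region_labelling C \<chi> \<longleftrightarrow> (\<forall>(x, y)\<in>region_step \<Lambda> C. \<chi> y = \<chi> x)"
  unfolding region_labelling_def region_step_def by auto

lemma region_labelling_region: "region_labelling C (\<lambda>x. x \<in> region \<Lambda> C h)"
proof -
  let ?R = "region_step \<Lambda> C \<union> (region_step \<Lambda> C)\<inverse>"
  have "((h, y) \<in> ?R\<^sup>*) = ((h, x) \<in> ?R\<^sup>*)" if "(x, y) \<in> region_step \<Lambda> C" for x y
  proof -
    have "(x, y) \<in> ?R" "(y, x) \<in> ?R" using that by auto
    then show ?thesis by (meson rtrancl.rtrancl_into_rtrancl)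
  qed
  then show ?thesis unfolding region_labelling_step region_def by auto
qed

lemma region_iff: "g \<in> region \<Lambda> C h \<longleftrightarrow> (\<forall>\<chi>. region_labelling C \<chi> \<longrightarrow> \<chi> g = \<chi> h)"
proof
  assume "g \<in> region \<Lambda> C h"
  then have "(h, g) \<in> (region_step \<Lambda> C \<union> (region_step \<Lambda> C)\<inverse>)\<^sup>*" by (simp add: region_def)
  then show "\<forall>\<chi>. region_labelling C \<chi> \<longrightarrow> \<chi> g = \<chi> h"
  proof (induction rule: rtrancl_induct)
    case (step y z)
    have "\<chi> z = \<chi> y" if "region_labelling C \<chi>" for \<chi>
      using step.hyps(2) that unfolding region_labelling_step by blast
    then show ?case using step.IH by metis
  qed simp
next
  assume "\<forall>\<chi>. region_labelling C \<chi> \<longrightarrow> \<chi> g = \<chi> h"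
  moreover have "h \<in> region \<Lambda> C h" by (simp add: region_def)
  ultimately show "g \<in> region \<Lambda> C h" using region_labelling_region by blast
qed

lemma bounds_region_labelling: "bounds \<Lambda> C \<chi> \<Longrightarrow> region_labelling C \<chi>"
  unfolding bounds_def region_labelling_def by blast

text \<open>The two sides of a path are continued through each of its inner vertices.\<close>

lemma region_labelling_other_black:
  assumes b: "fpl b" and h: "h \<in> H" "b h" "h \<notin> ends b"
    and \<chi>: "region_labelling C \<chi>" and C: "\<And>x. x \<in> C \<Longrightarrow> b x"
  shows "\<chi> (other_black b h) = \<chi> (m h)" "\<chi> (m (other_black b h)) = \<chi> h"
proof -
  have cross: "\<chi> (m y) = \<chi> y" if "y \<in> H" "\<not> b y" for y
    using region_labelling_cross[OF \<chi> that(1)] that(2) C by blast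
  note inner = not_end_quartic[OF b h] not_end_ccw[OF b h]
  have turn: "\<chi> (c h) = \<chi> (m h)" "\<chi> (c (c h)) = \<chi> (m (c h))"
    "\<chi> (c (c (c h))) = \<chi> (m (c (c h)))" "\<chi> h = \<chi> (m (c (c (c h))))"
    using region_labelling_turn[OF \<chi>] inner h(1) ccw_four[OF h(1)] by metis+
  show "\<chi> (other_black b h) = \<chi> (m h)" "\<chi> (m (other_black b h)) = \<chi> h"
    using turn cross inner not_end_exactly_two[OF b h] h(2,3)
    unfolding other_black_def exactly_two_def by (auto split: if_splits)
qed

section \<open>Gyration\<close>

text \<open>\<open>gyr q\<close> acts on the faces of parity \<open>q\<close>; a half-edge of the other parity is seen from the face across
  its edge.\<close>

definition frozen :: "(half \<Rightarrow> bool) \<Rightarrow> half \<Rightarrow> bool" where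
  "frozen b h \<longleftrightarrow> (\<forall>x\<in>face h. b (f x) \<noteq> b x \<and> x \<notin> X)"

definition gyr :: "bool \<Rightarrow> (half \<Rightarrow> bool) \<Rightarrow> half \<Rightarrow> bool" where
  "gyr q b h \<longleftrightarrow> h \<in> H \<and> (b h \<longleftrightarrow> frozen b (if par h = q then h else m h))"

lemma frozen_face: "h \<in> H \<Longrightarrow> x \<in> face h \<Longrightarrow> frozen b x = frozen b h"
  unfolding frozen_def by (simp add: face_eq)

lemma frozen_face_step: "h \<in> H \<Longrightarrow> frozen b (f h) = frozen b h"
  by (rule frozen_face[OF _ orbit.base])

lemma frozen_alternating: "h \<in> H \<Longrightarrow> frozen b h \<Longrightarrow> b (f h) \<noteq> b h"
  using self_in_face unfolding frozen_def by blast

lemma gyr_active: "h \<in> H \<Longrightarrow> par h = q \<Longrightarrow> gyr q b h \<longleftrightarrow> (b h \<longleftrightarrow> frozen b h)"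
  by (simp add: gyr_def)

lemma frozen_gyr:
  assumes "h \<in> H" "par h = q" shows "frozen (gyr q b) h = frozen b h"
proof -
  have "(gyr q b (f x) \<noteq> gyr q b x) \<longleftrightarrow> (b (f x) \<noteq> b x)" if "x \<in> face h" for x
  proof -
    have "x \<in> H" "par x = q" using that assms face_subset_H par_face by blast+
    then show ?thesis by (auto simp: gyr_active frozen_face_step par_face_step face_step_in)
  qed
  then show ?thesis unfolding frozen_def by blast
qed

lemma corner_face_step:
  assumes "h \<in> H" "h \<notin> X" "par (c h) = q"
  shows "m h \<in> H" "f (m h) = c h" "c h \<in> H" "par (m h) = q"
  using assms mate_in face_step_mate_inner ccw_in par_face_step by metis+

lemma ext_not_frozen:
  assumes "j \<in> J"
  shows "\<not> frozen b (e j)" "\<not> frozen b (m (e (nx j)))" "m (e (nx j)) \<in> face (e j)"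
proof -
  show ext: "\<not> frozen b (e j)" using self_in_face ext_in ext_in_X assms unfolding frozen_def by blast
  have "m (e (nx j)) \<in> H" "f (m (e (nx j))) = e j"
    using face_step_mate_ext assms ext_in mate_in next_ext_in by auto
  then show "\<not> frozen b (m (e (nx j)))" "m (e (nx j)) \<in> face (e j)"
    using ext frozen_face_step face_face_step self_in_face by metis+
qed

context
  fixes b :: "half \<Rightarrow> bool"
  assumes b: "fpl b"
begin

lemma gyr_mate: "h \<in> H \<Longrightarrow> gyr q b (m h) = gyr q b h"
  using mate_in[of h] mate_mate[of h] par_mate[of h] fpl_mate[OF b, of h] unfolding gyr_def by simp

lemma gyr_gyr: "gyr q (gyr q b) = b"
proof
  fix h
  show "gyr q (gyr q b) h = b h"
  proof (cases "h \<in> H")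
    case True
    let ?g = "if par h = q then h else m h"
    have "?g \<in> H" "par ?g = q" using True mate_in par_mate by auto
    then have "frozen (gyr q b) ?g = frozen b ?g" by (rule frozen_gyr)
    then show ?thesis using True by (auto simp: gyr_def)
  next
    case False
    then show ?thesis using fpl_in_H[OF b] by (auto simp: gyr_def)
  qed
qed

lemma gyr_ext:
  assumes "j \<in> J" shows "gyr q b (e j) = (\<not> b (e j))"
proof -
  obtain i where "i \<in> J" "j = nx i" using next_prev_ext prev_ext_in assms by metis
  then have "\<not> frozen b (m (e j))" using ext_not_frozen(2) by simp
  then show ?thesis using ext_not_frozen(1)[OF assms] ext_in[OF assms] by (simp add: gyr_def)
qed

context
  fixes h q assumes h: "h \<in> H" "h \<notin> X" "par (c h) = q"
begin

lemma gyr_corner: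
  "gyr q b h \<longleftrightarrow> (b h \<longleftrightarrow> frozen b (m h))" "gyr q b (c h) \<longleftrightarrow> (b (c h) \<longleftrightarrow> frozen b (m h))"
  using gyr_active[of "m h" q b] gyr_active[of "c h" q b] gyr_mate[OF h(1)] fpl_mate[OF b h(1)]
    frozen_face_step[of "m h" b] corner_face_step[OF h] h(3) by simp_all

lemma frozen_corner: "frozen b (m h) \<Longrightarrow> b (c h) \<noteq> b h"
  using frozen_alternating[of "m h" b] corner_face_step[OF h] fpl_mate[OF b h(1)] by simp

end

lemma gyr_quartic:
  assumes "h \<in> H" "h \<notin> X" "quartic \<Lambda> h"
  shows "exactly_two (gyr q b h) (gyr q b (c h)) (gyr q b (c (c h))) (gyr q b (c (c (c h))))"
proof -
  have active: "exactly_two (gyr q b h) (gyr q b (c h)) (gyr q b (c (c h))) (gyr q b (c (c (c h))))"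
    if h: "h \<in> H" "h \<notin> X" "quartic \<Lambda> h" and first: "par (c h) = q" for h
  proof -
    have far: "c (c h) \<in> H" "c (c h) \<notin> X" "par (c (c (c h))) = q"
      using h first par_ccw ccw_in ccw_notin_X by (metis DiffI)+
    show ?thesis
      using gyr_corner[OF h(1,2) first] frozen_corner[OF h(1,2) first] gyr_corner[OF far]
        frozen_corner[OF far] fpl_quartic[OF b h] unfolding exactly_two_def by (smt (verit))
  qed
  show ?thesis
  proof (cases "par (c h) = q")
    case True then show ?thesis using active assms by blast
  next
    case False
    have "c h \<in> H" "c h \<notin> X" using assms ccw_in ccw_notin_X by blast+
    moreover from this have "par (c (c h)) = q" using False par_ccw by simp
    ultimately show ?thesis
      using active[OF _ _ quartic_ccw[OF assms(3)]] assms(3) unfolding quartic_def exactly_two_def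
      by (smt (verit))
  qed
qed

lemma gyr_bivalent:
  assumes "h \<in> H" "h \<notin> X" "bivalent \<Lambda> h" shows "gyr q b (c h) = (\<not> gyr q b h)"
proof (cases "par (c h) = q")
  case True
  then show ?thesis using gyr_corner[OF assms(1,2)] fpl_bivalent[OF b assms] by auto
next
  case False
  have next_half: "c h \<in> H" "c h \<notin> X" using assms ccw_in ccw_notin_X by blast+
  moreover from this have "par (c (c h)) = q" using False par_ccw by simp
  moreover have "c (c h) = h" using assms by (simp add: bivalent_def)
  ultimately show ?thesis using gyr_corner[OF next_half] fpl_bivalent[OF b assms] by auto
qed

lemma gyr_fpl: "fpl (gyr q b)"
  unfolding fpl_def
proof (intro conjI ballI allI impI)
  show "gyr q b h \<Longrightarrow> h \<in> H" for h by (simp add: gyr_def)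
  show "gyr q b (e (nx j)) = (\<not> gyr q b (e j))" if "j \<in> J" for j
    using gyr_ext[OF next_ext_in] gyr_ext[OF that] fpl_next_ext[OF b that] by simp
qed (use gyr_mate gyr_quartic gyr_bivalent in blast)+

lemma boundary_face_period:
  assumes "x \<in> H" "face x \<inter> X \<noteq> {}" shows "f (f x) = x \<or> f (f (f x)) = x"
proof -
  obtain j where j: "j \<in> J" "e j \<in> face x"
    using assms(2) next_ext_in by (metis disjoint_iff ext_next_cases)
  have x: "x \<in> face (e j)" by (rule face_sym[OF assms(1) j(2)])
  from j(1) show ?thesis
  proof (cases rule: boundary_cases)
    case two
    then show ?thesis using funpow_eq_self_in_orbit[of 2 f "e j", OF _ x] by (simp add: eval_nat_numeral)
  next
    case three
    then show ?thesis using funpow_eq_self_in_orbit[of 3 f "e j", OF _ x] by (simp add: eval_nat_numeral)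
  qed
qed

text \<open>The black half-edges of a non-frozen face are consecutive: a face with four sides has two neighbouring
  edges of the same colour, and a shorter one has no opposite edges at all.\<close>

lemma constant_on_black_of_face:
  assumes g: "g \<in> H" "\<not> frozen b g"
    and step: "\<And>x. x \<in> face g \<Longrightarrow> b x \<Longrightarrow> b (f x) \<Longrightarrow> \<mu> (f x) = \<mu> x"
    and xy: "x \<in> face g" "y \<in> face g" "b x" "b y"
  shows "\<mu> x = (\<mu> y :: bool)"
proof -
  have x: "x \<in> H" "face x = face g" by (rule face_subset_H[OF g(1) xy(1)] face_eq[OF g(1) xy(1)])+
  then have "y \<in> face x" using xy(2) by simp
  with x(1) show ?thesis
  proof (cases rule: face_cases)
    case same then show ?thesis by simp
  next
    case next_step then show ?thesis using step[of x] xy by simp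
  next
    case prev_step then show ?thesis using step[of y] xy by simp
  next
    case opposite
    have face: "face x = {x, f x, y, f y}"
      using orbit_eq_image_funpow[of 4 f x] opposite
      by (simp add: eval_nat_numeral lessThan_Suc insert_commute)
    have in_face: "f x \<in> face g" "f y \<in> face g" using face x(2) by auto
    show ?thesis
    proof (cases "face g \<inter> X = {}")
      case True
      then obtain z where z: "z \<in> face g" "b (f z) = b z" using g unfolding frozen_def by blast
      then have "b (f x) \<or> b (f y)" using face x(2) xy opposite by auto
      then show ?thesis using step[of x] step[of "f x"] step[of y] step[of "f y"] xy in_face opposite by auto
    next
      case False
      then have "y = x \<or> f y = x" using boundary_face_period[OF x(1)] x(2) opposite(1) by auto
      then show ?thesis using step[of y] xy by auto
    qed
  qed
qed

end

section \<open>Transport of path labels\<close>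

text \<open>A labelling of the black paths is carried through a gyration face by face: a non-frozen face
  carries at most one path piece before and after, with the same end points.\<close>

definition transport :: "bool \<Rightarrow> (half \<Rightarrow> bool) \<Rightarrow> (half \<Rightarrow> bool) \<Rightarrow> half \<Rightarrow> bool" where
  "transport q b l h = (let g = if par h = q then h else m h in
     if frozen b g then l g else (\<exists>x\<in>face g. b x \<and> l x))"

lemma transport_active:
  "par g = q \<Longrightarrow> transport q b l g = (if frozen b g then l g else (\<exists>x\<in>face g. b x \<and> l x))"
  unfolding transport_def by simp

lemma transport_mate: "h \<in> H \<Longrightarrow> transport q b l (m h) = transport q b l h"
  by (simp add: transport_def par_mate mate_mate)

lemma transport_face_step:
  assumes "g \<in> H" "par g = q" "\<not> frozen b g" shows "transport q b l (f g) = transport q b l g"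
  using transport_active[of g q b l] transport_active[of "f g" q b l] par_face_step[OF assms(1)]
    frozen_face_step[OF assms(1)] face_face_step[OF assms(1)] assms(2,3) by simp

text \<open>Where a black path turns at the boundary of the disk, the edge colours alternate, so the face of an
  external edge has no two consecutive black half-edges across that edge.\<close>

lemma consecutive_black_inner:
  assumes b: "fpl b" and x: "x \<in> H" "b x" "b (f x)" shows "m x \<notin> X" "f x = c (m x)"
proof -
  show "m x \<notin> X"
  proof
    assume "m x \<in> X"
    then obtain j where j: "j \<in> J" "m x = e (nx j)" by (rule ext_next_cases)
    then have "f x = e j" using mate_mate[OF x(1)] face_step_mate_ext by metis
    then show False using x fpl_mate[OF b x(1)] fpl_next_ext[OF b j(1)] j by simp
  qed
  then show "f x = c (m x)" by (rule face_step_inner)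
qed

context
  fixes b l :: "half \<Rightarrow> bool" and q :: bool
  assumes b: "fpl b" and l: "path_labelling b l"
begin

lemma path_labelling_on_face:
  assumes g: "g \<in> H" "\<not> frozen b g" and xy: "x \<in> face g" "y \<in> face g" "b x" "b y"
  shows "l x = l y"
proof (rule constant_on_black_of_face[OF b g _ xy])
  fix x assume x: "x \<in> face g" "b x" "b (f x)"
  have in_H: "x \<in> H" by (rule face_subset_H[OF g(1) x(1)])
  have "c (m x) \<in> vertex_of \<Lambda> (m x)" by (rule ccw_in_vertex_of)
  then show "l (f x) = l x"
    using path_labelling_mate[OF l in_H x(2)] path_labelling_vertex[OF l mate_in[OF in_H]]
      fpl_mate[OF b in_H] x consecutive_black_inner(2)[OF b in_H x(2,3)] by simp
qed

lemma transport_not_frozen: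
  assumes "g \<in> H" "par g = q" "\<not> frozen b g" "x \<in> face g" "b x"
  shows "transport q b l g = l x"
proof -
  have "transport q b l g = (\<exists>y\<in>face g. b y \<and> l y)" using assms by (simp add: transport_active)
  also have "\<dots> = l x" using path_labelling_on_face[OF assms(1,3) _ assms(4) _ assms(5)] assms(4,5) by blast
  finally show ?thesis .
qed

context
  fixes h assumes h: "h \<in> H" "h \<notin> X" "par (c h) = q"
begin

lemma transport_corner_frozen:
  assumes "frozen b (m h)" "u \<in> {h, c h}" "b u" shows "transport q b l u = l u"
proof (cases "u = h")
  case True
  have "transport q b l (m h) = l (m h)"
    using corner_face_step[OF h] assms(1) by (simp add: transport_active)
  then show ?thesis using transport_mate[OF h(1), of q b l] path_labelling_mate[OF l h(1)] assms(3) True by simp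
next
  case False
  then show ?thesis
    using corner_face_step[OF h] frozen_face_step[of "m h" b] assms h(3) by (auto simp: transport_active)
qed

lemma transport_corner_not_frozen:
  assumes "\<not> frozen b (m h)" "w \<in> {h, c h}" shows "transport q b l w = transport q b l (m h)"
  using assms transport_mate[OF h(1)] transport_face_step[of "m h" q b l] corner_face_step[OF h] by auto

lemma transport_corner:
  assumes u: "u \<in> {h, c h}" "b u" and w: "w \<in> {h, c h}" "gyr q b w" and one: "b (c h) \<noteq> b h"
  shows "transport q b l w = l u"
proof (cases "frozen b (m h)")
  case True
  then have "b w" using gyr_corner[OF b h] w by auto
  then have "w = u" using u w one by auto
  then show ?thesis using transport_corner_frozen[OF True u] by simp
next
  case False
  define x where "x = (if u = h then m h else c h)"
  have "x \<in> face (m h)" "b x" "l x = l u"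
    using u corner_face_step[OF h] self_in_face orbit.base[of f "m h"] fpl_mate[OF b h(1)]
      path_labelling_mate[OF l h(1)] unfolding x_def by auto
  then show ?thesis
    using transport_not_frozen[OF _ _ False] corner_face_step[OF h] transport_corner_not_frozen[OF False w(1)]
    by simp
qed

lemma transport_same_corner:
  assumes "gyr q b h" "gyr q b (c h)" shows "transport q b l (c h) = transport q b l h"
proof -
  have "\<not> frozen b (m h)" using gyr_corner[OF b h] frozen_corner[OF b h] assms by blast
  then show ?thesis using transport_corner_not_frozen[of h] transport_corner_not_frozen[of "c h"] by simp
qed

end

lemma transport_quartic:
  assumes v: "v \<in> H" "v \<notin> X" "quartic \<Lambda> v" "par (c v) = q"
    and xy: "x \<in> vertex_of \<Lambda> v" "y \<in> vertex_of \<Lambda> v" "gyr q b x" "gyr q b y"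
  shows "transport q b l x = transport q b l y"
proof -
  let ?w = "c (c v)"
  have near: "v \<in> H" "v \<notin> X" "par (c v) = q" using v by blast+
  have far: "?w \<in> H" "?w \<notin> X" "par (c ?w) = q"
    using v par_ccw ccw_in ccw_notin_X by (metis DiffI)+
  have two: "exactly_two (gyr q b v) (gyr q b (c v)) (gyr q b ?w) (gyr q b (c ?w))"
    by (rule gyr_quartic[OF b v(1-3)])
  have across: "transport q b l x = transport q b l y"
    if x: "x \<in> {v, c v}" "gyr q b x" and y: "y \<in> {?w, c ?w}" "gyr q b y" for x y
  proof -
    have "gyr q b v \<noteq> gyr q b (c v)" "gyr q b ?w \<noteq> gyr q b (c ?w)"
      using two x y unfolding exactly_two_def by (auto split: if_splits)
    then have one: "b (c v) \<noteq> b v" "b (c ?w) \<noteq> b ?w"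
      using gyr_corner[OF b near] gyr_corner[OF b far] by auto
    then obtain u u' where u: "u \<in> {v, c v}" "b u" "u' \<in> {?w, c ?w}" "b u'" by blast
    then have "u \<in> vertex_of \<Lambda> v" "u' \<in> vertex_of \<Lambda> v" using vertex_of_quartic(1)[OF v(3)] by auto
    then have "l u = l u'"
      using path_labelling_vertex[OF l _ u(2) _ u(4)] vertex_of_subset_H vertex_of_eq v(1) by metis
    then show ?thesis
      using transport_corner[OF near u(1,2) x one(1)] transport_corner[OF far u(3,4) y one(2)] by simp
  qed
  have "x \<in> {v, c v} \<union> {?w, c ?w}" "y \<in> {v, c v} \<union> {?w, c ?w}"
    using xy(1,2) vertex_of_quartic(1)[OF v(3)] by auto
  moreover have "transport q b l x = transport q b l y" if "x \<in> {v, c v}" "y \<in> {v, c v}"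
    using that transport_same_corner[OF near] xy(3,4) by auto
  moreover have "transport q b l x = transport q b l y" if "x \<in> {?w, c ?w}" "y \<in> {?w, c ?w}"
    using that transport_same_corner[OF far] xy(3,4) by auto
  ultimately show ?thesis using across[of x y] across[of y x] xy(3,4) by blast
qed

lemma path_labelling_transport: "path_labelling (gyr q b) (transport q b l)"
  unfolding path_labelling_def
proof (intro ballI impI conjI)
  fix h assume h: "h \<in> H" "gyr q b h"
  show "transport q b l (m h) = transport q b l h" using transport_mate h by blast
  fix g assume g: "g \<in> vertex_of \<Lambda> h" "gyr q b g"
  consider (external) "h \<in> X" | (active) "h \<notin> X" "quartic \<Lambda> h" "par (c h) = q"
    | (inactive) "h \<notin> X" "quartic \<Lambda> h" "par (c h) \<noteq> q" | (bivalent) "h \<notin> X" "bivalent \<Lambda> h"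
    using degree h by blast
  then show "transport q b l g = transport q b l h"
  proof cases
    case external then show ?thesis using g vertex_of_ext by simp
  next
    case active
    then show ?thesis using transport_quartic[OF h(1) active g(1) self_in_vertex_of g(2) h(2)] by blast
  next
    case inactive
    have "c h \<in> H" "c h \<notin> X" "par (c (c h)) = q" using h inactive ccw_in ccw_notin_X par_ccw by auto
    moreover have "vertex_of \<Lambda> (c h) = vertex_of \<Lambda> h" using vertex_of_eq[OF h(1) ccw_in_vertex_of] .
    ultimately show ?thesis
      using transport_quartic[of "c h" g h] quartic_ccw inactive(2) g h self_in_vertex_of by metis
  next
    case bivalent
    then have "g = h" using gyr_bivalent[OF b h(1) bivalent, of q] g h vertex_of_bivalent by auto
    then show ?thesis by simp
  qed
qed

lemma transport_ext:
  assumes j: "j \<in> J" "par (e j) = q"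
  shows "b (e j) \<Longrightarrow> transport q b l (e (nx j)) = l (e j)"
    "b (e (nx j)) \<Longrightarrow> transport q b l (e j) = l (e (nx j))"
proof -
  have in_H: "e j \<in> H" "e (nx j) \<in> H" "m (e (nx j)) \<in> H" using ext_in next_ext_in j mate_in by blast+
  note not_frozen = ext_not_frozen(1,2)[OF j(1), of b] ext_not_frozen(3)[OF j(1)]
  have "par (m (e (nx j))) = q" using par_mate par_next_ext[OF j(1)] in_H j by simp
  moreover have "e j \<in> face (m (e (nx j)))" by (rule face_sym[OF in_H(1) not_frozen(3)])
  ultimately show "b (e j) \<Longrightarrow> transport q b l (e (nx j)) = l (e j)"
    using transport_not_frozen[OF in_H(3) _ not_frozen(2), of "e j"] transport_mate[OF in_H(2), of q b l]
    by simp
  show "transport q b l (e j) = l (e (nx j))" if "b (e (nx j))"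
    using transport_not_frozen[OF in_H(1) j(2) not_frozen(1,3)] fpl_mate_black[OF b that]
      path_labelling_mate[OF l in_H(2) that] by simp
qed

end

section \<open>Transport of link patterns\<close>

definition linked_ends :: "bool \<Rightarrow> (half \<Rightarrow> bool) \<Rightarrow> half \<Rightarrow> half \<Rightarrow> bool" where
  "linked_ends q b s s' \<longleftrightarrow> b s \<and> gyr q b s' \<and>
     (\<forall>l. path_labelling b l \<longrightarrow> transport q b l s' = l s) \<and>
     (\<forall>l. path_labelling (gyr q b) l \<longrightarrow> transport q (gyr q b) l s = l s')"

lemma linked_ends_gyr: "fpl b \<Longrightarrow> linked_ends q b s s' \<Longrightarrow> linked_ends q (gyr q b) s' s"
  using gyr_gyr unfolding linked_ends_def by simp

lemma linked_ends_ext: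
  assumes b: "fpl b" and j: "j \<in> J" "par (e j) = q" "b (e j)"
  shows "linked_ends q b (e j) (e (nx j))"
proof -
  have "gyr q b (e (nx j))" using gyr_ext[OF b next_ext_in] fpl_next_ext[OF b j(1)] j(3) by simp
  then show ?thesis
    unfolding linked_ends_def
    using j transport_ext(1)[OF b _ j(1,2)] transport_ext(2)[OF gyr_fpl[OF b] _ j(1,2)] by blast
qed

context
  fixes b :: "half \<Rightarrow> bool" and q :: bool and s s' :: half
  assumes b: "fpl b" and joined: "linked_ends q b s s'"
begin

lemma linked_ends_black: "b s" "gyr q b s'"
  using joined unfolding linked_ends_def by auto

lemma transport_path_gyr:
  assumes "x \<in> path (gyr q b) s'" shows "transport q b (\<lambda>x. x \<in> path b s) x"
proof -
  have l: "path_labelling b (\<lambda>x. x \<in> path b s)" by (rule path_labelling_path[OF b linked_ends_black(1)])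
  have "transport q b (\<lambda>x. x \<in> path b s) x = transport q b (\<lambda>x. x \<in> path b s) s'"
    using path_labelling_on_path[OF gyr_fpl[OF b] linked_ends_black(2) path_labelling_transport[OF b l] assms]
    by blast
  then show ?thesis using joined l self_in_path unfolding linked_ends_def by simp
qed

lemma frozen_in_path_gyrD:
  "x \<in> path (gyr q b) s' \<Longrightarrow> par x = q \<Longrightarrow> frozen b x \<Longrightarrow> x \<in> path b s"
  using transport_path_gyr[of x] transport_active[of x q b] by simp

lemma face_meets_path_gyrD:
  assumes x: "x \<in> H" "par x = q" "\<not> frozen b x" and meets: "face x \<inter> path (gyr q b) s' \<noteq> {}"
  shows "face x \<inter> path b s \<noteq> {}"
proof -
  obtain y where y: "y \<in> face x" "y \<in> path (gyr q b) s'" using meets by blast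
  then have "par y = q" "\<not> frozen b y" "face y = face x"
    using par_face frozen_face face_eq x by blast+
  then show ?thesis using transport_path_gyr[OF y(2)] by (auto simp: transport_active)
qed

end

context
  fixes b :: "half \<Rightarrow> bool" and q :: bool and s s' :: half
  assumes b: "fpl b" and joined: "linked_ends q b s s'"
begin

lemma frozen_in_path_gyr_iff:
  "x \<in> H \<Longrightarrow> par x = q \<Longrightarrow> frozen b x \<Longrightarrow> x \<in> path (gyr q b) s' \<longleftrightarrow> x \<in> path b s"
  using frozen_in_path_gyrD[OF b joined] frozen_in_path_gyrD[OF gyr_fpl[OF b] linked_ends_gyr[OF b joined]]
    frozen_gyr gyr_gyr[OF b] by auto

lemma face_meets_path_gyr_iff:
  "x \<in> H \<Longrightarrow> par x = q \<Longrightarrow> \<not> frozen b x \<Longrightarrow>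
    face x \<inter> path (gyr q b) s' \<noteq> {} \<longleftrightarrow> face x \<inter> path b s \<noteq> {}"
  using face_meets_path_gyrD[OF b joined] face_meets_path_gyrD[OF gyr_fpl[OF b] linked_ends_gyr[OF b joined]]
    frozen_gyr gyr_gyr[OF b] by auto

end

lemma in_path_iff_black_of_face:
  assumes b: "fpl b" and s: "b s"
    and g: "g \<in> H" "\<not> frozen b g" "face g \<inter> path b s \<noteq> {}" and y: "y \<in> face g"
  shows "y \<in> path b s \<longleftrightarrow> b y"
proof
  show "y \<in> path b s \<Longrightarrow> b y" by (rule path_black[OF b s])
  obtain z where z: "z \<in> face g" "z \<in> path b s" using g by blast
  assume "b y"
  then show "y \<in> path b s"
    using path_labelling_on_face[OF b path_labelling_path[OF b s] g(1,2) y z(1)] path_black[OF b s z(2)] z(2)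
    by blast
qed

lemma region_labelling_on_face:
  assumes b: "fpl b" and \<chi>: "region_labelling C \<chi>" and C: "\<And>x. x \<in> C \<Longrightarrow> b x"
    and g: "g \<in> H" "\<not> frozen b g" and xy: "x \<in> face g" "y \<in> face g" "b x" "b y"
  shows "\<chi> (m x) = \<chi> (m y)"
proof (rule constant_on_black_of_face[where \<mu> = "\<lambda>x. \<chi> (m x)", OF b g _ xy])
  fix x assume x: "x \<in> face g" "b x" "b (f x)"
  have in_H: "x \<in> H" by (rule face_subset_H[OF g(1) x(1)])
  note inner = consecutive_black_inner[OF b in_H x(2,3)]
  have mate: "m x \<in> H" "b (m x)" using in_H x mate_in fpl_mate[OF b] by auto
  then have not_end: "m x \<notin> ends b"
    using inner x(3) fpl_bivalent[OF b mate(1)] unfolding ends_def by auto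
  have "other_black b (m x) = f x" using not_end inner(2) x(3) by (simp add: other_black_def)
  then show "\<chi> (m (f x)) = \<chi> (m x)"
    using region_labelling_other_black(2)[OF b mate not_end \<chi> C] by simp
qed

text \<open>Gyration moves a path across the non-frozen faces it meets, so exactly these faces change sides.\<close>

definition flipped :: "bool \<Rightarrow> (half \<Rightarrow> bool) \<Rightarrow> half set \<Rightarrow> half \<Rightarrow> bool" where
  "flipped q b C g \<longleftrightarrow> par g = q \<and> \<not> frozen b g \<and> face g \<inter> C \<noteq> {}"

definition transport_region ::
    "bool \<Rightarrow> (half \<Rightarrow> bool) \<Rightarrow> half set \<Rightarrow> (half \<Rightarrow> bool) \<Rightarrow> half \<Rightarrow> bool" where
  "transport_region q b C \<chi> g = (if flipped q b C g then \<chi> (m (SOME y. y \<in> face g \<inter> C)) else \<chi> g)"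

lemma flipped_face_step: "g \<in> H \<Longrightarrow> flipped q b C (f g) = flipped q b C g"
  unfolding flipped_def by (simp add: par_face_step frozen_face_step face_face_step)

context
  fixes b :: "half \<Rightarrow> bool" and q :: bool and s s' :: half and \<chi> :: "half \<Rightarrow> bool"
  assumes b: "fpl b" and joined: "linked_ends q b s s'" and \<chi>: "region_labelling (path b s) \<chi>"
begin

lemma transport_region_flipped:
  assumes g: "g \<in> H" "flipped q b (path b s) g" and y: "y \<in> face g" "y \<in> path b s"
  shows "transport_region q b (path b s) \<chi> g = \<chi> (m y)"
proof -
  let ?y = "SOME y. y \<in> face g \<inter> path b s"
  note black = path_black[OF b linked_ends_black(1)[OF b joined]]
  have "?y \<in> face g \<inter> path b s" by (rule someI[of _ y]) (use y in blast)
  then have "\<chi> (m ?y) = \<chi> (m y)"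
    using region_labelling_on_face[OF b \<chi> black g(1) _ _ y(1)] g(2) y(2) black unfolding flipped_def by blast
  then show ?thesis using g(2) by (simp add: transport_region_def)
qed

lemma transport_region_cross:
  assumes g: "g \<in> H" "par g = q" "g \<notin> path (gyr q b) s'"
  shows "transport_region q b (path b s) \<chi> (m g) = transport_region q b (path b s) \<chi> g"
proof -
  have mate: "transport_region q b (path b s) \<chi> (m g) = \<chi> (m g)"
    using par_mate g by (simp add: transport_region_def flipped_def)
  show ?thesis
  proof (cases "flipped q b (path b s) g")
    case True
    then have meets: "\<not> frozen b g" "face g \<inter> path b s \<noteq> {}" by (auto simp: flipped_def)
    moreover have "\<not> frozen (gyr q b) g" using frozen_gyr g meets by blast
    moreover have "face g \<inter> path (gyr q b) s' \<noteq> {}"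
      using face_meets_path_gyr_iff[OF b joined g(1,2)] meets by blast
    ultimately have "\<not> gyr q b g"
      using in_path_iff_black_of_face[OF gyr_fpl[OF b] linked_ends_black(2)[OF b joined] g(1)]
        self_in_face[OF g(1)] g(3) by blast
    then have "b g" using gyr_active[OF g(1,2)] meets by blast
    then have "g \<in> path b s"
      using in_path_iff_black_of_face[OF b linked_ends_black(1)[OF b joined] g(1) meets
          self_in_face[OF g(1)]] by blast
    then show ?thesis using transport_region_flipped[OF g(1) True self_in_face[OF g(1)]] mate by simp
  next
    case False
    then have "g \<notin> path b s"
      using frozen_in_path_gyr_iff[OF b joined g(1,2)] self_in_face[OF g(1)] g(2,3) unfolding flipped_def by blast
    then show ?thesis using region_labelling_cross[OF \<chi> g(1)] False mate by (simp add: transport_region_def)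
  qed
qed

lemma region_labelling_transport_region:
  "region_labelling (path (gyr q b) s') (transport_region q b (path b s) \<chi>)"
  unfolding region_labelling_def
proof (intro ballI conjI impI)
  fix g assume g: "g \<in> H"
  show "transport_region q b (path b s) \<chi> (c (m g)) = transport_region q b (path b s) \<chi> g" if "m g \<notin> X"
    using region_labelling_face[OF \<chi> g that] flipped_face_step[OF g] face_face_step[OF g]
      face_step_inner[OF that] by (simp add: transport_region_def)
  show "transport_region q b (path b s) \<chi> (m g) = transport_region q b (path b s) \<chi> g"
    if "g \<notin> path (gyr q b) s'"
  proof (cases "par g = q")
    case True then show ?thesis using transport_region_cross g that by blast
  next
    case False
    have "m g \<notin> path (gyr q b) s'"
      using path_mate_iff[OF gyr_fpl[OF b] linked_ends_black(2)[OF b joined] g] that by blast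
    then show ?thesis using transport_region_cross[of "m g"] g mate_in mate_mate par_mate False by auto
  qed
qed

text \<open>A face with two sides is never flipped: with equal colours before the gyration, it has the opposite
  colour afterwards, and one of the two is white.\<close>

lemma two_sided_face_not_flipped:
  assumes p: "p \<in> H" "f (f p) = p" "p \<notin> X" "f p \<notin> X" shows "\<not> flipped q b (path b s) p"
proof
  assume flip: "flipped q b (path b s) p"
  then have active: "par p = q" "\<not> frozen b p" by (auto simp: flipped_def)
  have face: "face p = {p, f p}" by (rule face_two[OF p(2)])
  have same: "b (f p) = b p" using active p face unfolding frozen_def by auto
  have "face p \<inter> path (gyr q b) s' \<noteq> {}"
    using face_meets_path_gyr_iff[OF b joined p(1) active] flip by (simp add: flipped_def)
  then have "gyr q b p \<or> gyr q b (f p)"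
    using path_black[OF gyr_fpl[OF b] linked_ends_black(2)[OF b joined]] face by auto
  moreover have "b p"
    using flip same path_black[OF b linked_ends_black(1)[OF b joined]] face by (auto simp: flipped_def)
  ultimately show False
    using same active gyr_active[OF p(1)] gyr_active[OF face_step_in[OF p(1)]] par_face_step[OF p(1)]
      frozen_face_step[OF p(1)] by auto
qed

end

lemma in_region_gyrD:
  assumes b: "fpl b" and joined: "linked_ends q b s s'"
    and p: "p \<in> H" "f (f p) = p" "p \<notin> X" "f p \<notin> X"
    and end_side: "\<And>\<chi>. region_labelling (path b s) \<chi> \<Longrightarrow> transport_region q b (path b s) \<chi> s' = \<chi> s"
    and region: "p \<in> region \<Lambda> (path (gyr q b) s') s'"
  shows "p \<in> region \<Lambda> (path b s) s"
  unfolding region_iff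
proof (intro allI impI)
  fix \<chi> assume \<chi>: "region_labelling (path b s) \<chi>"
  have "\<chi> p = transport_region q b (path b s) \<chi> p"
    using two_sided_face_not_flipped[OF b joined \<chi> p] by (simp add: transport_region_def)
  also have "\<dots> = transport_region q b (path b s) \<chi> s'"
    using region region_labelling_transport_region[OF b joined \<chi>] unfolding region_iff by blast
  also have "\<dots> = \<chi> s" by (rule end_side[OF \<chi>])
  finally show "\<chi> p = \<chi> s" .
qed

context
  fixes b :: "half \<Rightarrow> bool" and q :: bool and j :: nat
  assumes b: "fpl b" and j: "j \<in> J" "par (e j) = q" "b (e j)"
begin

lemma in_region_gyr_ext_iff:
  assumes p: "p \<in> H" "f (f p) = p" "p \<notin> X" "f p \<notin> X"
  shows "p \<in> region \<Lambda> (path (gyr q b) (e (nx j))) (e (nx j)) \<longleftrightarrow> p \<in> region \<Lambda> (path b (e j)) (e j)"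
proof
  have in_H: "e j \<in> H" "e (nx j) \<in> H" "m (e (nx j)) \<in> H" using ext_in next_ext_in j mate_in by blast+
  note joined = linked_ends_ext[OF b j]
  note white_next = fpl_next_ext[OF b j(1)] and black_next = linked_ends_black(2)[OF b joined]
  show "p \<in> region \<Lambda> (path (gyr q b) (e (nx j))) (e (nx j)) \<Longrightarrow> p \<in> region \<Lambda> (path b (e j)) (e j)"
  proof (rule in_region_gyrD[OF b joined p])
    fix \<chi> assume \<chi>: "region_labelling (path b (e j)) \<chi>"
    have "e (nx j) \<notin> path b (e j)" using white_next j(3) path_black[OF b j(3)] by blast
    then have "\<chi> (e (nx j)) = \<chi> (e j)" by (rule region_labelling_next_ext[OF \<chi> j(1)])
    moreover have "par (e (nx j)) \<noteq> q" using par_next_ext[OF j(1)] j(2) by simp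
    ultimately show "transport_region q b (path b (e j)) \<chi> (e (nx j)) = \<chi> (e j)"
      by (simp add: transport_region_def flipped_def)
  qed
  have "p \<in> region \<Lambda> (path (gyr q (gyr q b)) (e j)) (e j) \<Longrightarrow>
      p \<in> region \<Lambda> (path (gyr q b) (e (nx j))) (e (nx j))"
  proof (rule in_region_gyrD[OF gyr_fpl[OF b] linked_ends_gyr[OF b joined] p])
    fix \<chi> assume \<chi>: "region_labelling (path (gyr q b) (e (nx j))) \<chi>"
    have on_path: "m (e (nx j)) \<in> path (gyr q b) (e (nx j))"
      using path_mate_iff[OF gyr_fpl[OF b] black_next in_H(2)] self_in_path by blast
    then have "flipped q (gyr q b) (path (gyr q b) (e (nx j))) (e j)"
      using ext_not_frozen(1,3)[OF j(1)] j(2) unfolding flipped_def by blast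
    then show "transport_region q (gyr q b) (path (gyr q b) (e (nx j))) \<chi> (e j) = \<chi> (e (nx j))"
      using transport_region_flipped[OF gyr_fpl[OF b] linked_ends_gyr[OF b joined] \<chi> in_H(1) _
          ext_not_frozen(3)[OF j(1)] on_path] mate_mate[OF in_H(2)] by simp
  qed
  then show "p \<in> region \<Lambda> (path b (e j)) (e j) \<Longrightarrow>
      p \<in> region \<Lambda> (path (gyr q b) (e (nx j))) (e (nx j))" unfolding gyr_gyr[OF b] .
qed

lemma ext_in_path_gyr_iff:
  assumes i: "i \<in> J" "par (e i) = q" "b (e i)"
  shows "e (nx i) \<in> path (gyr q b) (e (nx j)) \<longleftrightarrow> e i \<in> path b (e j)"
proof -
  have before: "t \<in> path b s"
    if b: "fpl b" and joined: "linked_ends q b s s'" "linked_ends q b t t'" and t': "t' \<in> path (gyr q b) s'"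
    for b s s' t t'
    using transport_path_gyr[OF b joined(1) t'] path_labelling_path[OF b linked_ends_black(1)[OF b joined(1)]]
      joined(2)
    unfolding linked_ends_def by simp
  have joined: "linked_ends q b (e j) (e (nx j))" "linked_ends q b (e i) (e (nx i))"
    using linked_ends_ext[OF b] i j by blast+
  then show ?thesis
    using before[OF b joined] before[OF gyr_fpl[OF b] linked_ends_gyr[OF b joined(1)] linked_ends_gyr[OF b joined(2)]]
      gyr_gyr[OF b] by auto
qed

lemma path_gyr_meets_bivalent_iff:
  assumes p: "p \<in> H" "p \<notin> X" "bivalent \<Lambda> p"
  shows "path (gyr q b) (e (nx j)) \<inter> vertex_of \<Lambda> p \<noteq> {} \<longleftrightarrow> path b (e j) \<inter> vertex_of \<Lambda> p \<noteq> {}"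
proof -
  have partner: "c p \<in> H" "c p \<notin> X" "c (c p) = p" "c p \<noteq> p"
    using p ccw_in ccw_notin_X by (auto simp: bivalent_def)
  define h where "h = (if par (c p) = q then p else c p)"
  have h: "h \<in> H" "h \<notin> X" "par (c h) = q" "bivalent \<Lambda> h" and vertex: "vertex_of \<Lambda> p = {h, c h}"
    using p partner par_ccw[of p] par_ccw[of "c p"] vertex_of_bivalent[OF p(3)]
    unfolding h_def by (auto simp: bivalent_def)
  have before: "path b s \<inter> {h, c h} \<noteq> {}"
    if b: "fpl b" and joined: "linked_ends q b s s'" and meets: "path (gyr q b) s' \<inter> {h, c h} \<noteq> {}" for b s s'
  proof -
    obtain w where w: "w \<in> {h, c h}" "w \<in> path (gyr q b) s'" using meets by blast
    have one: "b (c h) \<noteq> b h" using fpl_bivalent[OF b h(1,2,4)] by simp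
    then obtain u where u: "u \<in> {h, c h}" "b u" by blast
    have "u \<in> path b s"
      using transport_corner[OF b path_labelling_path[OF b linked_ends_black(1)[OF b joined]] h(1-3) u w(1)
          path_black[OF gyr_fpl[OF b] linked_ends_black(2)[OF b joined] w(2)] one]
        transport_path_gyr[OF b joined w(2)] by simp
    then show ?thesis using u by blast
  qed
  have joined: "linked_ends q b (e j) (e (nx j))" by (rule linked_ends_ext[OF b j])
  show ?thesis
    unfolding vertex
    using before[OF b joined] before[OF gyr_fpl[OF b] linked_ends_gyr[OF b joined]] gyr_gyr[OF b, of q] by auto
qed

end

definition idx :: "nat \<Rightarrow> nat \<Rightarrow> nat" where
  "idx v k = (v - 1 + 2 * (k - 1)) mod (2 * N) + 1"

lemma idx_in: "idx v k \<in> J"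
  using nblack_pos unfolding idx_def by (simp add: Suc_le_eq)

lemma relabelled_eq: "relabelled \<Lambda> v k = e (idx v k)"
  by (simp add: relabelled_def idx_def)

lemma next_ext_mod: "nx (x mod (2 * N) + 1) = (x + 1) mod (2 * N) + 1"
  unfolding next_ext_def by (simp add: mod_Suc_eq)

lemma idx_next_ext:
  assumes "v \<in> J" shows "idx (nx v) k = nx (idx v k)"
proof -
  have "nx (idx v k) = (v - 1 + 2 * (k - 1) + 1) mod (2 * N) + 1"
    unfolding idx_def by (rule next_ext_mod)
  also have "v - 1 + 2 * (k - 1) + 1 = v + 2 * (k - 1)" using assms by simp
  finally show ?thesis unfolding idx_def next_ext_def by (simp add: mod_add_left_eq)
qed

lemma idx_Suc:
  assumes "k \<ge> 1" shows "idx v (Suc k) = nx (nx (idx v k))"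
proof -
  have "nx (nx (idx v k)) = (v - 1 + 2 * (k - 1) + 1 + 1) mod (2 * N) + 1"
    unfolding idx_def by (simp only: next_ext_mod)
  moreover have "v - 1 + 2 * (k - 1) + 1 + 1 = v - 1 + 2 * (Suc k - 1)" using assms by simp
  ultimately show ?thesis unfolding idx_def by (simp only:)
qed

lemma idx_one: "v \<in> J \<Longrightarrow> idx v 1 = v"
  unfolding idx_def by auto

lemma idx_induct:
  assumes "v \<in> J" "k \<ge> 1" "P v" "\<And>i. i \<in> J \<Longrightarrow> P i \<Longrightarrow> P (nx (nx i))" shows "P (idx v k)"
  using assms(2)
proof (induction k rule: dec_induct)
  case base then show ?case using idx_one[OF assms(1)] assms(3) by simp
next
  case (step k) then show ?case using idx_Suc[OF step(1)] assms(4)[OF idx_in] by simp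
qed

lemma fpl_idx: "fpl b \<Longrightarrow> v \<in> J \<Longrightarrow> k \<ge> 1 \<Longrightarrow> b (e (idx v k)) = b (e v)"
  by (rule idx_induct[of v k]) (use fpl_next_ext next_ext_in in metis)+

lemma par_idx: "v \<in> J \<Longrightarrow> k \<ge> 1 \<Longrightarrow> par (e (idx v k)) = par (e v)"
  by (rule idx_induct[of v k]) (use par_next_ext next_ext_in in metis)+

theorem link_pattern_of_gyr:
  assumes b: "fpl b" and v: "v \<in> J" "par (e v) = q" "b (e v)"
  shows "link_pattern_of \<Lambda> (edges_of (gyr q b)) (nx v) = link_pattern_of \<Lambda> (edges_of b) v"
proof -
  have label: "idx v k \<in> J" "par (e (idx v k)) = q" "b (e (idx v k))" if "k \<in> {1..N}" for k
    using that idx_in par_idx[OF v(1)] fpl_idx[OF b v(1)] v by auto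
  have linked: "linked_labels \<Lambda> (edges_of (gyr q b)) (nx v) = linked_labels \<Lambda> (edges_of b) v"
    unfolding linked_labels_def relabelled_eq idx_next_ext[OF v(1)]
    using ext_in_path_gyr_iff[OF b label label] by blast
  have face: "{(k, l) \<in> linked_labels \<Lambda> (edges_of b) v.
        p \<notin> region \<Lambda> (path (gyr q b) (relabelled \<Lambda> (nx v) k)) (relabelled \<Lambda> (nx v) k)} =
      {(k, l) \<in> linked_labels \<Lambda> (edges_of b) v.
        p \<notin> region \<Lambda> (path b (relabelled \<Lambda> v k)) (relabelled \<Lambda> v k)}"
    if p: "puncture \<Lambda> = In_Face p" for p
  proof -
    have "p \<in> H" "f (f p) = p" "p \<notin> X" "f p \<notin> X" using puncture_ok p unfolding puncture_ok_def by auto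
    then show ?thesis
      unfolding relabelled_eq idx_next_ext[OF v(1)] linked_labels_def
      using in_region_gyr_ext_iff[OF b label] by auto
  qed
  have vertex: "{{Some k, None} | k. k \<in> {1..N} \<and>
        path (gyr q b) (relabelled \<Lambda> (nx v) k) \<inter> vertex_of \<Lambda> p \<noteq> {}} =
      {{Some k, None} | k. k \<in> {1..N} \<and> path b (relabelled \<Lambda> v k) \<inter> vertex_of \<Lambda> p \<noteq> {}}"
    if p: "puncture \<Lambda> = At_Vertex p" for p
  proof -
    have "p \<in> H" "p \<notin> X" "bivalent \<Lambda> p" using puncture_ok p unfolding puncture_ok_def by auto
    then show ?thesis
      unfolding relabelled_eq idx_next_ext[OF v(1)] using path_gyr_meets_bivalent_iff[OF b label] by blast
  qed
  show ?thesis
    using linked face vertex unfolding link_pattern_of_def Let_def by (simp split: puncture.split)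
qed

end

section \<open>The refinement position\<close>

lemma sum_black_eq_sum_white_at_position:
  fixes S :: "'a \<Rightarrow> 'b :: ab_group_add" and pos :: "'a \<Rightarrow> nat"
  assumes fin: "finite A" and bij: "bij_betw G A A" and inv: "\<And>x. x \<in> A \<Longrightarrow> S (G x) = S x"
    and white: "\<And>x. x \<in> A \<Longrightarrow> \<not> black x \<Longrightarrow>
      pos (G x) = pos x \<and> black (G x) \<or> pos (G x) = pos x + 1 \<and> \<not> black (G x)"
    and black: "\<And>x. x \<in> A \<Longrightarrow> black x \<Longrightarrow>
      pos (G x) = pos x \<and> \<not> black (G x) \<or> pos (G x) + 1 = pos x \<and> black (G x)"
  shows "(\<Sum>x\<in>{x \<in> A. pos x = n \<and> \<not> black x}. S x) = (\<Sum>x\<in>{x \<in> A. pos x = n \<and> black x}. S x)"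
proof -
  define weight where "weight P = (\<Sum>x\<in>A. if P x then S x else 0)" for P
  have sum_filter: "(\<Sum>x\<in>{x \<in> A. P x}. S x) = weight P" for P
    unfolding weight_def by (rule sum.inter_filter[OF fin])
  have weight_image: "(\<Sum>x\<in>A. if P (G x) then S x else 0) = weight P" for P
  proof -
    have "(\<Sum>x\<in>A. if P (G x) then S x else 0) = (\<Sum>x\<in>A. if P (G x) then S (G x) else 0)"
      by (intro sum.cong) (simp_all add: inv)
    also have "\<dots> = weight P"
      unfolding weight_def by (rule sum.reindex_bij_betw[OF bij, of "\<lambda>x. if P x then S x else 0"])
    finally show ?thesis .
  qed
  have "weight (\<lambda>x. pos x = n \<and> \<not> black x) =
      (\<Sum>x\<in>A. (if pos (G x) = n \<and> black (G x) then S x else 0) +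
        ((if pos x \<le> n then S x else 0) - (if pos (G x) \<le> n then S x else 0)))"
    unfolding weight_def
  proof (rule sum.cong[OF refl])
    fix x assume "x \<in> A"
    then show "(if pos x = n \<and> \<not> black x then S x else 0) =
      (if pos (G x) = n \<and> black (G x) then S x else 0) +
        ((if pos x \<le> n then S x else 0) - (if pos (G x) \<le> n then S x else 0))"
      using white[of x] black[of x] by (cases "black x") auto
  qed
  also have "\<dots> = weight (\<lambda>x. pos x = n \<and> black x) +
      (weight (\<lambda>x. pos x \<le> n) - weight (\<lambda>x. pos x \<le> n))"
    unfolding sum.distrib sum_subtractf weight_image[of "\<lambda>x. pos x = n \<and> black x"]
      weight_image[of "\<lambda>x. pos x \<le> n"] by (simp add: weight_def)
  finally show ?thesis unfolding sum_filter by simp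
qed

context plane_domain begin

abbreviation "L \<equiv> side_length \<Lambda>"

lemma side_length:
  "1 \<le> L" "L \<le> 2 * N" "c (m (e L)) = m (e (nx L))"
  "1 \<le> j \<Longrightarrow> j < L \<Longrightarrow> c (m (e j)) \<noteq> m (e (nx j))"
proof -
  let ?P = "\<lambda>j. 1 \<le> j \<and> c (m (e j)) = m (e (nx j))"
  have last: "?P (2 * N)" using corner nblack_pos by (simp add: next_ext_def)
  have "?P L" unfolding side_length_def by (rule LeastI[of ?P, OF last])
  then show "1 \<le> L" "c (m (e L)) = m (e (nx L))" by auto
  show "L \<le> 2 * N" unfolding side_length_def by (rule Least_le[of ?P, OF last])
  show "1 \<le> j \<Longrightarrow> j < L \<Longrightarrow> c (m (e j)) \<noteq> m (e (nx j))"
    unfolding side_length_def using not_less_Least[of j ?P] by blast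
qed

lemma side_in_J: "j \<in> {1..L} \<Longrightarrow> j \<in> J"
  using side_length(2) by auto

lemma next_ext_side: "1 \<le> j \<Longrightarrow> j < L \<Longrightarrow> nx j = j + 1"
  using side_length(2) by (simp add: next_ext_def)

text \<open>The horizontal edge between neighbouring vertices \<open>j\<close> and \<open>j + 1\<close> of the reference side has the
  halves \<open>f (e j)\<close> and \<open>m (f (e j))\<close>.\<close>

lemma side_edge:
  assumes "1 \<le> j" "j < L"
  shows "c (m (e j)) = f (e j)" "c (c (c (m (e (j + 1))))) = m (f (e j))"
    "m (f (e j)) \<notin> X" "m (f (e j)) \<in> H" "f (e j) \<notin> X"
proof -
  have j: "j \<in> J" using assms side_in_J by simp
  then show in_H: "m (f (e j)) \<in> H" using ext_in face_step_in mate_in by blast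
  from j have step: "c (m (e j)) = f (e j) \<and> c (m (f (e j))) = m (e (j + 1)) \<and> m (f (e j)) \<notin> X"
  proof (cases rule: boundary_cases)
    case two then show ?thesis using side_length(4)[OF assms] by simp
  next
    case three then show ?thesis using next_ext_side[OF assms] by simp
  qed
  then show "c (m (e j)) = f (e j)" "m (f (e j)) \<notin> X" by auto
  show "f (e j) \<notin> X" using step ccw_notin_X mate_in mate_notin_X ext_in ext_in_X j by metis
  have "e (j + 1) \<in> X" using ext_in_X next_ext_in[of j] next_ext_side[OF assms] by simp
  then have "quartic \<Lambda> (m (e (j + 1)))" by (rule quartic_mate_ext)
  then have "quartic \<Lambda> (m (f (e j)))"
    using step degree in_H unfolding bivalent_def quartic_def by (metis DiffI)
  then show "c (c (c (m (e (j + 1))))) = m (f (e j))" using step unfolding quartic_def by metis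
qed

definition straight :: "(half \<Rightarrow> bool) \<Rightarrow> nat \<Rightarrow> bool" where
  "straight b j \<longleftrightarrow> b (c (c (m (e j)))) = b (e j)"

definition before :: "(half \<Rightarrow> bool) \<Rightarrow> nat \<Rightarrow> bool" where
  "before b j \<longleftrightarrow> b (c (m (e j))) = b (e j)"

definition refpos :: "(half \<Rightarrow> bool) \<Rightarrow> nat" where
  "refpos b = (LEAST j. 1 \<le> j \<and> \<not> before b j)"

context
  fixes b :: "half \<Rightarrow> bool"
  assumes b: "fpl b"
begin

lemma ext_vertex_exactly_two:
  assumes "j \<in> J"
  shows "exactly_two (b (e j)) (b (c (m (e j)))) (b (c (c (m (e j))))) (b (c (c (c (m (e j))))))"
  using fpl_quartic[OF b, of "m (e j)"] fpl_mate[OF b, of "e j"] assms ext_in mate_in mate_notin_X ext_in_X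
    quartic_mate_ext by simp

lemma c_tile_iff_straight:
  assumes j: "j \<in> J" shows "c_tile \<Lambda> (edges_of b) j \<longleftrightarrow> straight b j"
proof -
  let ?d = "m (e j)"
  have down: "quartic \<Lambda> ?d" "b ?d = b (e j)"
    using j ext_in ext_in_X quartic_mate_ext fpl_mate[OF b] by blast+
  note vertex = vertex_of_quartic[OF down(1)]
  have "black_at \<Lambda> (edges_of b) ?d = {g \<in> {?d, c ?d, c (c ?d), c (c (c ?d))}. b g}"
    unfolding black_at_eq fpl_edges_of(2)[OF b] vertex(1) ..
  then have "c_tile \<Lambda> (edges_of b) j \<longleftrightarrow>
      (b ?d \<and> \<not> b (c ?d) \<and> b (c (c ?d)) \<and> \<not> b (c (c (c ?d)))) \<or>
      (\<not> b ?d \<and> b (c ?d) \<and> \<not> b (c (c ?d)) \<and> b (c (c (c ?d))))"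
    using vertex(2) unfolding c_tile_def Let_def by (simp add: set_eq_iff) (smt (verit))
  then show ?thesis
    using ext_vertex_exactly_two[OF j] down(2) unfolding exactly_two_def straight_def
    by (auto split: if_splits)
qed

lemma not_before_last: "\<not> before b L"
proof -
  have "L \<in> J" using side_in_J side_length by simp
  then have "b (m (e (nx L))) = (\<not> b (e L))"
    using fpl_mate[OF b] fpl_next_ext[OF b] ext_in next_ext_in by simp
  then show ?thesis using side_length(3) by (simp add: before_def)
qed

lemma straight_first: "straight b 1 \<longleftrightarrow> \<not> before b 1"
proof -
  have J: "1 \<in> J" "2 * N \<in> J" using nblack_pos by auto
  let ?z = "m (e (2 * N))"
  have "c (c (c (m (e 1)))) = ?z"
    using corner ccw_four[of ?z] mate_in ext_in J by metis
  moreover have "b ?z = (\<not> b (e 1))"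
    using fpl_mate[OF b ext_in[OF J(2)]] fpl_next_ext[OF b J(2)] nblack_pos by (simp add: next_ext_def)
  ultimately show ?thesis
    using ext_vertex_exactly_two[OF J(1)] unfolding straight_def before_def exactly_two_def
    by (auto split: if_splits)
qed

lemma before_step:
  assumes "1 \<le> j" "j < L"
  shows "before b (j + 1) \<Longrightarrow> before b j"
    "straight b (j + 1) \<longleftrightarrow> before b j \<and> \<not> before b (j + 1)"
proof -
  have J: "j \<in> J" "j + 1 \<in> J" using side_in_J assms by auto
  have "b (m (f (e j))) = b (f (e j))" using fpl_mate[OF b] face_step_in ext_in J by blast
  moreover have "b (e (j + 1)) = (\<not> b (e j))" using fpl_next_ext[OF b J(1)] next_ext_side[OF assms] by simp
  ultimately have left: "b (c (c (c (m (e (j + 1)))))) = (before b j \<noteq> b (e (j + 1)))"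
    using side_edge(1,2)[OF assms] unfolding before_def by auto
  show "before b (j + 1) \<Longrightarrow> before b j" "straight b (j + 1) \<longleftrightarrow> before b j \<and> \<not> before b (j + 1)"
    using ext_vertex_exactly_two[OF J(2)] left
    unfolding straight_def before_def[of b "j + 1"] exactly_two_def by (auto split: if_splits)
qed

lemma refpos_in: "refpos b \<in> {1..L}"
  and not_before_refpos: "\<not> before b (refpos b)"
proof -
  let ?P = "\<lambda>j. 1 \<le> j \<and> \<not> before b j"
  have last: "?P L" using not_before_last side_length by simp
  have first: "?P (refpos b)" unfolding refpos_def by (rule LeastI[of ?P, OF last])
  then show "\<not> before b (refpos b)" by blast
  have "refpos b \<le> L" unfolding refpos_def by (rule Least_le[of ?P, OF last])
  then show "refpos b \<in> {1..L}" using first by simp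
qed

lemma before_iff:
  assumes "j \<in> {1..L}" shows "before b j \<longleftrightarrow> j < refpos b"
proof
  have "\<not> before b j" if "refpos b \<le> j" "j \<le> L" for j
    using that
  proof (induction j rule: dec_induct)
    case base show ?case by (rule not_before_refpos)
  next
    case (step n) then show ?case using before_step(1)[of n] refpos_in by auto
  qed
  then show "j < refpos b" if "before b j" using assms that by (meson atLeastAtMost_iff not_le)
  show "before b j" if "j < refpos b"
    using that not_less_Least[of j "\<lambda>j. 1 \<le> j \<and> \<not> before b j"] assms unfolding refpos_def by auto
qed

lemma straight_iff:
  assumes j: "j \<in> {1..L}" shows "straight b j \<longleftrightarrow> j = refpos b"
proof (cases "j = 1")
  case True
  then show ?thesis using straight_first before_iff[OF j] refpos_in by auto
next
  case False
  then obtain i where "j = i + 1" "1 \<le> i" "i < L" using j by (cases j) auto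
  then show ?thesis using before_step(2)[of i] before_iff[of i] before_iff[of j] j by auto
qed

lemma refinement_pos_eq: "refinement_pos \<Lambda> (edges_of b) = refpos b"
  unfolding refinement_pos_def
proof (rule the_equality)
  show "refpos b \<in> {1..L} \<and> c_tile \<Lambda> (edges_of b) (refpos b)"
    using refpos_in straight_iff c_tile_iff_straight side_in_J by blast
  show "j = refpos b" if "j \<in> {1..L} \<and> c_tile \<Lambda> (edges_of b) j" for j
    using that straight_iff c_tile_iff_straight side_in_J by blast
qed

end

definition active :: "(half \<Rightarrow> bool) \<Rightarrow> bool" where
  "active b \<longleftrightarrow> (par (e 1) \<longleftrightarrow> b (e 1))"

lemma par_ext_eq_active_iff:
  assumes b: "fpl b" and j: "j \<in> J" shows "par (e j) = active b \<longleftrightarrow> b (e j)"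
proof -
  have "1 \<le> j" "j \<le> 2 * N" using j by auto
  then have "(par (e j) \<longleftrightarrow> b (e j)) = active b"
  proof (induction j rule: dec_induct)
    case base then show ?case by (simp add: active_def)
  next
    case (step n)
    then have "n \<in> J" "nx n = Suc n" by (auto simp: next_ext_def)
    then show ?case using step fpl_next_ext[OF b, of n] par_next_ext[of n] by auto
  qed
  then show ?thesis by auto
qed

context
  fixes b :: "half \<Rightarrow> bool"
  assumes b: "fpl b"
begin

text \<open>If the face above the edge between \<open>j\<close> and \<open>j + 1\<close> is frozen, its alternating colours make one of
  the two tiles straight.\<close>

lemma straight_below_frozen:
  assumes j: "1 \<le> j" "j < L" and frozen: "frozen b (m (f (e j)))"
  shows "straight b j \<or> straight b (j + 1)"
proof -
  let ?g = "f (e j)" and ?u = "c (c (m (e (j + 1))))"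
  have J: "j \<in> J" "j + 1 \<in> J" using side_in_J j by auto
  have g: "?g \<in> H" "m ?g \<in> H" using ext_in face_step_in mate_in J by blast+
  have "f (m ?g) = c ?g" by (rule face_step_mate_inner[OF g(1) side_edge(5)[OF j]])
  then have right_side: "b (c ?g) \<noteq> b ?g"
    using frozen_alternating[OF g(2) frozen] fpl_mate[OF b g(1)] by simp
  have u: "?u \<in> H" "?u \<notin> X"
    using J(2) ext_in mate_in mate_notin_X ext_in_X ccw_in ccw_notin_X by meson+
  then have "f (m ?u) = m ?g" using face_step_mate_inner side_edge(2)[OF j] by simp
  moreover have "frozen b (m ?u)" using frozen frozen_face_step[OF mate_in[OF u(1)]] calculation by simp
  ultimately have left_side: "b ?u \<noteq> b ?g"
    using frozen_alternating[OF mate_in[OF u(1)], of b] fpl_mate[OF b u(1)] fpl_mate[OF b g(1)] by simp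
  have "b (e (j + 1)) = (\<not> b (e j))" using fpl_next_ext[OF b J(1)] next_ext_side[OF j] by simp
  then show ?thesis using right_side left_side side_edge(1)[OF j] unfolding straight_def by auto
qed

lemma before_gyr_changeD:
  assumes j: "1 \<le> j" "j < L" and change: "before (gyr (active b) b) j \<noteq> before b j"
  shows "\<not> b (e j)" "j = refpos b \<or> j + 1 = refpos b"
proof -
  let ?q = "active b" let ?g = "f (e j)"
  have J: "j \<in> J" using side_in_J j by auto
  have in_H: "e j \<in> H" "?g \<in> H" "m ?g \<in> H" using ext_in face_step_in mate_in J by blast+
  have before: "before b j \<longleftrightarrow> b ?g = b (e j)" "before (gyr ?q b) j \<longleftrightarrow> gyr ?q b ?g = (\<not> b (e j))"
    using side_edge(1)[OF j] gyr_ext[OF b J] unfolding before_def by auto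
  have "\<not> frozen b ?g" using ext_not_frozen(1)[OF J] frozen_face_step in_H by simp
  then show white: "\<not> b (e j)"
    using gyr_active[OF in_H(2), of ?q b] par_ext_eq_active_iff[OF b J] par_face_step in_H before change by auto
  then have "par (m ?g) = ?q"
    using par_ext_eq_active_iff[OF b J] par_face_step par_mate in_H by auto
  then have "frozen b (m ?g)"
    using gyr_active[OF in_H(3), of ?q b] fpl_mate[OF b in_H(2)] gyr_mate[OF b in_H(2), of ?q] before change by auto
  then show "j = refpos b \<or> j + 1 = refpos b"
    using straight_below_frozen[OF j] straight_iff[OF b] j by auto
qed

text \<open>\<open>before\<close> changes exactly at the positions between the old and the new refinement position.\<close>

lemma refpos_gyr_cases:
  obtains (stay) "refpos (gyr (active b) b) = refpos b"
  | (up) "refpos (gyr (active b) b) = refpos b + 1" "\<not> b (e (refpos b))"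
  | (down) "refpos (gyr (active b) b) + 1 = refpos b" "b (e (refpos b))"
proof -
  let ?b' = "gyr (active b) b"
  note bounds = refpos_in[OF b] refpos_in[OF gyr_fpl[OF b], of "active b"]
  have between: "\<not> b (e j)" "j = refpos b \<or> j + 1 = refpos b"
    if "j \<in> {1..L}" "(j < refpos ?b') \<noteq> (j < refpos b)" for j
  proof -
    have "before ?b' j \<noteq> before b j" using that before_iff[OF b] before_iff[OF gyr_fpl[OF b]] by simp
    moreover have "1 \<le> j" "j < L" using that bounds by auto
    ultimately show "\<not> b (e j)" "j = refpos b \<or> j + 1 = refpos b" using before_gyr_changeD by blast+
  qed
  consider (equal) "refpos ?b' = refpos b" | (greater) "refpos b < refpos ?b'" | (less) "refpos ?b' < refpos b"
    by linarith
  then show thesis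
  proof cases
    case equal then show thesis by (rule stay)
  next
    case greater
    then have "refpos ?b' - 1 = refpos b" using between(2)[of "refpos ?b' - 1"] bounds by auto
    then show thesis using up greater between(1)[of "refpos b"] bounds by auto
  next
    case less
    then have pred: "refpos ?b' + 1 = refpos b" using between(2)[of "refpos ?b'"] bounds by auto
    then have "refpos ?b' < L" using bounds by auto
    then have "b (e (refpos b)) = (\<not> b (e (refpos ?b')))"
      using fpl_next_ext[OF b, of "refpos ?b'"] next_ext_side[of "refpos ?b'"] side_in_J bounds(2) pred by auto
    then show thesis using down pred between(1)[of "refpos ?b'"] bounds by auto
  qed
qed

lemma refpos_gyr:
  defines "b' \<equiv> gyr (active b) b"
  shows "if b (e (refpos b))
    then refpos b' = refpos b \<and> \<not> b' (e (refpos b')) \<or> refpos b' + 1 = refpos b \<and> b' (e (refpos b'))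
    else refpos b' = refpos b \<and> b' (e (refpos b')) \<or> refpos b' = refpos b + 1 \<and> \<not> b' (e (refpos b'))"
proof -
  have in_J: "refpos b \<in> J" "refpos b' \<in> J"
    using refpos_in[OF b] refpos_in[OF gyr_fpl[OF b]] side_in_J unfolding b'_def by auto
  have colour: "b' (e (refpos b')) = (\<not> b (e (refpos b')))" unfolding b'_def using gyr_ext[OF b] in_J b'_def by blast
  have neighbours: "b (e (Suc j)) = (\<not> b (e j))" if "j \<in> J" "Suc j \<in> J" for j
    using fpl_next_ext[OF b that(1)] that(2) by (simp add: next_ext_def)
  show ?thesis
  proof (cases rule: refpos_gyr_cases)
    case stay then show ?thesis using colour by (simp flip: b'_def)
  next
    case up then show ?thesis using colour neighbours[of "refpos b"] in_J by (simp flip: b'_def)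
  next
    case down then show ?thesis using colour neighbours[of "refpos b'"] in_J by (auto simp flip: b'_def)
  qed
qed

end

end

section \<open>Matchings and cyclic intervals\<close>

lemma Collect_pair_eq_image: "{F x y | x y. (x, y) \<in> r} = (\<lambda>(x, y). F x y) ` r"
  by force

lemma perfect_matching_sym_rel:
  assumes "sym r" "irrefl r" "single_valued r"
  shows "perfect_matching (Domain r) {{x, y} | x y. (x, y) \<in> r}"
  unfolding perfect_matching_def
proof
  have partner_eq: "{x, y} = {z, w}" if "(x, y) \<in> r" "(z, w) \<in> r" "{x, y} \<inter> {z, w} \<noteq> {}" for x y z w
    using that symD[OF assms(1)] single_valuedD[OF assms(3)] by blast
  show "partition_on (Domain r) {{x, y} | x y. (x, y) \<in> r}"
  proof (rule partition_onI)
    show "\<Union>{{x, y} | x y. (x, y) \<in> r} = Domain r" using symD[OF assms(1)] by blast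
    fix p q assume pq: "p \<in> {{x, y} | x y. (x, y) \<in> r}" "q \<in> {{x, y} | x y. (x, y) \<in> r}" "p \<noteq> q"
    show "disjnt p q"
    proof -
      obtain x y z w where "p = {x, y}" "(x, y) \<in> r" "q = {z, w}" "(z, w) \<in> r" using pq(1,2) by blast
      then show ?thesis using partner_eq pq(3) unfolding disjnt_def by blast
    qed
  qed blast
  show "\<forall>p\<in>{{x, y} | x y. (x, y) \<in> r}. card p = 2"
    using irreflD[OF assms(2)] by (auto simp: card_insert_if)
qed

lemma perfect_matching_inj_image:
  assumes M: "perfect_matching A M" and f: "inj_on f A" shows "perfect_matching (f ` A) ((`) f ` M)"
proof -
  have part: "partition_on A M" and two: "\<forall>p\<in>M. card p = 2" using M by (auto simp: perfect_matching_def)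
  have "{} \<notin> (`) f ` M" using partition_onD3[OF part] by auto
  then have "partition_on (f ` A) ((`) f ` M)" using partition_on_inj_image[OF part f] by simp
  moreover have "card (f ` p) = 2" if "p \<in> M" for p
    using card_image[OF inj_on_subset[OF f]] partition_onD1[OF part] two that by (metis Union_upper)
  ultimately show ?thesis unfolding perfect_matching_def by blast
qed

lemma perfect_matching_insert:
  assumes "perfect_matching A M" "x \<notin> A" "y \<notin> A" "x \<noteq> y"
  shows "perfect_matching (insert x (insert y A)) (insert {x, y} M)"
proof -
  have "disjnt {x, y} (\<Union>M)" "insert x (insert y A) - {x, y} = A"
    using assms unfolding perfect_matching_def partition_on_def by (auto simp: disjnt_def)
  then show ?thesis using assms(1,4) unfolding perfect_matching_def by (auto simp: partition_on_insert)
qed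

lemma perfect_matching_even:
  assumes "perfect_matching A M" "finite A" shows "even (card A)"
proof -
  have M: "partition_on A M" "\<And>p. p \<in> M \<Longrightarrow> card p = 2"
    using assms(1) by (auto simp: perfect_matching_def)
  have "card A = (\<Sum>p\<in>M. card p)"
    unfolding card_eq_sum by (rule sum.partition[OF assms(2) M(1)])
  then show ?thesis using M(2) by simp
qed

lemma noncrossing_subset: "A \<subseteq> B \<Longrightarrow> noncrossing B \<Longrightarrow> noncrossing A"
  unfolding noncrossing_def by blast

lemma finite_LP: "finite (LP n)"
proof -
  have "LP n \<subseteq> Disk ` Pow (Pow {1..n})"
    unfolding LP_def perfect_matching_def partition_on_def by auto
  then show ?thesis by (rule finite_subset) simp
qed

lemma finite_LP_punctured: "finite (LP_punctured n)"
proof (cases "even n")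
  case True
  have "D \<subseteq> {1..n} \<times> {1..n}" if "perfect_matching {1..n} ((\<lambda>(i, j). {i, j}) ` D)" for D
  proof -
    have "\<Union> ((\<lambda>(i, j). {i, j}) ` D) = {1..n}"
      using that unfolding perfect_matching_def partition_on_def by blast
    then show ?thesis by fastforce
  qed
  then have "LP_punctured n \<subseteq> Punctured_Even ` Pow ({1..n} \<times> {1..n})"
    using True unfolding LP_punctured_def by auto
  then show ?thesis by (rule finite_subset) simp
next
  case False
  have "M \<in> Pow (Pow A)" if "perfect_matching A M" for A :: "nat option set" and M
    using that unfolding perfect_matching_def partition_on_def by blast
  then have "LP_punctured n \<subseteq> Punctured_Odd ` Pow (Pow (insert None (Some ` {1..n})))"
    using False unfolding LP_punctured_def by (auto simp del: Pow_iff)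
  then show ?thesis by (rule finite_subset) simp
qed

definition arc :: "nat \<Rightarrow> nat \<Rightarrow> nat \<Rightarrow> nat set" where
  "arc n i j = (if i < j then {i..<j} else {i..n} \<union> {1..<j})"

lemma arc_propagate:
  assumes ij: "i \<in> {1..n}" "i \<noteq> j" and start: "P i"
    and step: "\<And>k. 1 \<le> k \<Longrightarrow> k < n \<Longrightarrow> Suc k \<noteq> j \<Longrightarrow> P k \<Longrightarrow> P (Suc k)"
    and wrap: "j \<noteq> 1 \<Longrightarrow> P n \<Longrightarrow> P 1"
    and k: "k \<in> arc n i j" "k \<le> n"
  shows "P k"
proof -
  have upwards: "P r" if "1 \<le> l" "l \<le> r" "P l" "j \<notin> {l<..r}" "r \<le> n" for l r
    using that(2,4,5)
  proof (induction r rule: dec_induct)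
    case base show ?case by (rule that(3))
  next
    case (step r) then show ?case using assms(4)[of r] that(1) by auto
  qed
  show ?thesis
  proof (cases "i \<le> k")
    case True
    then show ?thesis using upwards[of i k] ij start k by (auto simp: arc_def split: if_splits)
  next
    case False
    then have k': "1 \<le> k" "k < j" "j < i" using ij k by (auto simp: arc_def split: if_splits)
    then have "P n" using upwards[of i n] ij start by auto
    then show ?thesis using upwards[of 1 k] wrap k' k(2) by auto
  qed
qed

lemma arc_complement: "i \<in> {1..n} \<Longrightarrow> j \<in> {1..n} \<Longrightarrow> k \<in> {1..n} \<Longrightarrow> k \<notin> arc n i j \<Longrightarrow> k \<in> arc n j i"
  by (auto simp: arc_def split: if_splits)

lemma in_arc_iff_if_locally_constant:
  assumes ij: "i \<in> {1..n}" "j \<in> {1..n}" "P i" "\<not> P j"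
    and step: "\<And>k. 1 \<le> k \<Longrightarrow> k < n \<Longrightarrow> Suc k \<notin> {i, j} \<Longrightarrow> P (Suc k) = P k"
    and wrap: "1 \<notin> {i, j} \<Longrightarrow> P 1 = P n"
    and k: "k \<in> {1..n}"
  shows "P k \<longleftrightarrow> k \<in> arc n i j"
proof
  have propagate: "P k = P i'" if ij': "{i', j'} = {i, j}" "k \<in> arc n i' j'" for i' j'
  proof (rule arc_propagate[where P = "\<lambda>k. P k = P i'", OF _ _ refl _ _ ij'(2)])
    show "i' \<in> {1..n}" "i' \<noteq> j'" "k \<le> n" using ij ij'(1) k by (auto simp: doubleton_eq_iff)
    show "P (Suc r) = P i'" if "1 \<le> r" "r < n" "Suc r \<noteq> j'" "P r = P i'" for r
      using step[of r] that ij'(1) by (cases "Suc r = i'") (auto simp: doubleton_eq_iff)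
    show "P 1 = P i'" if "j' \<noteq> 1" "P n = P i'"
      using wrap that ij'(1) by (cases "1 = i'") (auto simp: doubleton_eq_iff)
  qed
  show "P k" if "k \<in> arc n i j" using propagate[of i j] that ij(3) by simp
  show "k \<in> arc n i j" if "P k"
    using propagate[of j i] that ij(4) arc_complement[OF ij(1,2) k] by (auto simp: insert_commute)
qed

lemma ccw_intervals_nested_or_disjoint:
  assumes "i \<in> {1..n}" "j \<in> {1..n}" "k \<in> {1..n}" "l \<in> {1..n}" "distinct [i, j, k, l]"
    and "k \<in> arc n i j \<longleftrightarrow> l \<in> arc n i j" "i \<in> arc n k l \<longleftrightarrow> j \<in> arc n k l"
    and "\<not> (k \<in> arc n i j \<and> i \<in> arc n k l)"
  shows "ccw_interval n (i, j) \<subseteq> ccw_interval n (k, l) \<or> ccw_interval n (k, l) \<subseteq> ccw_interval n (i, j) \<or>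
    ccw_interval n (i, j) \<inter> ccw_interval n (k, l) = {}"
proof -
  consider (both_straight) "i < j" "k < l" | (second_wraps) "i < j" "l < k"
    | (first_wraps) "j < i" "k < l" | (both_wrap) "j < i" "l < k"
    using assms(5) by fastforce
  then show ?thesis
  proof cases
    case both_straight
    then have "(k \<le> i \<and> j \<le> l) \<or> (i \<le> k \<and> l \<le> j) \<or> j < k \<or> l < i"
      using assms(6-8) by (simp add: arc_def) linarith
    then show ?thesis using both_straight unfolding ccw_interval_def by fastforce
  next
    case second_wraps
    then have "j \<le> l \<or> k \<le> i \<or> (l < i \<and> j < k)"
      using assms(1-4,6-8) by (simp add: arc_def) linarith
    then show ?thesis using second_wraps assms(1-4) unfolding ccw_interval_def by fastforce
  next
    case first_wraps
    then have "l \<le> j \<or> i \<le> k \<or> (j < k \<and> l < i)"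
      using assms(1-4,6-8) by (simp add: arc_def) linarith
    then show ?thesis using first_wraps assms(1-4) unfolding ccw_interval_def by fastforce
  next
    case both_wrap
    then have "(k \<le> i \<and> j \<le> l) \<or> (i \<le> k \<and> l \<le> j)"
      using assms(1-4,6-8) by (simp add: arc_def) linarith
    then show ?thesis using both_wrap assms(1-4) unfolding ccw_interval_def by fastforce
  qed
qed

section \<open>The ends of a black path\<close>

text \<open>Alternating two involutions, one of them without fixed points, from a fixed point of the other leads
  around a cycle of even length that is its own mirror image; the opposite point of the cycle is the only
  other fixed point.\<close>

locale alternating_involutions =
  fixes A :: "'a set" and \<alpha> \<beta> :: "'a \<Rightarrow> 'a" and s :: 'a
  assumes finite_carrier: "finite A"
    and \<alpha>_in: "x \<in> A \<Longrightarrow> \<alpha> x \<in> A" and \<alpha>_\<alpha>: "x \<in> A \<Longrightarrow> \<alpha> (\<alpha> x) = x" and \<alpha>_neq: "x \<in> A \<Longrightarrow> \<alpha> x \<noteq> x"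
    and \<beta>_in: "x \<in> A \<Longrightarrow> \<beta> x \<in> A" and \<beta>_\<beta>: "x \<in> A \<Longrightarrow> \<beta> (\<beta> x) = x"
    and start_in: "s \<in> A" and start_fixed: "\<beta> s = s"
begin

definition walk :: "nat \<Rightarrow> 'a" where
  "walk n = ((\<beta> \<circ> \<alpha>) ^^ n) s"

definition period :: nat where
  "period = funpow_dist1 (\<beta> \<circ> \<alpha>) s s"

lemma walk_0: "walk 0 = s"
  and walk_Suc: "walk (Suc n) = \<beta> (\<alpha> (walk n))"
  by (simp_all add: walk_def)

lemma walk_in: "walk n \<in> A"
  by (induction n) (simp_all add: walk_0 walk_Suc start_in \<alpha>_in \<beta>_in)

lemma start_in_orbit: "s \<in> orbit (\<beta> \<circ> \<alpha>) s"
proof (rule self_in_orbit_if_inj_on[OF finite_carrier _ _ start_in])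
  show "(\<beta> \<circ> \<alpha>) ` A \<subseteq> A" using \<alpha>_in \<beta>_in by auto
  show "inj_on (\<beta> \<circ> \<alpha>) A" by (rule inj_onI) (metis \<alpha>_\<alpha> \<alpha>_in \<beta>_\<beta> comp_apply)
qed

lemma period_pos: "0 < period"
  by (simp add: period_def)

lemma walk_period: "walk period = s"
  unfolding walk_def period_def by (rule funpow_dist1_prop[OF start_in_orbit])

lemma start_in_walk: "s \<in> walk ` {..<period}"
  using walk_0 period_pos by (intro image_eqI[of _ _ 0]) simp_all

lemma walk_eq_iff: "i < period \<Longrightarrow> j < period \<Longrightarrow> walk i = walk j \<longleftrightarrow> i = j"
  using inj_on_eq_iff[OF inj_on_funpow_dist1[OF start_in_orbit]] unfolding walk_def period_def by simp

lemma \<alpha>_walk: "k < period \<Longrightarrow> \<alpha> (walk k) = walk (period - 1 - k)"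
proof (induction k)
  case 0
  have "\<beta> (\<alpha> (walk (period - 1))) = s" using walk_Suc[of "period - 1"] walk_period period_pos by simp
  then have "\<alpha> (walk (period - 1)) = s" using \<beta>_\<beta>[OF \<alpha>_in[OF walk_in]] start_fixed by metis
  then show ?case using \<alpha>_\<alpha>[OF walk_in, of "period - 1"] by (simp add: walk_0)
next
  case (Suc k)
  define j where "j = period - 1 - Suc k"
  then have "period - 1 - k = Suc j" using Suc.prems by simp
  then have "\<beta> (\<alpha> (walk j)) = \<alpha> (walk k)" using Suc walk_Suc[of j] by simp
  then have "\<alpha> (walk j) = walk (Suc k)"
    using \<beta>_\<beta>[OF \<alpha>_in[OF walk_in], of j] walk_Suc[of k] by simp
  then show ?case using \<alpha>_\<alpha>[OF walk_in, of j] j_def by simp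
qed

lemma \<beta>_walk: "0 < k \<Longrightarrow> k < period \<Longrightarrow> \<beta> (walk k) = walk (period - k)"
  using walk_Suc[of "k - 1"] \<beta>_\<beta>[OF \<alpha>_in[OF walk_in], of "k - 1"] \<alpha>_walk[of "k - 1"] by simp

lemma even_period: "even period"
proof (rule ccontr)
  assume "odd period"
  then have "period - 1 - period div 2 = period div 2" by (auto elim!: oddE)
  moreover have "period div 2 < period" using period_pos by simp
  ultimately show False using \<alpha>_walk \<alpha>_neq[OF walk_in] by metis
qed

lemma period_div_two: "0 < period div 2" "period div 2 < period"
  using even_period period_pos by (auto elim: evenE)

lemma walk_fixed_iff: "k < period \<Longrightarrow> \<beta> (walk k) = walk k \<longleftrightarrow> k = 0 \<or> k = period div 2"
proof (cases "k = 0")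
  case False
  assume "k < period"
  then have "\<beta> (walk k) = walk k \<longleftrightarrow> period - k = k"
    using False \<beta>_walk[of k] walk_eq_iff[of "period - k" k] by simp
  then show ?thesis using False \<open>k < period\<close> even_period by auto
qed (simp add: walk_0 start_fixed)

lemma \<alpha>_walk_fixed_iff:
  "Suc k \<le> period div 2 \<Longrightarrow> \<beta> (\<alpha> (walk k)) = \<alpha> (walk k) \<longleftrightarrow> Suc k = period div 2"
  using \<alpha>_walk[of k] walk_fixed_iff[of "period - 1 - k"] period_div_two even_period by auto

lemma walk_closed:
  assumes "x \<in> walk ` {..<period}" shows "\<alpha> x \<in> walk ` {..<period}" "\<beta> x \<in> walk ` {..<period}"
proof -
  obtain k where k: "x = walk k" "k < period" using assms by blast
  show "\<alpha> x \<in> walk ` {..<period}" using k \<alpha>_walk[OF k(2)] by auto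
  show "\<beta> x \<in> walk ` {..<period}"
    using k assms \<beta>_walk[of k] walk_0 start_fixed by (cases "k = 0") auto
qed

lemma walk_halves:
  assumes "x \<in> walk ` {..<period}" obtains k where "k < period div 2" "x = walk k \<or> x = \<alpha> (walk k)"
proof -
  obtain k where k: "x = walk k" "k < period" using assms by blast
  show thesis
  proof (cases "k < period div 2")
    case True then show thesis using that k by blast
  next
    case False
    then have "period - 1 - k < period div 2" using k(2) even_period by (auto elim!: evenE)
    moreover have "x = \<alpha> (walk (period - 1 - k))" using \<alpha>_walk[of "period - 1 - k"] k by simp
    ultimately show thesis using that by blast
  qed
qed

end

context plane_domain begin

context
  fixes b :: "half \<Rightarrow> bool" and s :: half
  assumes b: "fpl b" and s: "s \<in> ends b"
begin

interpretation alternating_involutions "{h \<in> H. b h}" m "other_black b" s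
proof
  show "finite {h \<in> H. b h}" using finite_halves by simp
  show "s \<in> {h \<in> H. b h}" "other_black b s = s" using s by (simp_all add: ends_def other_black_def)
  fix x assume "x \<in> {h \<in> H. b h}"
  then show "m x \<noteq> x" using par_mate by fastforce
  from \<open>x \<in> {h \<in> H. b h}\<close> show "m x \<in> {h \<in> H. b h}" "m (m x) = x"
    "other_black b x \<in> {h \<in> H. b h}" "other_black b (other_black b x) = x"
    using mate_in mate_mate fpl_mate[OF b] other_black_in[OF b] other_black_black[OF b]
      other_black_other_black[OF b] by auto
qed

lemma walk_in_H: "walk k \<in> H" and walk_black: "b (walk k)"
  using walk_in by blast+

lemma walk_in_path: "walk k \<in> path b s"
proof (induction k)
  case 0 then show ?case by (simp add: walk_0 self_in_path)
next
  case (Suc k)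
  have black: "b s" using s by (simp add: ends_def)
  have mate: "m (walk k) \<in> H" "b (m (walk k))" "m (walk k) \<in> path b s"
    using path_mate_iff[OF b black walk_in_H] Suc walk_in_H walk_black mate_in fpl_mate[OF b] by auto
  then show ?case
    using path_vertex[OF b black mate(3)] black_at_vertex[OF b mate(1,2)] other_black_black[OF b mate(1,2)]
    unfolding walk_Suc by blast
qed

lemma path_eq_walk: "path b s = walk ` {..<period}"
proof
  show "walk ` {..<period} \<subseteq> path b s" using walk_in_path by blast
  have "path_labelling b (\<lambda>x. x \<in> walk ` {..<period})"
    unfolding path_labelling_def
  proof (intro ballI impI conjI)
    fix h assume h: "h \<in> H" "b h"
    show "(m h \<in> walk ` {..<period}) = (h \<in> walk ` {..<period})"
      using walk_closed(1) mate_mate[OF h(1)] by metis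
    fix g assume "g \<in> vertex_of \<Lambda> h" "b g"
    then have "g = h \<or> g = other_black b h" using black_at_vertex[OF b h] by blast
    then show "(g \<in> walk ` {..<period}) = (h \<in> walk ` {..<period})"
      using walk_closed(2) other_black_other_black[OF b h] by metis
  qed
  then show "path b s \<subseteq> walk ` {..<period}"
    using path_labelling_on_path[OF b, of s "\<lambda>x. x \<in> walk ` {..<period}"] walk_black[of 0] start_in_walk
    by (auto simp: walk_0)
qed

lemma walk_sides:
  assumes "region_labelling (path b s) \<chi>" "k < period div 2"
  shows "\<chi> (walk k) = \<chi> s \<and> \<chi> (m (walk k)) = \<chi> (m s)"
  using assms(2)
proof (induction k)
  case (Suc k)
  let ?h = "m (walk k)"
  have h: "?h \<in> H" "b ?h" "m ?h = walk k"
    using walk_in_H walk_black mate_in mate_mate fpl_mate[OF b] by auto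
  then have "?h \<notin> ends b"
    using \<alpha>_walk_fixed_iff[of k] other_black_eq_self_iff[OF b h(1,2)] Suc.prems by simp
  then show ?case
    using region_labelling_other_black[OF b h(1,2) _ assms(1)] path_black[OF b] s Suc h(3)
    unfolding walk_Suc ends_def by auto
qed (simp add: walk_0)

lemma path_ends:
  obtains t where "t \<in> path b s" "t \<noteq> s" "path b s \<inter> ends b = {s, t}"
    "\<forall>\<chi>. region_labelling (path b s) \<chi> \<longrightarrow> \<chi> t = \<chi> (m s)"
proof
  let ?t = "walk (period div 2)"
  show "?t \<in> path b s" by (rule walk_in_path)
  show "?t \<noteq> s" using walk_eq_iff[of "period div 2" 0] period_div_two by (simp add: walk_0)
  have "walk k \<in> ends b \<longleftrightarrow> k = 0 \<or> k = period div 2" if "k < period" for k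
    using walk_fixed_iff[OF that] other_black_eq_self_iff[OF b walk_in_H walk_black] by simp
  then show "path b s \<inter> ends b = {s, ?t}"
    unfolding path_eq_walk using period_div_two(2) s start_in_walk by (auto simp: walk_0)
  have pred: "Suc (period div 2 - 1) = period div 2" using period_div_two(1) by simp
  have "?t = m (walk (period div 2 - 1))"
    using \<alpha>_walk_fixed_iff[of "period div 2 - 1"] walk_Suc[of "period div 2 - 1"] unfolding pred by simp
  then show "\<forall>\<chi>. region_labelling (path b s) \<chi> \<longrightarrow> \<chi> ?t = \<chi> (m s)"
    using walk_sides[of _ "period div 2 - 1"] period_div_two(1) by simp
qed

lemma path_sides:
  assumes "x \<in> path b s"
  shows "(\<forall>\<chi>. region_labelling (path b s) \<chi> \<longrightarrow> \<chi> x = \<chi> s \<and> \<chi> (m x) = \<chi> (m s)) \<or>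
    (\<forall>\<chi>. region_labelling (path b s) \<chi> \<longrightarrow> \<chi> x = \<chi> (m s) \<and> \<chi> (m x) = \<chi> s)"
proof -
  obtain k where "k < period div 2" "x = walk k \<or> x = m (walk k)"
    using assms walk_halves unfolding path_eq_walk by metis
  then show ?thesis using walk_sides[of _ k] mate_mate[OF walk_in_H, of k] by metis
qed

end

lemma bounds_path:
  assumes b: "fpl b" and s: "s \<in> X" "b s" and t: "path b s \<inter> ends b = {s, t}" "t \<in> X"
  shows "\<exists>\<chi>. bounds \<Lambda> (path b s) \<chi>"
proof (rule planar)
  show "path b s \<subseteq> H" using path_subset_H[OF b s(2)] by blast
  show "m h \<in> path b s" if "h \<in> path b s" for h
    using path_mate_iff[OF b s(2)] path_subset_H[OF b s(2) that] that by blast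
  show "even (card (path b s \<inter> vertex_of \<Lambda> h))" if h: "h \<in> H - X" for h
  proof (cases "path b s \<inter> vertex_of \<Lambda> h = {}")
    case False
    then obtain x where x: "x \<in> path b s" "x \<in> vertex_of \<Lambda> h" by blast
    have black: "x \<in> H" "b x" using path_subset_H[OF b s(2)] path_black[OF b s(2)] x by auto
    have vertex: "vertex_of \<Lambda> x = vertex_of \<Lambda> h" using vertex_of_eq h x by blast
    have "x \<notin> X" using vertex_of_notin_X h x(2) by blast
    then have "x \<notin> {s, t}" using s(1) t(2) by blast
    then have "x \<notin> ends b" using x(1) unfolding t(1)[symmetric] by blast
    then have "other_black b x \<noteq> x" using other_black_eq_self_iff[OF b black] by blast
    moreover have "path b s \<inter> vertex_of \<Lambda> x = {x, other_black b x}"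
      using path_vertex[OF b s(2) x(1)] black_at_vertex[OF b black] path_black[OF b s(2)] by blast
    ultimately show ?thesis using vertex by simp
  qed simp
qed

lemma other_path_one_side:
  assumes b: "fpl b" and s: "b s" and \<chi>: "region_labelling (path b s) \<chi>"
    and t: "t \<notin> path b s" "b t" and x: "x \<in> path b t"
  shows "\<chi> x = \<chi> t"
proof -
  let ?C = "path b s"
  have "path_labelling b (\<lambda>y. y \<notin> ?C \<and> \<chi> y)"
    unfolding path_labelling_def
  proof (intro ballI impI conjI)
    fix h assume h: "h \<in> H" "b h"
    show "(m h \<notin> ?C \<and> \<chi> (m h)) = (h \<notin> ?C \<and> \<chi> h)"
      using region_labelling_cross[OF \<chi> h(1)] path_mate_iff[OF b s h(1)] by blast
    fix g assume g: "g \<in> vertex_of \<Lambda> h" "b g"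
    then have same: "g \<in> ?C \<longleftrightarrow> h \<in> ?C" using path_labelling_vertex[OF path_labelling_path[OF b s]] h by blast
    have "\<chi> g = \<chi> h" if "h \<notin> ?C"
    proof (cases "g = h")
      case False
      then have "g = other_black b h" using g black_at_vertex[OF b h] by blast
      moreover from this have "h \<notin> ends b" using False other_black_eq_self_iff[OF b h] by blast
      ultimately show ?thesis
        using region_labelling_other_black(1)[OF b h _ \<chi> path_black[OF b s]] region_labelling_cross[OF \<chi> h(1) that]
        by simp
    qed simp
    then show "(g \<notin> ?C \<and> \<chi> g) = (h \<notin> ?C \<and> \<chi> h)" using same by blast
  qed
  from path_labelling_on_path[OF b t(2) this x] path_labelling_on_path[OF b t(2) path_labelling_path[OF b s] x]
  show ?thesis using t(1) by blast
qed

lemma region_labellings_constant: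
  assumes \<chi>: "region_labelling C \<chi>" and \<xi>: "region_labelling D \<xi>"
    and cross: "\<And>y. y \<in> H \<Longrightarrow> y \<in> C \<or> y \<in> D \<Longrightarrow> F (\<chi> (m y)) (\<xi> (m y)) = F (\<chi> y) (\<xi> y)"
    and xy: "x \<in> H" "y \<in> H"
  shows "F (\<chi> x) (\<xi> x) = (F (\<chi> y) (\<xi> y) :: bool)"
proof (rule connected[OF _ xy(2,1)])
  fix h assume h: "h \<in> H"
  have mate: "F (\<chi> (m h)) (\<xi> (m h)) = F (\<chi> h) (\<xi> h)"
  proof (cases "h \<in> C \<or> h \<in> D")
    case True then show ?thesis by (rule cross[OF h])
  next
    case False
    then show ?thesis using region_labelling_cross[OF \<chi> h] region_labelling_cross[OF \<xi> h] by simp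
  qed
  moreover have "F (\<chi> (c h)) (\<xi> (c h)) = F (\<chi> h) (\<xi> h)"
  proof (cases "h \<in> X")
    case True then show ?thesis by (simp add: ccw_ext)
  next
    case False
    then show ?thesis
      using mate region_labelling_turn[OF \<chi> h False] region_labelling_turn[OF \<xi> h False] by simp
  qed
  ultimately show "F (\<chi> (m h)) (\<xi> (m h)) = F (\<chi> h) (\<xi> h) \<and> F (\<chi> (c h)) (\<xi> (c h)) = F (\<chi> h) (\<xi> h)" ..
qed

section \<open>Link patterns\<close>

abbreviation "K \<equiv> {1..nblack \<Lambda>}"

lemma idx_period: "idx v (k + N) = idx v k" if "k \<ge> 1"
proof -
  have "v - 1 + 2 * (k + N - 1) = v - 1 + 2 * (k - 1) + 2 * N" using that by simp
  then show ?thesis unfolding idx_def by (metis mod_add_self2)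
qed

lemma inj_on_idx: "inj_on (idx v) K"
proof (rule linorder_inj_onI)
  fix k l assume kl: "k < l" "k \<in> K" "l \<in> K"
  show "idx v k \<noteq> idx v l"
  proof
    assume "idx v k = idx v l"
    then have "(v - 1 + 2 * (l - 1)) mod (2 * N) = (v - 1 + 2 * (k - 1)) mod (2 * N)"
      unfolding idx_def by simp
    then have "2 * N dvd (v - 1 + 2 * (l - 1)) - (v - 1 + 2 * (k - 1))"
      using kl(1) by (subst mod_eq_dvd_iff_nat[symmetric]) auto
    moreover have "(v - 1 + 2 * (l - 1)) - (v - 1 + 2 * (k - 1)) = 2 * (l - k)" using kl by auto
    ultimately have "N dvd l - k" by simp
    then show False using kl by (auto dest: dvd_imp_le)
  qed
qed auto

lemma black_ext_idx:
  assumes b: "fpl b" and v: "v \<in> J" "b (e v)" and j: "j \<in> J" "b (e j)"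
  obtains k where "k \<in> K" "j = idx v k"
proof -
  have parity: "even (j + v)"
    using fpl_ext_parity[OF b v(1)] fpl_ext_parity[OF b j(1)] v(2) j(2) by simp
  show thesis
  proof (cases "v \<le> j")
    case True
    have "v - 1 + 2 * ((j - v) div 2) = j - 1" using True parity v(1) by auto
    then have "j = idx v ((j - v) div 2 + 1)" using j(1) unfolding idx_def by auto
    then show thesis using that[of "(j - v) div 2 + 1"] v(1) j(1) by auto
  next
    case False
    let ?k = "(j + 2 * N - v) div 2 + 1"
    have "v - 1 + 2 * (?k - 1) = j - 1 + 2 * N" using False parity v(1) j(1) by auto
    moreover have "(j - 1 + 2 * N) mod (2 * N) = j - 1" using j(1) by (subst mod_add_self2) auto
    ultimately have "idx v ?k = j - 1 + 1" unfolding idx_def by (simp only:)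
    then have "j = idx v ?k" using j(1) by simp
    then show thesis using that[of ?k] v(1) j(1) False by auto
  qed
qed

context
  fixes b :: "half \<Rightarrow> bool" and v :: nat
  assumes b: "fpl b" and v: "v \<in> J" "b (e v)"
begin

abbreviation "pt k \<equiv> e (idx v k)"
abbreviation "linked \<equiv> linked_labels \<Lambda> (edges_of b) v"
abbreviation "arcs \<equiv> {{k, l} | k l. (k, l) \<in> linked}"

lemma linked_iff: "(k, l) \<in> linked \<longleftrightarrow> k \<in> K \<and> l \<in> K \<and> k \<noteq> l \<and> pt l \<in> path b (pt k)"
  unfolding linked_labels_def relabelled_eq by blast

lemma pt_in: "pt k \<in> X" "pt k \<in> H"
  using idx_in ext_in_X ext_in by blast+

lemma pt_black: "k \<ge> 1 \<Longrightarrow> b (pt k)"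
  using fpl_idx[OF b v(1)] v(2) by simp

lemma pt_in_ends: "k \<ge> 1 \<Longrightarrow> pt k \<in> ends b"
  using pt_black pt_in unfolding ends_def by blast

lemma label_black: "k \<in> K \<Longrightarrow> b (pt k)" and label_in_ends: "k \<in> K \<Longrightarrow> pt k \<in> ends b"
  using pt_black pt_in_ends by auto

lemma pt_eq_iff: "k \<in> K \<Longrightarrow> l \<in> K \<Longrightarrow> pt k = pt l \<longleftrightarrow> k = l"
  using inj_on_eq_iff[OF inj_on_idx] ext_eq_iff[OF idx_in idx_in] by simp

lemma black_ext_pt:
  assumes "t \<in> X" "b t" obtains k where "k \<in> K" "t = pt k"
  using assms black_ext_idx[OF b v next_ext_in] by (metis ext_next_cases)

lemma linked_path_eq: "(k, l) \<in> linked \<Longrightarrow> path b (pt l) = path b (pt k)"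
  using path_eq[OF b label_black] unfolding linked_iff by blast

lemma linked_sym: "(k, l) \<in> linked \<Longrightarrow> (l, k) \<in> linked"
  using linked_path_eq[of k l] self_in_path[of "pt k" b] unfolding linked_iff by blast

lemma linked_ends_path:
  assumes "(k, l) \<in> linked"
  shows "path b (pt k) \<inter> ends b = {pt k, pt l}"
    "\<And>\<chi>. region_labelling (path b (pt k)) \<chi> \<Longrightarrow> \<chi> (pt l) = \<chi> (m (pt k))"
proof -
  have kl: "k \<in> K" "l \<in> K" "k \<noteq> l" "pt l \<in> path b (pt k)" using assms linked_iff by auto
  obtain t where t: "path b (pt k) \<inter> ends b = {pt k, t}"
    "\<forall>\<chi>. region_labelling (path b (pt k)) \<chi> \<longrightarrow> \<chi> t = \<chi> (m (pt k))"
    by (rule path_ends[OF b label_in_ends[OF kl(1)]]) (rule that)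
  have "pt l \<in> {pt k, t}" using kl label_in_ends[OF kl(2)] unfolding t(1)[symmetric] by blast
  then have "t = pt l" using pt_eq_iff kl by auto
  then show "path b (pt k) \<inter> ends b = {pt k, pt l}"
    "\<And>\<chi>. region_labelling (path b (pt k)) \<chi> \<Longrightarrow> \<chi> (pt l) = \<chi> (m (pt k))" using t by simp_all
qed

lemma single_valued_linked: "single_valued linked"
proof (rule single_valuedI)
  fix k l l' assume kl: "(k, l) \<in> linked" "(k, l') \<in> linked"
  then have "{pt k, pt l} = {pt k, pt l'}" using linked_ends_path(1) by metis
  then show "l = l'" using kl pt_eq_iff unfolding linked_iff doubleton_eq_iff by auto
qed

lemma perfect_matching_arcs: "perfect_matching (Domain linked) arcs"
  by (rule perfect_matching_sym_rel)
    (auto intro: symI irreflI linked_sym single_valued_linked simp: linked_iff)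

lemma linked_exists:
  assumes k: "k \<in> K" and no_end: "\<And>h. h \<in> path b (pt k) \<Longrightarrow> \<not> bivalent \<Lambda> h"
  shows "k \<in> Domain linked"
proof -
  obtain t where t: "t \<in> path b (pt k)" "t \<noteq> pt k" "path b (pt k) \<inter> ends b = {pt k, t}"
    by (rule path_ends[OF b label_in_ends[OF k]]) (rule that)
  then have "t \<in> X" "b t" using no_end[OF t(1)] unfolding ends_def by auto
  then obtain l where "l \<in> K" "t = pt l" by (rule black_ext_pt)
  then show ?thesis using t k linked_iff by blast
qed

lemma not_linked_notin_path:
  assumes "(i, l) \<in> linked" "k \<in> K" "k \<noteq> i" "k \<noteq> l" shows "pt k \<notin> path b (pt i)"
proof
  assume "pt k \<in> path b (pt i)"
  then have "pt k \<in> {pt i, pt l}"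
    using label_in_ends[OF assms(2)] unfolding linked_ends_path(1)[OF assms(1), symmetric] by blast
  then show False using assms pt_eq_iff unfolding linked_iff by auto
qed

context
  fixes i l and \<chi> :: "half \<Rightarrow> bool"
  assumes il: "(i, l) \<in> linked" and \<chi>: "bounds \<Lambda> (path b (pt i)) \<chi>"
begin

lemma linked_separated: "\<chi> (pt l) \<noteq> \<chi> (pt i)"
proof -
  have "\<chi> (m (pt i)) \<noteq> \<chi> (pt i)" using \<chi> pt_in(2) self_in_path unfolding bounds_def by blast
  then show ?thesis using linked_ends_path(2)[OF il bounds_region_labelling[OF \<chi>]] by simp
qed

lemma side_of_next_label:
  assumes k: "k \<ge> 1" "pt (Suc k) \<noteq> pt i" "pt (Suc k) \<noteq> pt l" shows "\<chi> (pt (Suc k)) = \<chi> (pt k)"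
proof -
  note next_side = region_labelling_next_ext[OF bounds_region_labelling[OF \<chi>]]
  have i: "i \<in> K" using il linked_iff by blast
  have "\<not> b (e (nx (idx v k)))" using fpl_next_ext[OF b idx_in] pt_black[OF k(1)] by blast
  then have "\<chi> (e (nx (idx v k))) = \<chi> (pt k)" using next_side[OF idx_in] path_black[OF b label_black[OF i]] by blast
  moreover have "pt (Suc k) \<notin> path b (pt i)"
    using pt_in_ends[of "Suc k"] linked_ends_path(1)[OF il] k by auto
  ultimately show ?thesis using next_side[OF next_ext_in] unfolding idx_Suc[OF k(1)] by simp
qed

lemma side_iff_in_arc:
  assumes k: "k \<in> K" shows "\<chi> (pt k) = \<chi> (pt i) \<longleftrightarrow> k \<in> arc N i l"
proof -
  have il_in: "i \<in> K" "l \<in> K" using il linked_iff by auto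
  show ?thesis
  proof (rule in_arc_iff_if_locally_constant[OF il_in refl _ _ _ k])
    show "\<chi> (pt l) \<noteq> \<chi> (pt i)" by (rule linked_separated)
    show "(\<chi> (pt (Suc r)) = \<chi> (pt i)) = (\<chi> (pt r) = \<chi> (pt i))"
      if "1 \<le> r" "r < N" "Suc r \<notin> {i, l}" for r
      using side_of_next_label[of r] that pt_eq_iff[of "Suc r"] il_in by simp
    show "(\<chi> (pt 1) = \<chi> (pt i)) = (\<chi> (pt N) = \<chi> (pt i))" if "1 \<notin> {i, l}"
      using side_of_next_label[of N] that pt_eq_iff[of 1] il_in idx_period[of 1 v] nblack_pos by simp
  qed
qed

lemma side_of_path:
  assumes "k \<in> K" "k \<noteq> i" "k \<noteq> l" "y \<in> path b (pt k)"
  shows "\<chi> y = \<chi> (pt i) \<longleftrightarrow> k \<in> arc N i l"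
proof -
  have "i \<in> K" using il linked_iff by blast
  then have "\<chi> y = \<chi> (pt k)"
    using other_path_one_side[OF b label_black bounds_region_labelling[OF \<chi>] not_linked_notin_path[OF il]]
      assms label_black by blast
  then show ?thesis using side_iff_in_arc[OF assms(1)] by simp
qed

end

lemma linked_bounds:
  assumes "(k, l) \<in> linked" obtains \<chi> where "bounds \<Lambda> (path b (pt k)) \<chi>"
  using bounds_path[OF b _ _ linked_ends_path(1)[OF assms]] pt_in label_black assms linked_iff by blast

lemma linked_in_arc_iff:
  assumes il: "(i, l) \<in> linked" and kr: "(k, r) \<in> linked" and separate: "k \<noteq> i" "k \<noteq> l"
  shows "k \<in> arc N i l \<longleftrightarrow> r \<in> arc N i l"
proof -
  obtain \<chi> where \<chi>: "bounds \<Lambda> (path b (pt i)) \<chi>" by (rule linked_bounds[OF il])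
  have "k \<in> K" "r \<in> K" "pt r \<in> path b (pt k)" using kr linked_iff by auto
  then show ?thesis using side_of_path[OF il \<chi> _ separate] side_iff_in_arc[OF il \<chi>] by metis
qed

lemma noncrossing_arcs: "noncrossing arcs"
  unfolding noncrossing_def
proof clarify
  fix i j k l p q p' q'
  assume order: "i < k" "k < j" "j < l"
    and "{i, j} = {p, q}" "(p, q) \<in> linked" "{k, l} = {p', q'}" "(p', q') \<in> linked"
  then have linked: "(i, j) \<in> linked" "(k, l) \<in> linked" using linked_sym by (metis doubleton_eq_iff)+
  have "k \<in> arc N i j \<longleftrightarrow> l \<in> arc N i j" by (rule linked_in_arc_iff[OF linked]) (use order in auto)
  then show False using order by (simp add: arc_def)
qed

lemma Domain_linked_if_quartic:
  assumes quartic: "\<And>h. h \<in> H - X \<Longrightarrow> quartic \<Lambda> h" shows "Domain linked = K"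
proof
  have "\<not> bivalent \<Lambda> h" if "h \<in> H" for h
    using quartic[of h] quartic_not_bivalent ccw_ext that unfolding bivalent_def by blast
  then show "K \<subseteq> Domain linked" using linked_exists path_subset_H[OF b label_black] by blast
qed (auto simp: linked_iff)

lemma link_pattern_disk_in_LP:
  assumes p: "puncture \<Lambda> = Unpunctured"
  shows "link_pattern_of \<Lambda> (edges_of b) v \<in> LP_domain \<Lambda>"
proof -
  have "Domain linked = K" using puncture_ok p unfolding puncture_ok_def by (intro Domain_linked_if_quartic) auto
  moreover have "link_pattern_of \<Lambda> (edges_of b) v = Disk arcs"
    unfolding link_pattern_of_def Let_def by (simp add: p)
  ultimately show ?thesis
    using p noncrossing_arcs perfect_matching_arcs unfolding LP_domain_def LP_def by auto
qed

lemma in_region_of_either_end: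
  assumes kl: "(k, l) \<in> linked" and p: "p \<in> H"
  shows "p \<in> region \<Lambda> (path b (pt k)) (pt k) \<or> p \<in> region \<Lambda> (path b (pt k)) (pt l)"
proof -
  let ?C = "path b (pt k)"
  let ?in = "\<lambda>s y. y \<in> region \<Lambda> ?C s"
  have k: "k \<in> K" using kl linked_iff by blast
  have self: "?in y y" for y by (simp add: region_iff)
  have "(?in (pt k) p \<or> ?in (pt l) p) = (?in (pt k) (pt k) \<or> ?in (pt l) (pt k))"
  proof (rule region_labellings_constant[OF region_labelling_region region_labelling_region _ p pt_in(2)])
    fix y assume "y \<in> ?C \<or> y \<in> ?C"
    then have "y \<in> ?C" by blast
    moreover have "?in (pt l) (m (pt k))" using linked_ends_path(2)[OF kl] unfolding region_iff by metis
    ultimately show "(?in (pt k) (m y) \<or> ?in (pt l) (m y)) = (?in (pt k) y \<or> ?in (pt l) y)"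
      using path_sides[OF b label_in_ends[OF k]] region_labelling_region[of ?C] self by metis
  qed
  then show ?thesis using self by blast
qed

lemma in_region_of_one_end:
  assumes kl: "(k, l) \<in> linked" and p: "p \<in> H"
  shows "p \<in> region \<Lambda> (path b (pt k)) (pt k) \<longleftrightarrow> p \<notin> region \<Lambda> (path b (pt l)) (pt l)"
proof -
  obtain \<chi> where \<chi>: "bounds \<Lambda> (path b (pt k)) \<chi>" by (rule linked_bounds[OF kl])
  have "\<not> (p \<in> region \<Lambda> (path b (pt k)) (pt k) \<and> p \<in> region \<Lambda> (path b (pt k)) (pt l))"
    using linked_separated[OF kl \<chi>] bounds_region_labelling[OF \<chi>] unfolding region_iff by metis
  then show ?thesis using in_region_of_either_end[OF kl p] linked_path_eq[OF kl] by auto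
qed

text \<open>The sides of two disjoint arcs that contain the puncture cannot be disjoint, since the puncture lies
  in both.\<close>

lemma arcs_not_covering:
  assumes ij: "(i, j) \<in> linked" "p \<notin> region \<Lambda> (path b (pt i)) (pt i)"
    and kl: "(k, l) \<in> linked" "p \<notin> region \<Lambda> (path b (pt k)) (pt k)"
    and p: "p \<in> H" and separate: "distinct [i, j, k, l]"
  shows "\<not> (k \<in> arc N i j \<and> i \<in> arc N k l)"
proof
  assume cover: "k \<in> arc N i j \<and> i \<in> arc N k l"
  have K: "i \<in> K" "k \<in> K" using ij kl linked_iff by auto
  obtain \<chi> where \<chi>: "bounds \<Lambda> (path b (pt i)) \<chi>" by (rule linked_bounds[OF ij(1)])
  obtain \<xi> where \<xi>: "bounds \<Lambda> (path b (pt k)) \<xi>" by (rule linked_bounds[OF kl(1)])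
  note labelling = bounds_region_labelling[OF \<chi>] bounds_region_labelling[OF \<xi>]
  have puncture_side: "\<chi> p \<noteq> \<chi> (pt i)" "\<xi> p \<noteq> \<xi> (pt k)"
    using in_region_of_either_end[OF ij(1) p] ij(2) linked_separated[OF ij(1) \<chi>]
      in_region_of_either_end[OF kl(1) p] kl(2) linked_separated[OF kl(1) \<xi>] labelling
    unfolding region_iff by metis+
  have on_k: "\<chi> y = \<chi> (pt i)" if "y \<in> path b (pt k)" for y
    using side_of_path[OF ij(1) \<chi> K(2) _ _ that] cover separate by simp
  have on_i: "\<xi> y = \<xi> (pt k)" if "y \<in> path b (pt i)" for y
    using side_of_path[OF kl(1) \<xi> K(1) _ _ that] cover separate by simp
  have "(\<chi> p \<noteq> \<chi> (pt i) \<and> \<xi> p \<noteq> \<xi> (pt k)) = (\<chi> (pt i) \<noteq> \<chi> (pt i) \<and> \<xi> (pt i) \<noteq> \<xi> (pt k))"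
  proof (rule region_labellings_constant[OF labelling _ p pt_in(2)])
    fix y assume "y \<in> H" "y \<in> path b (pt i) \<or> y \<in> path b (pt k)"
    then show "(\<chi> (m y) \<noteq> \<chi> (pt i) \<and> \<xi> (m y) \<noteq> \<xi> (pt k)) = (\<chi> y \<noteq> \<chi> (pt i) \<and> \<xi> y \<noteq> \<xi> (pt k))"
      using on_i on_k path_mate_iff[OF b label_black[OF K(1)]] path_mate_iff[OF b label_black[OF K(2)]] by metis
  qed
  then show False using puncture_side by blast
qed

lemma ccw_intervals_around_puncture:
  assumes p: "p \<in> H"
    and ij: "(i, j) \<in> linked" "p \<notin> region \<Lambda> (path b (pt i)) (pt i)"
    and kl: "(k, l) \<in> linked" "p \<notin> region \<Lambda> (path b (pt k)) (pt k)"
  shows "ccw_interval N (i, j) \<subseteq> ccw_interval N (k, l) \<or> ccw_interval N (k, l) \<subseteq> ccw_interval N (i, j) \<or>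
    ccw_interval N (i, j) \<inter> ccw_interval N (k, l) = {}"
proof -
  have "k \<noteq> j" using in_region_of_one_end[OF ij(1) p] ij(2) kl(2) by blast
  consider (equal) "k = i" | (distinct) "k \<noteq> i" by blast
  then show ?thesis
  proof cases
    case equal
    then have "l = j" using single_valuedD[OF single_valued_linked] ij(1) kl(1) by blast
    then show ?thesis using equal by simp
  next
    case distinct
    have K: "i \<in> K" "j \<in> K" "k \<in> K" "l \<in> K" and "i \<noteq> j" "k \<noteq> l" using ij kl linked_iff by auto
    moreover have "l \<noteq> i" "l \<noteq> j"
      using single_valuedD[OF single_valued_linked] linked_sym ij(1) kl(1) distinct \<open>k \<noteq> j\<close> by metis+
    ultimately have "distinct [i, j, k, l]" using distinct \<open>k \<noteq> j\<close> by auto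
    then show ?thesis
      by (intro ccw_intervals_nested_or_disjoint[OF K] linked_in_arc_iff[OF ij(1) kl(1)]
          linked_in_arc_iff[OF kl(1) ij(1)] arcs_not_covering[OF ij kl p]) auto
  qed
qed

lemma link_pattern_face_in_LP:
  assumes p: "puncture \<Lambda> = In_Face p"
  shows "link_pattern_of \<Lambda> (edges_of b) v \<in> LP_domain \<Lambda>"
proof -
  have "p \<in> H" and "Domain linked = K"
    using puncture_ok p Domain_linked_if_quartic unfolding puncture_ok_def by auto
  then have matching: "perfect_matching K arcs" using perfect_matching_arcs by simp
  define D where "D = {(k, l) \<in> linked. p \<notin> region \<Lambda> (path b (pt k)) (pt k)}"
  have link: "link_pattern_of \<Lambda> (edges_of b) v = Punctured_Even D"
    unfolding link_pattern_of_def D_def relabelled_eq Let_def by (simp add: p)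
  have one_end: "(k, l) \<in> D \<longleftrightarrow> (l, k) \<notin> D" if "(k, l) \<in> linked" for k l
    using that in_region_of_one_end[OF that \<open>p \<in> H\<close>] linked_sym unfolding D_def by blast
  have "(\<lambda>(i, j). {i, j}) ` D = arcs"
  proof
    show "(\<lambda>(i, j). {i, j}) ` D \<subseteq> arcs" unfolding D_def by auto
    show "arcs \<subseteq> (\<lambda>(i, j). {i, j}) ` D" using one_end by (force simp: insert_commute)
  qed
  moreover have "even N" using perfect_matching_even[OF matching] by simp
  moreover have "\<forall>(i, j)\<in>D. (j, i) \<notin> D" using one_end unfolding D_def by blast
  moreover have "\<forall>r\<in>D. \<forall>s\<in>D. ccw_interval N r \<subseteq> ccw_interval N s \<or> ccw_interval N s \<subseteq> ccw_interval N r \<or>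
      ccw_interval N r \<inter> ccw_interval N s = {}"
    using ccw_intervals_around_puncture[OF \<open>p \<in> H\<close>] unfolding D_def by blast
  ultimately show ?thesis
    unfolding link LP_domain_def LP_punctured_def using matching p by auto
qed

context
  fixes p assumes p: "puncture \<Lambda> = At_Vertex p"
begin

lemma puncture_vertex:
  shows "vertex_of \<Lambda> p = {p, c p}" "{p, c p} \<subseteq> H - X" "b (c p) \<noteq> b p"
    "h \<in> H \<Longrightarrow> bivalent \<Lambda> h \<longleftrightarrow> h \<in> {p, c p}"
proof -
  have ok: "p \<in> H - X" "bivalent \<Lambda> p" "\<And>h. h \<in> H - X \<Longrightarrow> h \<notin> {p, c p} \<Longrightarrow> quartic \<Lambda> h"
    using puncture_ok p unfolding puncture_ok_def by auto
  then show "vertex_of \<Lambda> p = {p, c p}" "{p, c p} \<subseteq> H - X" "b (c p) \<noteq> b p"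
    using vertex_of_bivalent ccw_in ccw_notin_X fpl_bivalent[OF b] by auto
  have "bivalent \<Lambda> (c p)" using ok(2) by (auto simp: bivalent_def)
  then show "h \<in> H \<Longrightarrow> bivalent \<Lambda> h \<longleftrightarrow> h \<in> {p, c p}"
    using ok ccw_ext quartic_not_bivalent by (auto simp: bivalent_def)
qed

lemma strand_to_puncture:
  obtains k\<^sub>0 where "k\<^sub>0 \<in> K" "Domain linked = K - {k\<^sub>0}"
    "\<forall>k\<in>K. path b (pt k) \<inter> vertex_of \<Lambda> p \<noteq> {} \<longleftrightarrow> k = k\<^sub>0"
proof -
  note vertex = puncture_vertex
  obtain u where u: "u \<in> {p, c p}" "b u" "\<And>z. z \<in> {p, c p} \<Longrightarrow> b z \<Longrightarrow> z = u" using vertex(3) by blast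
  have "u \<in> H" "u \<notin> X" using u(1) vertex(2) by blast+
  moreover from this have "u \<in> ends b" using u(1,2) vertex(4) unfolding ends_def by blast
  ultimately have u_in: "u \<in> H" "u \<notin> X" "u \<in> ends b" .
  obtain t where t: "t \<in> path b u" "t \<noteq> u" "path b u \<inter> ends b = {u, t}"
    by (rule path_ends[OF b u_in(3)]) (rule that)
  then have "t \<in> ends b" by blast
  then have "t \<in> X" "b t" using t(2) u(3)[of t] vertex(4)[of t] by (auto simp: ends_def)
  then obtain k\<^sub>0 where k\<^sub>0: "k\<^sub>0 \<in> K" "t = pt k\<^sub>0" by (rule black_ext_pt)
  have on_strand: "k = k\<^sub>0" if "k \<in> K" "pt k \<in> path b u" for k
  proof -
    have "pt k \<in> {u, t}" using that label_in_ends unfolding t(3)[symmetric] by blast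
    then show ?thesis using u_in(2) pt_in(1) pt_eq_iff that(1) k\<^sub>0 by auto
  qed
  have strand: "path b (pt k\<^sub>0) = path b u" using path_eq[OF b u(2) t(1)] k\<^sub>0(2) by simp
  have meets: "path b (pt k) \<inter> vertex_of \<Lambda> p \<noteq> {} \<longleftrightarrow> k = k\<^sub>0" if k: "k \<in> K" for k
  proof
    assume "path b (pt k) \<inter> vertex_of \<Lambda> p \<noteq> {}"
    then obtain z where "z \<in> path b (pt k)" "z \<in> {p, c p}" using vertex(1) by blast
    moreover from this have "z = u" using u(3) path_black[OF b label_black[OF k]] by blast
    ultimately have "u \<in> path b (pt k)" by blast
    then have "path b u = path b (pt k)" by (rule path_eq[OF b label_black[OF k]])
    then have "pt k \<in> path b u" using self_in_path by blast
    then show "k = k\<^sub>0" by (rule on_strand[OF k])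
  next
    assume "k = k\<^sub>0"
    then show "path b (pt k) \<inter> vertex_of \<Lambda> p \<noteq> {}" using strand self_in_path u(1) vertex(1) by blast
  qed
  have "k \<in> Domain linked" if "k \<in> K" "k \<noteq> k\<^sub>0" for k
    using that meets[of k] linked_exists path_subset_H[OF b label_black] vertex(1,4) by blast
  moreover have "k\<^sub>0 \<notin> Domain linked" using on_strand unfolding Domain_iff linked_iff strand by blast
  ultimately have "Domain linked = K - {k\<^sub>0}" using linked_iff by blast
  then show thesis using that[OF k\<^sub>0(1)] meets by blast
qed

lemma link_pattern_vertex_in_LP: "link_pattern_of \<Lambda> (edges_of b) v \<in> LP_domain \<Lambda>"
proof -
  obtain k\<^sub>0 where k\<^sub>0: "k\<^sub>0 \<in> K" "Domain linked = K - {k\<^sub>0}"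
    and meets: "\<forall>k\<in>K. path b (pt k) \<inter> vertex_of \<Lambda> p \<noteq> {} \<longleftrightarrow> k = k\<^sub>0"
    by (rule strand_to_puncture)
  let ?A = "insert None (Some ` K)"
  define M where "M = insert {Some k\<^sub>0, None} ((`) Some ` arcs)"
  have "{k. k \<in> K \<and> path b (pt k) \<inter> vertex_of \<Lambda> p \<noteq> {}} = {k\<^sub>0}" using meets k\<^sub>0(1) by blast
  then have "{{Some k, None} | k. k \<in> K \<and> path b (pt k) \<inter> vertex_of \<Lambda> p \<noteq> {}} = {{Some k\<^sub>0, None}}"
    unfolding setcompr_eq_image by simp
  moreover have "{{Some k, Some l} | k l. (k, l) \<in> linked} = (`) Some ` arcs"
    unfolding Collect_pair_eq_image by (simp add: image_image case_prod_unfold)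
  ultimately have link: "link_pattern_of \<Lambda> (edges_of b) v = Punctured_Odd M"
    unfolding link_pattern_of_def Let_def M_def relabelled_eq by (simp add: p)
  have "perfect_matching (insert (Some k\<^sub>0) (insert None (Some ` (K - {k\<^sub>0})))) M"
    unfolding M_def
    by (intro perfect_matching_insert perfect_matching_inj_image) (use perfect_matching_arcs k\<^sub>0(2) in auto)
  moreover have "insert (Some k\<^sub>0) (insert None (Some ` (K - {k\<^sub>0}))) = ?A" using k\<^sub>0(1) by blast
  ultimately have matching: "perfect_matching ?A M" by simp
  have "card ?A = N + 1" by (simp add: card_image)
  then have "odd N" using perfect_matching_even[OF matching] by simp
  moreover have "{s. Some ` s \<in> M} \<subseteq> arcs"
    unfolding M_def by (auto simp del: image_insert simp: inj_image_eq_iff) blast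
  then have "noncrossing {s. Some ` s \<in> M}" by (rule noncrossing_subset[OF _ noncrossing_arcs])
  ultimately show ?thesis unfolding link LP_domain_def LP_punctured_def using matching p by auto
qed

end

lemma link_pattern_of_in_LP_domain: "link_pattern_of \<Lambda> (edges_of b) v \<in> LP_domain \<Lambda>"
  using link_pattern_disk_in_LP link_pattern_face_in_LP link_pattern_vertex_in_LP by (cases "puncture \<Lambda>") auto

end

end

section \<open>Rotation and symmetrisation\<close>

lemma bij_betw_rot_label: "bij_betw (rot_label N) {1..N} {1..N}"
proof -
  have "inj_on (rot_label N) {1..N}"
  proof (rule inj_onI)
    fix i j assume "i \<in> {1..N}" "j \<in> {1..N}" "rot_label N i = rot_label N j"
    then show "i = j" by (cases "i = N"; cases "j = N") (auto simp: rot_label_def)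
  qed
  moreover have "rot_label N ` {1..N} \<subseteq> {1..N}" by (auto simp: rot_label_def Suc_le_eq)
  ultimately show ?thesis by (simp add: bij_betw_def endo_inj_surj)
qed

lemma Collect_image_bij_betw:
  assumes "bij_betw f A A" shows "{x. x \<in> A \<and> Q x} = f ` {x. x \<in> A \<and> Q (f x)}"
  using assms by (auto simp: bij_betw_def)

lemma Collect_pair_image_bij_betw:
  assumes f: "bij_betw f A A"
  shows "{(x, y). x \<in> A \<and> y \<in> A \<and> Q x y} = map_prod f f ` {(x, y). x \<in> A \<and> y \<in> A \<and> Q (f x) (f y)}"
proof -
  have "bij_betw (map_prod f f) (A \<times> A) (A \<times> A)" by (rule bij_betw_map_prod[OF f f])
  from Collect_image_bij_betw[OF this, of "\<lambda>(x, y). Q x y"] show ?thesis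
    by (simp add: case_prod_unfold mem_Times_iff conj_assoc)
qed

context plane_domain begin

lemma relabelled_next_ext_next_ext:
  assumes "v \<in> J" "k \<in> K" shows "relabelled \<Lambda> (nx (nx v)) k = relabelled \<Lambda> v (rot_label N k)"
proof -
  have "idx (nx (nx v)) k = idx v (k + 1)"
    using idx_next_ext[OF next_ext_in] idx_next_ext idx_Suc[of k v] assms by simp
  also have "\<dots> = idx v (rot_label N k)"
    using idx_period[of 1 v] assms(2) by (cases "k = N") (simp_all add: rot_label_def add.commute)
  finally show ?thesis by (simp add: relabelled_eq)
qed

lemma linked_labels_rot:
  assumes v: "v \<in> J"
  shows "{(k, l) \<in> linked_labels \<Lambda> B v. P (relabelled \<Lambda> v k)} =
    map_prod (rot_label N) (rot_label N) `
      {(k, l) \<in> linked_labels \<Lambda> B (nx (nx v)). P (relabelled \<Lambda> (nx (nx v)) k)}"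
proof -
  let ?\<rho> = "rot_label N"
  let ?R = "\<lambda>k l. relabelled \<Lambda> v l \<in> black_path \<Lambda> B (relabelled \<Lambda> v k) \<and> P (relabelled \<Lambda> v k)"
  note rotate = bij_betw_rot_label[of N]
  have neq: "?\<rho> k \<noteq> ?\<rho> l \<longleftrightarrow> k \<noteq> l" if "k \<in> K" "l \<in> K" for k l
    using inj_on_eq_iff[OF bij_betw_imp_inj_on[OF rotate] that] by simp
  have "{(k, l) \<in> linked_labels \<Lambda> B v. P (relabelled \<Lambda> v k)} =
      map_prod ?\<rho> ?\<rho> ` {(k, l). k \<in> K \<and> l \<in> K \<and> ?\<rho> k \<noteq> ?\<rho> l \<and> ?R (?\<rho> k) (?\<rho> l)}"
    using Collect_pair_image_bij_betw[OF rotate, of "\<lambda>k l. k \<noteq> l \<and> ?R k l"] unfolding linked_labels_def by simp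
  also have "{(k, l). k \<in> K \<and> l \<in> K \<and> ?\<rho> k \<noteq> ?\<rho> l \<and> ?R (?\<rho> k) (?\<rho> l)} =
      {(k, l) \<in> linked_labels \<Lambda> B (nx (nx v)). P (relabelled \<Lambda> (nx (nx v)) k)}"
    using relabelled_next_ext_next_ext[OF v] neq unfolding linked_labels_def by auto
  finally show ?thesis .
qed

lemma rot_pattern_link_pattern_of:
  assumes v: "v \<in> J"
  shows "rot_pattern N (link_pattern_of \<Lambda> B (nx (nx v))) = link_pattern_of \<Lambda> B v"
proof -
  let ?w = "nx (nx v)" and ?\<rho> = "rot_label N"
  have linked: "linked_labels \<Lambda> B v = map_prod ?\<rho> ?\<rho> ` linked_labels \<Lambda> B ?w"
    using linked_labels_rot[OF v, of B "\<lambda>_. True"] by simp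
  show ?thesis
  proof (cases "puncture \<Lambda>")
    case Unpunctured
    then show ?thesis unfolding link_pattern_of_def Let_def Collect_pair_eq_image linked
      by (simp add: image_image case_prod_unfold)
  next
    case (In_Face p)
    then show ?thesis using linked_labels_rot[OF v, of B "\<lambda>h. p \<notin> region \<Lambda> (black_path \<Lambda> B h) h"]
      unfolding link_pattern_of_def Let_def by simp
  next
    case (At_Vertex p)
    let ?P = "\<lambda>u k. black_path \<Lambda> B (relabelled \<Lambda> u k)"
    let ?meets = "\<lambda>u. {k. k \<in> K \<and> ?P u k \<inter> vertex_of \<Lambda> p \<noteq> {}}"
    have "?meets v = ?\<rho> ` {k. k \<in> K \<and> ?P v (?\<rho> k) \<inter> vertex_of \<Lambda> p \<noteq> {}}"
      by (rule Collect_image_bij_betw[OF bij_betw_rot_label])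
    also have "{k. k \<in> K \<and> ?P v (?\<rho> k) \<inter> vertex_of \<Lambda> p \<noteq> {}} = ?meets ?w"
      using relabelled_next_ext_next_ext[OF v] by auto
    finally have "?meets v = ?\<rho> ` ?meets ?w" .
    then show ?thesis using At_Vertex unfolding link_pattern_of_def Let_def Collect_pair_eq_image linked
      by (simp add: setcompr_eq_image image_Un image_image case_prod_unfold)
  qed
qed

lemma rot_op_ket:
  assumes "\<pi> \<in> LP_domain \<Lambda>" shows "rot_op \<Lambda> (ket \<pi>) = ket (rot_pattern N \<pi>)"
proof
  fix \<sigma>
  have "finite (LP_domain \<Lambda>)" unfolding LP_domain_def using finite_LP finite_LP_punctured by simp
  moreover have "rot_op \<Lambda> (ket \<pi>) \<sigma> = (\<Sum>\<tau>\<in>LP_domain \<Lambda>. if \<tau> = \<pi> then ket (rot_pattern N \<tau>) \<sigma> else 0)"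
    unfolding rot_op_def by (rule sum.cong) (auto simp: ket_def)
  ultimately show "rot_op \<Lambda> (ket \<pi>) \<sigma> = ket (rot_pattern N \<pi>) \<sigma>" using assms by simp
qed

lemma rot_op_sum: "rot_op \<Lambda> (\<lambda>\<sigma>. \<Sum>i\<in>I. a i * \<psi> i \<sigma>) = (\<lambda>\<sigma>. \<Sum>i\<in>I. a i * rot_op \<Lambda> (\<psi> i) \<sigma>)"
proof
  fix \<sigma>
  have "rot_op \<Lambda> (\<lambda>\<sigma>. \<Sum>i\<in>I. a i * \<psi> i \<sigma>) \<sigma> =
      (\<Sum>\<pi>\<in>LP_domain \<Lambda>. \<Sum>i\<in>I. a i * (\<psi> i \<pi> * ket (rot_pattern N \<pi>) \<sigma>))"
    unfolding rot_op_def by (simp add: sum_distrib_right mult.assoc)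
  also have "\<dots> = (\<Sum>i\<in>I. \<Sum>\<pi>\<in>LP_domain \<Lambda>. a i * (\<psi> i \<pi> * ket (rot_pattern N \<pi>) \<sigma>))"
    by (rule sum.swap)
  finally show "rot_op \<Lambda> (\<lambda>\<sigma>. \<Sum>i\<in>I. a i * \<psi> i \<sigma>) \<sigma> = (\<Sum>i\<in>I. a i * rot_op \<Lambda> (\<psi> i) \<sigma>)"
    unfolding rot_op_def by (simp add: sum_distrib_left)
qed

lemma Sym_sum: "Sym \<Lambda> (\<lambda>\<sigma>. \<Sum>i\<in>I. a i * \<psi> i \<sigma>) \<sigma> = (\<Sum>i\<in>I. a i * Sym \<Lambda> (\<psi> i) \<sigma>)"
proof -
  have "(rot_op \<Lambda> ^^ k) (\<lambda>\<sigma>. \<Sum>i\<in>I. a i * \<psi> i \<sigma>) = (\<lambda>\<sigma>. \<Sum>i\<in>I. a i * (rot_op \<Lambda> ^^ k) (\<psi> i) \<sigma>)" for k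
    by (induction k) (simp_all add: rot_op_sum)
  moreover have "(\<Sum>k<N. \<Sum>i\<in>I. a i * (rot_op \<Lambda> ^^ k) (\<psi> i) \<sigma>) = (\<Sum>i\<in>I. \<Sum>k<N. a i * (rot_op \<Lambda> ^^ k) (\<psi> i) \<sigma>)"
    by (rule sum.swap)
  ultimately show ?thesis unfolding Sym_def by (simp add: sum_distrib_left mult.left_commute)
qed

lemma Sym_rot_op:
  assumes "(rot_op \<Lambda> ^^ N) \<psi> = \<psi>" shows "Sym \<Lambda> (rot_op \<Lambda> \<psi>) = Sym \<Lambda> \<psi>"
proof
  fix \<sigma>
  have "(\<Sum>k<N. (rot_op \<Lambda> ^^ Suc k) \<psi> \<sigma>) + \<psi> \<sigma> = (\<Sum>k<Suc N. (rot_op \<Lambda> ^^ k) \<psi> \<sigma>)"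
    by (subst sum.lessThan_Suc_shift) simp
  also have "\<dots> = (\<Sum>k<N. (rot_op \<Lambda> ^^ k) \<psi> \<sigma>) + \<psi> \<sigma>" using assms by simp
  finally show "Sym \<Lambda> (rot_op \<Lambda> \<psi>) \<sigma> = Sym \<Lambda> \<psi> \<sigma>" unfolding Sym_def by (simp add: funpow_swap1)
qed

context
  fixes b :: "half \<Rightarrow> bool" and v :: nat
  assumes b: "fpl b" and v: "v \<in> J" "b (e v)"
begin

lemma rot_op_pow_link:
  assumes "1 \<le> k"
  shows "(rot_op \<Lambda> ^^ r) (ket (link_pattern_of \<Lambda> (edges_of b) (idx v (k + r)))) =
    ket (link_pattern_of \<Lambda> (edges_of b) (idx v k))"
  using assms
proof (induction r arbitrary: k)
  case (Suc r)
  let ?link = "link_pattern_of \<Lambda> (edges_of b)"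
  have "(rot_op \<Lambda> ^^ Suc r) (ket (?link (idx v (k + Suc r)))) = rot_op \<Lambda> (ket (?link (idx v (Suc k))))"
    using Suc.IH[of "Suc k"] by simp
  also have "\<dots> = ket (rot_pattern N (?link (nx (nx (idx v k)))))"
    using rot_op_ket link_pattern_of_in_LP_domain[OF b idx_in] fpl_idx[OF b v(1)] v(2)
      idx_Suc[OF Suc.prems] Suc.prems by (metis le_SucI)
  also have "\<dots> = ket (?link (idx v k))" by (simp add: rot_pattern_link_pattern_of[OF idx_in])
  finally show ?case .
qed simp

lemma Sym_link_idx:
  assumes "1 \<le> k"
  shows "Sym \<Lambda> (ket (link_pattern_of \<Lambda> (edges_of b) (idx v k))) = Sym \<Lambda> (ket (link_pattern_of \<Lambda> (edges_of b) v))"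
  using assms
proof (induction k rule: dec_induct)
  case base then show ?case using idx_one[OF v(1)] by simp
next
  case (step k)
  let ?ket = "\<lambda>k. ket (link_pattern_of \<Lambda> (edges_of b) (idx v k))"
  have "(rot_op \<Lambda> ^^ N) (?ket (Suc k)) = ?ket (Suc k)"
    using rot_op_pow_link[of "Suc k" N] idx_period[of "Suc k" v] by simp
  then have "Sym \<Lambda> (?ket (Suc k)) = Sym \<Lambda> (rot_op \<Lambda> (?ket (Suc k)))" by (rule Sym_rot_op[symmetric])
  also have "rot_op \<Lambda> (?ket (Suc k)) = ?ket k" using rot_op_pow_link[of k 1] step(1) by simp
  finally show ?case using step.IH by simp
qed

lemma Sym_link_eq:
  assumes "u \<in> J" "b (e u)"
  shows "Sym \<Lambda> (ket (link_pattern_of \<Lambda> (edges_of b) u)) = Sym \<Lambda> (ket (link_pattern_of \<Lambda> (edges_of b) v))"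
proof -
  obtain k where "k \<in> K" "u = idx v k" by (rule black_ext_idx[OF b v assms])
  then show ?thesis using Sym_link_idx by simp
qed

end

section \<open>The gyration argument\<close>

definition gyrate :: "half set set \<Rightarrow> half set set" where
  "gyrate B = edges_of (gyr (active (is_black B)) (is_black B))"

definition sym_link :: "half set set \<Rightarrow> link_pattern \<Rightarrow> complex" where
  "sym_link B = Sym \<Lambda> (ket (link_pattern_of \<Lambda> B (if black_ext \<Lambda> B 1 then 1 else 2)))"

lemma black_ext_iff: "black_ext \<Lambda> B j \<longleftrightarrow> is_black B (e j)"
  by (simp add: black_ext_def is_black_def)

lemma gyrate_in_Fpl:
  assumes "B \<in> Fpl \<Lambda>"
  shows "gyrate B \<in> Fpl \<Lambda>" "is_black (gyrate B) = gyr (active (is_black B)) (is_black B)"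
  using fpl_edges_of[OF gyr_fpl[OF Fpl_is_black(1)[OF assms]]] unfolding gyrate_def by auto

lemma bij_betw_gyrate: "bij_betw gyrate (Fpl \<Lambda>) (Fpl \<Lambda>)"
proof -
  have "inj_on gyrate (Fpl \<Lambda>)"
  proof (rule inj_on_inverseI)
    fix B assume B: "B \<in> Fpl \<Lambda>"
    let ?b = "is_black B" and ?b' = "is_black (gyrate B)"
    have "?b' (e 1) = (\<not> ?b (e 1))"
      using gyr_ext[OF Fpl_is_black(1)[OF B]] gyrate_in_Fpl(2)[OF B] nblack_pos by simp
    then have "gyr (\<not> active ?b') ?b' = ?b"
      using gyr_gyr[OF Fpl_is_black(1)[OF B]] gyrate_in_Fpl(2)[OF B] by (simp add: active_def)
    then show "edges_of (gyr (\<not> active ?b') ?b') = B" using Fpl_is_black(2)[OF B] by simp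
  qed
  moreover have "gyrate ` Fpl \<Lambda> \<subseteq> Fpl \<Lambda>" using gyrate_in_Fpl(1) by blast
  ultimately show ?thesis using finite_Fpl by (simp add: bij_betw_def endo_inj_surj)
qed

lemma Sym_link_eq_sym_link:
  assumes B: "B \<in> Fpl \<Lambda>" and v: "v \<in> J" "black_ext \<Lambda> B v"
  shows "Sym \<Lambda> (ket (link_pattern_of \<Lambda> B v)) = sym_link B"
proof -
  let ?u = "if black_ext \<Lambda> B 1 then 1 else 2 :: nat"
  have "1 \<in> J" "nx 1 = 2" "2 \<in> J" using nblack_pos by (auto simp: next_ext_def)
  then have "?u \<in> J" "is_black B (e ?u)"
    using fpl_next_ext[OF Fpl_is_black(1)[OF B], of 1] by (auto simp: black_ext_iff)
  then show ?thesis
    using Sym_link_eq[OF Fpl_is_black(1)[OF B], of ?u v] v Fpl_is_black(2)[OF B]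
    unfolding sym_link_def black_ext_iff by simp
qed

lemma sym_link_gyrate:
  assumes B: "B \<in> Fpl \<Lambda>" shows "sym_link (gyrate B) = sym_link B"
proof -
  let ?b = "is_black B"
  note b = Fpl_is_black(1)[OF B]
  have "1 \<in> J" using nblack_pos by simp
  then obtain v where v: "v \<in> J" "?b (e v)" using fpl_next_ext[OF b] next_ext_in by blast
  have "par (e v) = active ?b" using par_ext_eq_active_iff[OF b] v by simp
  then have "link_pattern_of \<Lambda> (gyrate B) (nx v) = link_pattern_of \<Lambda> B v"
    using link_pattern_of_gyr[OF b v(1) _ v(2)] Fpl_is_black(2)[OF B] unfolding gyrate_def by simp
  moreover have "black_ext \<Lambda> (gyrate B) (nx v)"
    using gyr_ext[OF b next_ext_in] fpl_next_ext[OF b v(1)] v(2) gyrate_in_Fpl(2)[OF B] by (simp add: black_ext_iff)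
  ultimately show ?thesis
    using Sym_link_eq_sym_link[OF gyrate_in_Fpl(1)[OF B] next_ext_in, of v] Sym_link_eq_sym_link[OF B v(1)] v(2)
    by (simp add: black_ext_iff)
qed

abbreviation "h \<equiv> refinement_pos \<Lambda>"

lemma refinement_pos_eq_refpos:
  assumes "B \<in> Fpl \<Lambda>" shows "h B = refpos (is_black B)"
  using refinement_pos_eq[OF Fpl_is_black(1)[OF assms]] Fpl_is_black(2)[OF assms] by simp

lemma refinement_pos_in:
  assumes "B \<in> Fpl \<Lambda>" shows "h B \<in> {1..L}" "h B \<in> J"
  using refpos_in[OF Fpl_is_black(1)[OF assms]] refinement_pos_eq_refpos[OF assms] side_in_J by auto

lemma sum_sym_link_black_eq_white:
  "(\<Sum>B\<in>{B \<in> Fpl \<Lambda>. h B = n \<and> \<not> black_ext \<Lambda> B (h B)}. sym_link B \<sigma>) =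
    (\<Sum>B\<in>{B \<in> Fpl \<Lambda>. h B = n \<and> black_ext \<Lambda> B (h B)}. sym_link B \<sigma>)"
proof (rule sum_black_eq_sum_white_at_position[OF finite_Fpl bij_betw_gyrate])
  fix B assume B: "B \<in> Fpl \<Lambda>"
  note moves = refpos_gyr[OF Fpl_is_black(1)[OF B], folded gyrate_in_Fpl(2)[OF B],
    folded refinement_pos_eq_refpos[OF B] refinement_pos_eq_refpos[OF gyrate_in_Fpl(1)[OF B]] black_ext_iff]
  show "sym_link (gyrate B) \<sigma> = sym_link B \<sigma>" by (simp add: sym_link_gyrate[OF B])
  show "h (gyrate B) = h B \<and> black_ext \<Lambda> (gyrate B) (h (gyrate B)) \<or>
    h (gyrate B) = h B + 1 \<and> \<not> black_ext \<Lambda> (gyrate B) (h (gyrate B))" if "\<not> black_ext \<Lambda> B (h B)"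
    using moves that by simp
  show "h (gyrate B) = h B \<and> \<not> black_ext \<Lambda> (gyrate B) (h (gyrate B)) \<or>
    h (gyrate B) + 1 = h B \<and> black_ext \<Lambda> (gyrate B) (h (gyrate B))" if "black_ext \<Lambda> B (h B)"
    using moves that by simp
qed

lemma sum_by_refinement_pos:
  fixes S :: "half set set \<Rightarrow> complex"
  shows "(\<Sum>B\<in>{B \<in> Fpl \<Lambda>. P B}. t ^ (h B - 1) * S B) =
    (\<Sum>n\<in>{1..L}. t ^ (n - 1) * (\<Sum>B\<in>{B \<in> Fpl \<Lambda>. h B = n \<and> P B}. S B))"
proof -
  have "(\<Sum>B\<in>{B \<in> Fpl \<Lambda>. P B}. t ^ (h B - 1) * S B) =
      (\<Sum>n\<in>{1..L}. \<Sum>B\<in>{B \<in> {B \<in> Fpl \<Lambda>. P B}. h B = n}. t ^ (h B - 1) * S B)"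
    by (rule sum.group[symmetric]) (use finite_Fpl refinement_pos_in in auto)
  also have "\<dots> = (\<Sum>n\<in>{1..L}. \<Sum>B\<in>{B \<in> Fpl \<Lambda>. h B = n \<and> P B}. t ^ (n - 1) * S B)"
    by (intro sum.cong) auto
  finally show ?thesis by (simp add: sum_distrib_left)
qed

text \<open>An external edge \<open>n\<close> has the colour of edge 1 or the opposite one according to the parity of \<open>n\<close>, so
  the two sums agree position by position.\<close>

lemma sum_Fpl_plus_eq_sum_Fpl_b:
  "(\<Sum>B\<in>Fpl_plus \<Lambda>. t ^ (h B - 1) * sym_link B \<sigma>) = (\<Sum>B\<in>Fpl_b \<Lambda>. t ^ (h B - 1) * sym_link B \<sigma>)"
proof -
  have "(\<Sum>B\<in>{B \<in> Fpl \<Lambda>. h B = n \<and> black_ext \<Lambda> B 1}. sym_link B \<sigma>) =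
      (\<Sum>B\<in>{B \<in> Fpl \<Lambda>. h B = n \<and> black_ext \<Lambda> B (h B)}. sym_link B \<sigma>)" for n
  proof -
    have "{B \<in> Fpl \<Lambda>. h B = n \<and> black_ext \<Lambda> B 1} =
        {B \<in> Fpl \<Lambda>. h B = n \<and> black_ext \<Lambda> B (h B) = odd n}"
      using fpl_ext_parity[OF Fpl_is_black(1) refinement_pos_in(2)] by (auto simp: black_ext_iff)
    then show ?thesis using sum_sym_link_black_eq_white[of \<sigma> n] by (cases "odd n") simp_all
  qed
  then show ?thesis unfolding Fpl_plus_def Fpl_b_def sum_by_refinement_pos by simp
qed

theorem Sym_Psi'_eq_Sym_Psi: "Sym \<Lambda> (Psi' \<Lambda> t) = Sym \<Lambda> (Psi \<Lambda> t)"
proof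
  fix \<sigma>
  have "Sym \<Lambda> (Psi' \<Lambda> t) \<sigma> = (\<Sum>B\<in>Fpl_plus \<Lambda>. t ^ (h B - 1) * Sym \<Lambda> (ket (Pi_plus \<Lambda> B)) \<sigma>)"
    unfolding Psi'_def by (rule Sym_sum)
  also have "\<dots> = (\<Sum>B\<in>Fpl_plus \<Lambda>. t ^ (h B - 1) * sym_link B \<sigma>)"
    using Sym_link_eq_sym_link[of _ 1] nblack_pos
    by (intro sum.cong) (auto simp: Fpl_plus_def Pi_plus_def)
  also have "\<dots> = (\<Sum>B\<in>Fpl_b \<Lambda>. t ^ (h B - 1) * sym_link B \<sigma>)" by (rule sum_Fpl_plus_eq_sum_Fpl_b)
  also have "\<dots> = (\<Sum>B\<in>Fpl_b \<Lambda>. t ^ (h B - 1) * Sym \<Lambda> (ket (Pi_b \<Lambda> B)) \<sigma>)"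
    using Sym_link_eq_sym_link refinement_pos_in(2)
    by (intro sum.cong) (auto simp: Fpl_b_def Pi_b_def)
  also have "\<dots> = Sym \<Lambda> (Psi \<Lambda> t) \<sigma>" unfolding Psi_def by (rule Sym_sum[symmetric])
  finally show "Sym \<Lambda> (Psi' \<Lambda> t) \<sigma> = Sym \<Lambda> (Psi \<Lambda> t) \<sigma>" .
qed

end

section \<open>The rectangle with its removed squares\<close>

definition dirs :: "(int \<times> int) set" where
  "dirs = {(0, -1), (1, 0), (0, 1), (-1, 0)}"

definition rot :: "int \<times> int \<Rightarrow> int \<times> int" where
  "rot d = (snd d, - fst d)"

lemma dirs_cases [consumes 1, case_names south east north west]:
  assumes "d \<in> dirs"
  obtains "d = (0, -1)" | "d = (1, 0)" | "d = (0, 1)" | "d = (-1, 0)"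
  using assms by (auto simp: dirs_def)

lemma rot_simps [simp]: "rot (rot d) = - d" "rot (- d) = - rot d" "rot (u, v) = (v, - u)"
  by (auto simp: rot_def prod_eq_iff)

lemma in_dirs_rot: "d \<in> dirs \<Longrightarrow> rot d \<in> dirs"
  and in_dirs_minus: "d \<in> dirs \<Longrightarrow> - d \<in> dirs"
  by (auto simp: dirs_def)

lemma dirs_eq: "d \<in> dirs \<Longrightarrow> dirs = {d, - d, rot d, - rot d}"
  by (auto simp: dirs_def)

lemma dirs_distinct: "d \<in> dirs \<Longrightarrow> distinct [d, - d, rot d, - rot d]"
  by (auto simp: dirs_def)

lemma rot_neq: "d \<in> dirs \<Longrightarrow> rot d \<noteq> d" "d \<in> dirs \<Longrightarrow> rot d \<noteq> - d"
  by (auto simp: dirs_def)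

locale dihedral =
  fixes Lx Ly :: int and a :: "nat \<Rightarrow> int"
  assumes params: "dihedral_params Lx Ly a"
begin

abbreviation "Rm \<equiv> removed Lx Ly a"
abbreviation "R \<equiv> rectangle Lx Ly"
abbreviation "Gd \<equiv> grid Lx Ly a"

lemma R_iff: "(x, y) \<in> R \<longleftrightarrow> 1 \<le> x \<and> x \<le> Lx \<and> 1 \<le> y \<and> y \<le> Ly"
  by (auto simp: rectangle_def)

lemma R_parallel:
  assumes "d \<in> dirs" "p \<in> R" "p + rot d \<in> R" shows "p + d \<in> R \<longleftrightarrow> p + d + rot d \<in> R"
  using assms by (cases p; cases rule: dirs_cases) (auto simp: R_iff)

lemma R_parallel_border:
  assumes "d \<in> dirs" "p \<in> R" "p + rot d \<notin> R" shows "p + d + rot d \<notin> R"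
  using assms by (cases p; cases rule: dirs_cases) (auto simp: R_iff)

text \<open>The frame of the square removed at corner \<open>i\<close>: a removed vertex is reached from the vertex
  \<open>concave i\<close> by \<open>depth i\<close> steps in direction \<open>outward i\<close> and \<open>width i\<close> steps in the direction to its
  right.  The three frames are rotations of each other.\<close>

definition outward :: "nat \<Rightarrow> int \<times> int" where
  "outward i = (if i = 2 then (1, 0) else if i = 3 then (0, 1) else (-1, 0))"

definition concave :: "nat \<Rightarrow> int \<times> int" where
  "concave i = (if i = 2 then (Lx - a 2, a 2 + 1) else if i = 3 then (Lx - a 3, Ly - a 3)
     else (a 4 + 1, Ly - a 4))"

definition depth :: "nat \<Rightarrow> int \<times> int \<Rightarrow> int" where
  "depth i p = (fst p - fst (concave i)) * fst (outward i) + (snd p - snd (concave i)) * snd (outward i)"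

definition width :: "nat \<Rightarrow> int \<times> int \<Rightarrow> int" where
  "width i p =
     (fst p - fst (concave i)) * fst (rot (outward i)) + (snd p - snd (concave i)) * snd (rot (outward i))"

definition in_square :: "nat \<Rightarrow> int \<times> int \<Rightarrow> bool" where
  "in_square i p \<longleftrightarrow> i \<in> {2, 3, 4} \<and> 1 \<le> depth i p \<and> depth i p \<le> a i \<and> 1 \<le> width i p \<and> width i p \<le> a i"

lemma in_square_index: "in_square i p \<Longrightarrow> i \<in> {2, 3, 4}"
  unfolding in_square_def by blast

lemma outward_in_dirs: "outward i \<in> dirs"
  by (simp add: outward_def dirs_def)

lemma outward_neq [simp]:
  "outward i \<noteq> - outward i" "outward i \<noteq> rot (outward i)" "outward i \<noteq> - rot (outward i)"
  "- outward i \<noteq> outward i" "- outward i \<noteq> rot (outward i)" "rot (outward i) \<noteq> outward i"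
  "rot (outward i) \<noteq> - outward i" "rot (outward i) \<noteq> - rot (outward i)"
  "- rot (outward i) \<noteq> outward i" "- rot (outward i) \<noteq> rot (outward i)"
  by (simp_all add: outward_def)

lemma frame_cases [consumes 1, case_names outward inward right left]:
  assumes "d \<in> dirs"
  obtains "d = outward i" | "d = - outward i" | "d = rot (outward i)" | "d = - rot (outward i)"
  using assms dirs_eq[OF outward_in_dirs, of i] by blast

lemma frame_move [simp]:
  "depth i (p + outward i) = depth i p + 1" "depth i (p - outward i) = depth i p - 1"
  "depth i (p + rot (outward i)) = depth i p" "depth i (p - rot (outward i)) = depth i p"
  "width i (p + rot (outward i)) = width i p + 1" "width i (p - rot (outward i)) = width i p - 1"
  "width i (p + outward i) = width i p" "width i (p - outward i) = width i p"
  by (simp_all add: depth_def width_def outward_def)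

lemma depth_width_coordinates:
  "depth 2 (x, y) = x - Lx + a 2" "width 2 (x, y) = a 2 + 1 - y"
  "depth 3 (x, y) = y - Ly + a 3" "width 3 (x, y) = x - Lx + a 3"
  "depth 4 (x, y) = a 4 + 1 - x" "width 4 (x, y) = y - Ly + a 4"
  by (simp_all add: depth_def width_def outward_def concave_def)

lemma parity_coordinates:
  "even (fst p + snd p) \<longleftrightarrow> even (fst (concave i) + snd (concave i) + depth i p + width i p)"
  by (auto simp: depth_def width_def outward_def)

lemma a_1: "a 1 = 0"
  using params by (auto simp: dihedral_params_def)

lemma corner_square_iff:
  "p \<notin> corner_square Lx Ly a 1" "i \<in> {2, 3, 4} \<Longrightarrow> p \<in> corner_square Lx Ly a i \<longleftrightarrow> in_square i p"
  using a_1 by (cases p; auto simp: corner_square_def in_square_def depth_width_coordinates)+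

lemma removed_iff: "p \<in> Rm \<longleftrightarrow> (\<exists>i. in_square i p)"
proof -
  have "{1..4} = {1, 2, 3, 4 :: nat}" by auto
  then show ?thesis
    using corner_square_iff(1)[of p] corner_square_iff(2)[of _ p] unfolding removed_def by (auto simp: in_square_def)
qed

lemma grid_iff: "p \<in> Gd \<longleftrightarrow> p \<in> R \<and> p \<notin> Rm"
  by (auto simp: grid_def)

lemma one_one_in_grid: "(1, 1) \<in> Gd"
  using params by (auto simp: dihedral_params_def)

lemma square_unique:
  assumes "in_square i p" "in_square j p" shows "i = j"
proof (rule ccontr)
  assume "i \<noteq> j"
  moreover have "i \<in> {1..4}" "j \<in> {1..4}" using assms by (auto simp: in_square_def)
  ultimately have "corner_square Lx Ly a i \<inter> corner_square Lx Ly a j = {}"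
    using params unfolding dihedral_params_def by blast
  then show False using assms corner_square_iff(2)[of _ p] by (auto simp: in_square_def)
qed

lemma size_bounds:
  shows "1 \<le> Lx" "1 \<le> Ly" and "i \<in> {2, 3, 4} \<Longrightarrow> 0 \<le> a i \<and> a i \<le> Lx \<and> a i \<le> Ly"
    and "a 2 < Lx" "a 4 < Ly" "a 3 < Lx \<or> a 3 < Ly"
    and "a 2 + a 3 \<le> Ly" "a 3 + a 4 \<le> Lx" "a 2 + a 4 \<le> Lx \<or> a 2 + a 4 \<le> Ly"
proof -
  show one: "1 \<le> Lx" "1 \<le> Ly" and bound: "i \<in> {2, 3, 4} \<Longrightarrow> 0 \<le> a i \<and> a i \<le> Lx \<and> a i \<le> Ly" for i
    using params unfolding dihedral_params_def by auto
  note bounds = one bound[of 2, simplified] bound[of 3, simplified] bound[of 4, simplified]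
  have first: "\<not> in_square i (1, 1)" for i using one_one_in_grid grid_iff removed_iff by blast
  show "a 2 < Lx" "a 4 < Ly" "a 3 < Lx \<or> a 3 < Ly"
    using first[of 2] first[of 3] first[of 4] bounds by (auto simp: in_square_def depth_width_coordinates)
  have disjoint: "\<not> in_square i p \<or> \<not> in_square j p" if "i \<noteq> j" for i j p using square_unique that by blast
  show "a 2 + a 3 \<le> Ly"
    using disjoint[of 2 3 "(Lx, a 2)"] bounds by (auto simp: in_square_def depth_width_coordinates)
  show "a 3 + a 4 \<le> Lx"
    using disjoint[of 3 4 "(a 4, Ly)"] bounds by (auto simp: in_square_def depth_width_coordinates)
  show "a 2 + a 4 \<le> Lx \<or> a 2 + a 4 \<le> Ly"
    using disjoint[of 2 4 "(a 4, a 2)"] bounds by (auto simp: in_square_def depth_width_coordinates)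
qed

lemma in_square_in_R: "in_square i p \<Longrightarrow> p \<in> R"
  using size_bounds(3)[of i] by (cases p) (auto simp: in_square_def depth_width_coordinates R_iff)

lemma removed_in_R: "p \<in> Rm \<Longrightarrow> p \<in> R"
  using removed_iff in_square_in_R by blast

lemma finite_removed: "finite Rm"
proof (rule finite_subset)
  show "Rm \<subseteq> R" using removed_in_R by blast
  show "finite R" by (simp add: rectangle_def)
qed

lemma outer_neighbour_in_R_iff:
  assumes "in_square i p"
  shows "p + outward i \<in> R \<longleftrightarrow> depth i p < a i" "p + rot (outward i) \<in> R \<longleftrightarrow> width i p < a i"
  using assms size_bounds(3)[of i]
  by (cases p; auto simp: in_square_def depth_width_coordinates outward_def R_iff)+

lemma in_square_product:
  assumes "d \<in> dirs" "in_square i (p + d)" "in_square i (p + rot d)" shows "in_square i p"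
  using assms by (cases rule: frame_cases[of d i]) (auto simp: in_square_def)

text \<open>The directions in which an edge of the full rectangle at a removed vertex belongs to a joined edge.\<close>

definition passable :: "int \<times> int \<Rightarrow> int \<times> int \<Rightarrow> bool" where
  "passable p d \<longleftrightarrow> (\<forall>i. in_square i p \<longrightarrow> d \<in>
     (if depth i p < width i p then {outward i, - outward i}
      else if width i p < depth i p then {rot (outward i), - rot (outward i)}
      else {- outward i, - rot (outward i)}))"

lemma passable_if_not_removed: "p \<notin> Rm \<Longrightarrow> passable p d"
  by (simp add: passable_def removed_iff)

lemma passable_iff:
  assumes "in_square i p"
  shows "passable p (outward i) \<longleftrightarrow> depth i p < width i p"
    "passable p (- outward i) \<longleftrightarrow> depth i p \<le> width i p"
    "passable p (rot (outward i)) \<longleftrightarrow> width i p < depth i p"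
    "passable p (- rot (outward i)) \<longleftrightarrow> width i p \<le> depth i p"
proof -
  have "in_square j p \<longleftrightarrow> j = i" for j using square_unique assms by blast
  then show "passable p (outward i) \<longleftrightarrow> depth i p < width i p"
    "passable p (- outward i) \<longleftrightarrow> depth i p \<le> width i p"
    "passable p (rot (outward i)) \<longleftrightarrow> width i p < depth i p"
    "passable p (- rot (outward i)) \<longleftrightarrow> width i p \<le> depth i p"
    by (auto simp: passable_def)
qed

abbreviation "rfl \<equiv> reflect Lx Ly a"

lemma reflect_cases:
  obtains "\<And>d. rfl p d = d" | "\<And>d. rfl p d = (- snd d, - fst d)" | "\<And>d. rfl p d = (snd d, fst d)"
proof -
  obtain P Q where "\<And>d. rfl p d = (if P then (- snd d, - fst d) else if Q then (snd d, fst d) else d)"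
    unfolding reflect_def Let_def case_prod_beta prod.collapse by blast
  then show thesis using that by (cases P; cases Q) simp_all
qed

lemma reflect_in_dirs: "d \<in> dirs \<Longrightarrow> rfl p d \<in> dirs"
  by (cases rule: reflect_cases[of p]; cases d rule: dirs_cases) (simp_all add: dirs_def)

lemma reflect_back: "rfl p (- rfl p d) = - d"
  by (cases rule: reflect_cases[of p]) (simp_all add: prod_eq_iff)

lemma reflect_inject: "rfl p d = rfl p d' \<Longrightarrow> d = d'"
  by (metis reflect_back minus_equation_iff)

lemma reflect_frame:
  assumes "in_square i p"
  shows "depth i p \<noteq> width i p \<Longrightarrow> rfl p d = d"
    and "depth i p = width i p \<Longrightarrow> rfl p (outward i) = - rot (outward i)"
    and "depth i p = width i p \<Longrightarrow> rfl p (- outward i) = rot (outward i)"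
    and "depth i p = width i p \<Longrightarrow> rfl p (rot (outward i)) = - outward i"
    and "depth i p = width i p \<Longrightarrow> rfl p (- rot (outward i)) = outward i"
proof -
  have i: "i = 2 \<or> i = 3 \<or> i = 4" using assms by (simp add: in_square_def)
  have "in_square j p \<longleftrightarrow> j = i" for j using square_unique assms by blast
  then have squares: "p \<notin> corner_square Lx Ly a 1" "p \<in> corner_square Lx Ly a 2 \<longleftrightarrow> i = 2"
    "p \<in> corner_square Lx Ly a 3 \<longleftrightarrow> i = 3" "p \<in> corner_square Lx Ly a 4 \<longleftrightarrow> i = 4"
    using corner_square_iff(1)[of p] corner_square_iff(2)[of 2 p] corner_square_iff(2)[of 3 p]
      corner_square_iff(2)[of 4 p] by auto
  obtain x y where p: "p = (x, y)" by (cases p)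
  have "rfl p d = (if depth i p = width i p then if i = 3 then (- snd d, - fst d) else (snd d, fst d) else d)" for d
    using i squares unfolding p reflect_def by (cases d) (auto simp: depth_width_coordinates)
  then show "depth i p \<noteq> width i p \<Longrightarrow> rfl p d = d"
    "depth i p = width i p \<Longrightarrow> rfl p (outward i) = - rot (outward i)"
    "depth i p = width i p \<Longrightarrow> rfl p (- outward i) = rot (outward i)"
    "depth i p = width i p \<Longrightarrow> rfl p (rot (outward i)) = - outward i"
    "depth i p = width i p \<Longrightarrow> rfl p (- rot (outward i)) = outward i"
    using i by (auto simp: outward_def)
qed

lemma passable_reflect:
  assumes "p \<in> Rm" "d \<in> dirs" "passable p (- d)"
  shows "passable p (rfl p d)" "rfl p d \<noteq> - d"
    and "d' \<in> dirs \<Longrightarrow> passable p d' \<longleftrightarrow> d' = - d \<or> d' = rfl p d"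
proof -
  obtain i where i: "in_square i p" using assms(1) removed_iff by blast
  have "passable p (rfl p d) \<and> rfl p d \<noteq> - d \<and>
      (\<forall>d'\<in>{outward i, - outward i, rot (outward i), - rot (outward i)}.
        passable p d' \<longleftrightarrow> d' = - d \<or> d' = rfl p d)"
    using assms(2,3)
    by (cases rule: frame_cases[of d i]; cases "depth i p" "width i p" rule: linorder_cases)
      (simp_all add: passable_iff[OF i] reflect_frame[OF i])
  then show "passable p (rfl p d)" "rfl p d \<noteq> - d" "d' \<in> dirs \<Longrightarrow> passable p d' \<longleftrightarrow> d' = - d \<or> d' = rfl p d"
    unfolding dirs_eq[OF outward_in_dirs, of i] by blast+
qed

lemma reflect_eqI:
  assumes "p \<in> Rm" "d \<in> dirs" "passable p (- d)" "d' \<in> dirs" "passable p d'" "d' \<noteq> - d" shows "rfl p d = d'"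
  using passable_reflect(3)[OF assms(1-4)] assms(5,6) by blast

lemma passable_if_leaves_square:
  assumes "d \<in> dirs" "in_square i p" "\<not> in_square i (p + d)" "p + d \<in> R"
  shows "passable p d"
  using assms(1)
  by (cases rule: frame_cases[of d i])
    (use assms(2-4) in \<open>simp_all add: passable_iff outer_neighbour_in_R_iff in_square_def\<close>)

lemma passable_within_square:
  assumes "d \<in> dirs" "in_square i p" "in_square i (p + d)"
  shows "passable p d \<longleftrightarrow> passable (p + d) (- d)"
  using assms by (cases rule: frame_cases[of d i]) (auto simp: passable_iff)

lemma passable_sym:
  assumes d: "d \<in> dirs" and p: "p \<in> R" "passable p d"
  shows "passable (p + d) (- d)"
proof (cases "p + d \<in> Rm")
  case True
  then obtain i where i: "in_square i (p + d)" using removed_iff by blast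
  show ?thesis
  proof (cases "in_square i p")
    case True then show ?thesis using passable_within_square[OF d _ i] p(2) by blast
  next
    case False
    then show ?thesis using passable_if_leaves_square[OF in_dirs_minus[OF d] i] p(1) by simp
  qed
qed (rule passable_if_not_removed)

lemma diagonal_bend:
  assumes d: "d \<in> dirs" and p: "p \<in> Rm" "passable p (- d)" "passable p (- rot d)"
  obtains i where "in_square i p" "depth i p = width i p" "d = outward i"
proof -
  obtain i where i: "in_square i p" using p(1) removed_iff by blast
  from d have "depth i p = width i p \<and> d = outward i"
    using p(2,3) by (cases rule: frame_cases[of d i]) (simp_all add: passable_iff[OF i])
  then show thesis using that i by blast
qed

lemma bend_left:
  assumes "d \<in> dirs" "p \<in> Rm" "p + rot d \<in> R" "passable p (- d)" "passable p (- rot d)"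
  shows "p + rot d \<in> Rm" "rfl (p + rot d) d = d" "p + rot d + d \<in> Rm" "rfl (p + rot d + d) d = - rot d"
    "p + d \<in> Rm" "rfl (p + d) (- rot d) = - rot d"
proof -
  obtain i where i: "in_square i p" "depth i p = width i p" "d = outward i"
    by (rule diagonal_bend[OF assms(1,2,4,5)])
  then have "in_square i (p + rot d)" "in_square i (p + rot d + d)" "in_square i (p + d)"
    using assms(3) outer_neighbour_in_R_iff[OF i(1)] by (simp_all add: in_square_def)
  then show "p + rot d \<in> Rm" "rfl (p + rot d) d = d" "p + rot d + d \<in> Rm" "rfl (p + rot d + d) d = - rot d"
    "p + d \<in> Rm" "rfl (p + d) (- rot d) = - rot d"
    using i removed_iff reflect_frame by (auto simp: add_eq_0_iff)
qed

lemma bend_right: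
  assumes "d \<in> dirs" "p \<in> Rm" "p - rot d \<in> R" "passable p (- d)" "passable p (rot d)"
  shows "p - rot d \<in> Rm" "rfl (p - rot d) d = d" "p - rot d + d \<in> Rm" "rfl (p - rot d + d) d = rot d"
    "p + d \<in> Rm" "rfl (p + d) (rot d) = rot d"
proof -
  obtain i where i: "in_square i p" "depth i p = width i p" "- rot d = outward i"
    using diagonal_bend[of "- rot d" p] in_dirs_minus[OF in_dirs_rot[OF assms(1)]] assms by auto
  then have d: "d = rot (outward i)" by (metis minus_minus rot_simps(1,2))
  then have "in_square i (p - rot d)" "in_square i (p - rot d + d)" "in_square i (p + d)"
    using i assms(3) outer_neighbour_in_R_iff[OF i(1)] by (simp_all add: in_square_def)
  then show "p - rot d \<in> Rm" "rfl (p - rot d) d = d" "p - rot d + d \<in> Rm" "rfl (p - rot d + d) d = rot d"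
    "p + d \<in> Rm" "rfl (p + d) (rot d) = rot d"
    using i d removed_iff reflect_frame by auto
qed

lemma bend_at_corner:
  assumes "d \<in> dirs" "p \<in> Rm" "passable p (- d)" "passable p (- rot d)" "p + rot d \<notin> R"
  shows "p + d \<notin> R"
proof -
  obtain i where "in_square i p" "depth i p = width i p" "d = outward i"
    by (rule diagonal_bend[OF assms(1-4)])
  then show ?thesis using assms(5) outer_neighbour_in_R_iff by simp
qed

lemma passable_along_side:
  assumes "d \<in> dirs" "in_square i p" "in_square i (p + rot d)" "p - d \<notin> R" "passable p (- d)"
  shows "passable (p + rot d) (- d)"
proof -
  have "\<not> in_square i (p - d)" using assms(4) in_square_in_R by blast
  with assms show ?thesis
    by (cases rule: frame_cases[of d i]) (auto simp: passable_iff in_square_def)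
qed

section \<open>Strands\<close>

abbreviation "m \<equiv> first_mate Lx Ly a"

definition advance :: "(int \<times> int) \<times> (int \<times> int) \<Rightarrow> (int \<times> int) \<times> (int \<times> int)" where
  "advance s = (fst s + rfl (fst s) (snd s), rfl (fst s) (snd s))"

lemma advance_simp [simp]: "advance (p, d) = (p + rfl p d, rfl p d)"
  by (simp add: advance_def)

lemma strand_unfold: "strand Lx Ly a (p, d) = (if p \<in> Rm then strand Lx Ly a (advance (p, d)) else (p, d))"
  unfolding strand_def by (subst while_unfold) (simp add: Let_def)

text \<open>The edge starting with \<open>h\<close> enters the vertex \<open>p\<close> of the rectangle in direction \<open>d\<close>.\<close>

inductive enters :: "half \<Rightarrow> (int \<times> int) \<times> (int \<times> int) \<Rightarrow> bool" where
  start: "q \<notin> Rm \<Longrightarrow> d \<in> dirs \<Longrightarrow> enters (Half q d) (q + d, d)"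
| step: "enters h (p, d) \<Longrightarrow> p \<in> Rm \<Longrightarrow> enters h (p + rfl p d, rfl p d)"

lemma enters_dirs: "enters h (p, d) \<Longrightarrow> d \<in> dirs"
  by (induction h "(p, d)" arbitrary: p d rule: enters.induct) (auto simp: reflect_in_dirs)

lemma enters_straight: "enters h (p, d) \<Longrightarrow> p \<in> Rm \<Longrightarrow> rfl p d = e \<Longrightarrow> enters h (p + e, e)"
  using enters.step by blast

lemma enters_mate:
  assumes "enters h (p, d)" "p \<notin> Rm" shows "m h = Half p (- d)"
proof -
  have "m h = (let (q, e) = strand Lx Ly a s in Half q (- e))" if "enters h s" for s
    using that
  proof (induction rule: enters.induct)
    case (step h p d)
    then show ?case using strand_unfold[of p d] by simp
  qed simp
  from this[OF assms(1)] show ?thesis using assms(2) strand_unfold[of p d] by simp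
qed

lemma enters_cases:
  assumes "enters h (p, d)"
  obtains (first) "h = Half (p - d) d" "p - d \<notin> Rm"
  | (later) d' where "enters h (p - d, d')" "p - d \<in> Rm" "rfl (p - d) d' = d"
  using assms by (cases rule: enters.cases) auto

lemma enters_unique: "enters h s \<Longrightarrow> enters h' s \<Longrightarrow> h = h'"
proof (induction arbitrary: h' rule: enters.induct)
  case (start q d)
  from start(3) show ?case by (cases rule: enters_cases) (use start in auto)
next
  case (step h p d)
  from step(4) obtain d' where "enters h' (p, d')" "rfl p d' = rfl p d"
    by (cases rule: enters_cases) (use step in auto)
  then show ?case using step.IH reflect_inject by metis
qed

lemma inj_advance: "inj advance"
proof (rule injI)
  fix s s' assume "advance s = advance s'"
  then show "s = s'" by (cases s; cases s') (auto dest: reflect_inject)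
qed

text \<open>A strand that never left the removed squares would be periodic, but its first vertex is entered
  from outside.\<close>

lemma enters_exit: "enters h s \<Longrightarrow> \<exists>n. fst ((advance ^^ n) s) \<notin> Rm"
proof (induction rule: enters.induct)
  case (start q d)
  show ?case
  proof (rule ccontr)
    let ?s = "\<lambda>n. (advance ^^ n) (q + d, d)"
    assume "\<nexists>n. fst (?s n) \<notin> Rm"
    then have in_removed: "fst (?s n) \<in> Rm" for n by blast
    have "snd (?s n) \<in> dirs" for n
      by (induction n) (use start reflect_in_dirs in \<open>auto simp: advance_def\<close>)
    then have "range ?s \<subseteq> Rm \<times> dirs"
      using in_removed by (intro image_subsetI) (simp add: mem_Times_iff)
    moreover have "finite (Rm \<times> dirs)" using finite_removed by (simp add: dirs_def)
    ultimately have finite: "finite (range ?s)" by (rule finite_subset)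
    have "advance (?s n) \<in> range ?s" for n by (rule range_eqI[of _ _ "Suc n"]) simp
    then have "advance ` range ?s \<subseteq> range ?s" by blast
    then have "?s 0 \<in> orbit advance (?s 0)"
      by (rule self_in_orbit_if_inj_on[OF finite _ inj_on_subset[OF inj_advance subset_UNIV]]) blast
    then obtain n where "n > 0" "?s n = (q + d, d)" unfolding orbit_altdef by auto
    then obtain k where "advance (?s k) = (q + d, d)" by (cases n) auto
    then have "fst (?s k) = q" by (auto simp: advance_def)
    then show False using in_removed[of k] start by simp
  qed
next
  case (step h p d)
  then obtain n where "fst ((advance ^^ n) (p, d)) \<notin> Rm" by blast
  moreover obtain k where "n = Suc k" using step calculation by (cases n) auto
  ultimately have "fst ((advance ^^ k) (p + rfl p d, rfl p d)) \<notin> Rm" by (simp add: funpow_swap1)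
  then show ?case by blast
qed

definition strand_length :: "(int \<times> int) \<times> (int \<times> int) \<Rightarrow> nat" where
  "strand_length s = (LEAST n. fst ((advance ^^ n) s) \<notin> Rm)"

lemma strand_length_advance:
  assumes "enters h (p, d)" "p \<in> Rm" shows "strand_length (p + rfl p d, rfl p d) < strand_length (p, d)"
proof -
  obtain n where "fst ((advance ^^ n) (p, d)) \<notin> Rm" using enters_exit[OF assms(1)] by blast
  then have "strand_length (p, d) = Suc (LEAST n. fst ((advance ^^ Suc n) (p, d)) \<notin> Rm)"
    unfolding strand_length_def by (rule Least_Suc) (use assms(2) in simp)
  then show ?thesis unfolding strand_length_def by (simp add: funpow_swap1)
qed

lemma enters_induct [consumes 1, case_names exit pass]:
  assumes "enters h (p, d)"
    and "\<And>p d. enters h (p, d) \<Longrightarrow> p \<notin> Rm \<Longrightarrow> P p d"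
    and "\<And>p d. enters h (p, d) \<Longrightarrow> p \<in> Rm \<Longrightarrow> enters h (p + rfl p d, rfl p d) \<Longrightarrow>
      P (p + rfl p d) (rfl p d) \<Longrightarrow> P p d"
  shows "P p d"
  using assms(1)
proof (induction "strand_length (p, d)" arbitrary: p d rule: less_induct)
  case less
  then show ?case using assms(2,3) enters.step strand_length_advance by (cases "p \<in> Rm") blast+
qed

lemma enters_reverse: "enters h (p, d) \<Longrightarrow> enters (m h) (p - d, - d)"
proof (induction p d rule: enters_induct)
  case (exit p d)
  have "enters (Half p (- d)) (p + - d, - d)"
    using exit enters_dirs in_dirs_minus by (intro enters.start) blast+
  then show ?case using enters_mate[OF exit] by simp
next
  case (pass p d)
  have "enters (m h) (p, - rfl p d)" using pass.IH by simp
  from enters.step[OF this pass(2)] show ?case unfolding reflect_back by simp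
qed

lemma first_mate_obtain:
  assumes "q \<notin> Rm" "d \<in> dirs"
  obtains p e where "enters (Half q d) (p, e)" "p \<notin> Rm" "e \<in> dirs" "m (Half q d) = Half p (- e)"
    "enters (Half p (- e)) (q, - d)" "m (Half p (- e)) = Half q d"
proof -
  have start: "enters (Half q d) (q + d, d)" using assms by (rule enters.start)
  have "\<exists>p e. enters h (p, e) \<and> p \<notin> Rm" if "enters h (p', d')" for h p' d'
    using that by (induction rule: enters_induct) blast+
  from this[OF start] obtain p e where p: "enters (Half q d) (p, e)" "p \<notin> Rm" by blast
  have reverse: "enters (Half p (- e)) (q, - d)" using enters_reverse[OF start] enters_mate[OF p] by simp
  then show thesis using that p enters_dirs[OF p(1)] enters_mate[OF p] enters_mate[OF reverse assms(1)] by simp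
qed

definition live :: "half \<Rightarrow> bool" where
  "live h \<longleftrightarrow> (\<exists>q d. h = Half q d \<and> q \<notin> Rm \<and> d \<in> dirs \<and> passable (q + d) (- d))"

lemma live_passable:
  "enters h (p, d) \<Longrightarrow> live h \<Longrightarrow> passable p (- d)"
proof (induction h "(p, d)" arbitrary: p d rule: enters.induct)
  case (start q d)
  then show ?case unfolding live_def by simp
next
  case (step h p d)
  then have d: "d \<in> dirs" "passable p (- d)" using enters_dirs by blast+
  then show ?case
    using passable_sym[OF reflect_in_dirs removed_in_R] passable_reflect(1)[OF step(3) d] step(3) by blast
qed

lemma live_passable_behind:
  assumes "enters h (p, d)" "live h" shows "passable (p - d) d"
  using assms(1)
proof (cases rule: enters_cases)
  case first then show ?thesis by (intro passable_if_not_removed)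
next
  case (later d')
  then show ?thesis
    using passable_reflect(1)[OF _ enters_dirs live_passable] assms(2) by metis
qed

lemma live_if_in_grid:
  assumes "q \<in> Gd" "d \<in> dirs" shows "live (Half q d)"
  using assms passable_sym[of d q] passable_if_not_removed[of q d] grid_iff unfolding live_def by blast

lemma Half_in_grid_halves_iff: "Half q d \<in> grid_halves Lx Ly a \<longleftrightarrow> q \<in> Gd \<and> d \<in> dirs"
  by (cases q) (auto simp: grid_halves_def dirs_def)

section \<open>The parity of half-edges\<close>

fun half_parity :: "half \<Rightarrow> bool" where
  "half_parity (Half (x, y) (u, v)) = even (x + y + u)"
| "half_parity (Mid (x, y) (u, v)) = odd (x + y + u)"

definition cell_parity :: "int \<times> int \<Rightarrow> int \<times> int \<Rightarrow> bool" where
  "cell_parity p d = even (fst p + snd p + fst d)"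

text \<open>Inside a removed square the parity of a strand depends only on the line that it follows, and is
  not changed by the reflection at the diagonal, which exchanges the two coordinates.\<close>

definition square_parity :: "nat \<Rightarrow> int \<times> int \<Rightarrow> int \<times> int \<Rightarrow> bool" where
  "square_parity i p d \<longleftrightarrow> even (fst (concave i) + snd (concave i) + fst (outward i) +
     (if d \<in> {outward i, - outward i} then width i p else depth i p) +
     (if d \<in> {outward i, - rot (outward i)} then 1 else 0))"

definition strand_parity :: "int \<times> int \<Rightarrow> int \<times> int \<Rightarrow> bool" where
  "strand_parity p d \<longleftrightarrow> (\<forall>i. in_square i p \<longrightarrow> square_parity i p d) \<and> (p \<notin> Rm \<longrightarrow> cell_parity p d)"

lemma strand_parity_in_square: "in_square i p \<Longrightarrow> strand_parity p d = square_parity i p d"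
  unfolding strand_parity_def removed_iff using square_unique by metis

lemma strand_parity_not_removed: "p \<notin> Rm \<Longrightarrow> strand_parity p d = cell_parity p d"
  unfolding strand_parity_def removed_iff by blast

lemma square_parity_straight: "d \<in> dirs \<Longrightarrow> square_parity i (p + d) d = square_parity i p d"
  by (cases rule: frame_cases[of d i]) (simp_all add: square_parity_def)

lemma square_parity_reflect:
  assumes "d \<in> dirs" "in_square i p" shows "square_parity i p (rfl p d) = square_parity i p d"
  using assms(1)
  by (cases rule: frame_cases[of d i]; cases "depth i p = width i p")
    (simp_all add: square_parity_def reflect_frame[OF assms(2)])

lemma square_parity_leaves:
  assumes "d \<in> dirs" "in_square i p" "\<not> in_square i (p + d)" "passable p d"
  shows "square_parity i p d = cell_parity (p + d) d" "square_parity i p (- d) = cell_parity p (- d)"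
proof -
  have fst_outward: "even (fst (rot (outward i)) + fst (outward i) + 1)"
    by (simp add: outward_def)
  have "square_parity i p d = cell_parity (p + d) d \<and> square_parity i p (- d) = cell_parity p (- d)"
    using assms(1)
  proof (cases rule: frame_cases[of d i])
    case inward
    then have "depth i p = 1" using assms by (auto simp: passable_iff in_square_def)
    then show ?thesis using parity_coordinates[of p i] parity_coordinates[of "p - outward i" i] inward
      by (auto simp: square_parity_def cell_parity_def)
  next
    case left
    then have "width i p = 1" using assms by (auto simp: passable_iff in_square_def)
    then show ?thesis
      using parity_coordinates[of p i] parity_coordinates[of "p - rot (outward i)" i] left fst_outward
      by (auto simp: square_parity_def cell_parity_def)
  qed (use assms in \<open>auto simp: passable_iff in_square_def\<close>)
  then show "square_parity i p d = cell_parity (p + d) d" "square_parity i p (- d) = cell_parity p (- d)"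
    by auto
qed

lemma strand_parity_entering_square:
  assumes d: "d \<in> dirs" and behind: "passable p (- d)" and new: "\<And>i. in_square i p \<Longrightarrow> \<not> in_square i (p - d)"
  shows "strand_parity p d = cell_parity p d"
proof (cases "p \<in> Rm")
  case True
  then obtain i where i: "in_square i p" using removed_iff by blast
  then show ?thesis
    using strand_parity_in_square[OF i] square_parity_leaves(2)[OF in_dirs_minus[OF d] i _ behind] new by simp
qed (rule strand_parity_not_removed)

lemma strand_parity_reflect:
  assumes d: "d \<in> dirs" and p: "p \<in> Rm" and behind: "passable p (- d)"
  shows "strand_parity (p + rfl p d) (rfl p d) = strand_parity p d"
proof -
  let ?e = "rfl p d"
  obtain i where i: "in_square i p" using p removed_iff by blast
  have e: "?e \<in> dirs" "passable p ?e" using reflect_in_dirs[OF d] passable_reflect(1)[OF p d behind] by blast+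
  have "strand_parity (p + ?e) ?e = square_parity i p ?e"
  proof (cases "in_square i (p + ?e)")
    case True then show ?thesis using strand_parity_in_square[OF True] square_parity_straight[OF e(1)] by simp
  next
    case False
    then have "\<not> in_square j (p + ?e - ?e)" if "in_square j (p + ?e)" for j
      using square_unique[OF i, of j] that by auto
    then have "strand_parity (p + ?e) ?e = cell_parity (p + ?e) ?e"
      by (rule strand_parity_entering_square[OF e(1) passable_sym[OF e(1) removed_in_R[OF p] e(2)]])
    then show ?thesis using square_parity_leaves(1)[OF e(1) i False e(2)] by simp
  qed
  then show ?thesis using strand_parity_in_square[OF i] square_parity_reflect[OF d i] by simp
qed

lemma half_parity_first_mate:
  assumes "q \<notin> Rm" "d \<in> dirs" "live (Half q d)"
  shows "half_parity (m (Half q d)) \<longleftrightarrow> \<not> half_parity (Half q d)"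
proof -
  have along: "strand_parity p d \<longleftrightarrow> \<not> half_parity h" if "enters h (p, d)" "live h" for h p d
    using that
  proof (induction h "(p, d)" arbitrary: p d rule: enters.induct)
    case (start q d)
    then have "strand_parity (q + d) d = cell_parity (q + d) d"
      using removed_iff by (intro strand_parity_entering_square) (auto simp: live_def)
    then show ?case using start(2) by (cases q) (auto simp: dirs_def cell_parity_def)
  next
    case (step h p d)
    then show ?case using strand_parity_reflect[OF enters_dirs[OF step(1)] step(3)] live_passable[OF step(1)] by simp
  qed
  obtain p e where p: "enters (Half q d) (p, e)" "p \<notin> Rm" "e \<in> dirs" "m (Half q d) = Half p (- e)"
    by (rule first_mate_obtain[OF assms(1,2)])
  have "strand_parity p e = half_parity (Half p (- e))"
    using strand_parity_not_removed[OF p(2)] by (cases p; cases e) (auto simp: cell_parity_def)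
  then show ?thesis using along[OF p(1) assms(3)] p(4) by simp
qed

end

section \<open>External edges\<close>

lemma filter_consecutive:
  assumes "k < k'" "k' < length xs" "P (xs ! k)" "P (xs ! k')" "\<And>i. k < i \<Longrightarrow> i < k' \<Longrightarrow> \<not> P (xs ! i)"
  shows "\<exists>j. Suc j < length (filter P xs) \<and> filter P xs ! j = xs ! k \<and> filter P xs ! Suc j = xs ! k'"
proof -
  let ?A = "take k xs" and ?B = "drop (Suc k) (take k' xs)" and ?C = "drop (Suc k') xs"
  have "take k' xs = ?A @ xs ! k # ?B"
    using id_take_nth_drop[of k "take k' xs"] assms(1,2) by (simp add: min_def)
  moreover have "xs = take k' xs @ xs ! k' # ?C" by (rule id_take_nth_drop[OF assms(2)])
  moreover have "filter P ?B = []" using assms by (auto simp: filter_empty_conv in_set_conv_nth)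
  ultimately have "filter P xs = filter P ?A @ xs ! k # xs ! k' # filter P ?C"
    using assms(3,4) by (metis append.assoc append_Cons append_Nil filter.simps(2) filter_append)
  then show ?thesis by (intro exI[of _ "length (filter P ?A)"]) (simp add: nth_append)
qed

lemma length_filter_upto:
  fixes n u v :: int
  assumes "\<And>x. x \<in> {1..n} \<Longrightarrow> P x \<longleftrightarrow> u \<le> x \<and> x \<le> v" "1 \<le> u" "v \<le> n"
  shows "length (filter P [1..n]) = nat (v - u + 1)"
proof -
  have "{x. P x} \<inter> set [1..n] = {u..v}" using assms by auto
  then show ?thesis using distinct_length_filter[of "[1..n]" P] by simp
qed

context dihedral begin

declare first_mate.simps [simp del] first_ccw.simps [simp del]

abbreviation "rim \<equiv> rectangle_pendants Lx Ly"

definition kept :: "half \<Rightarrow> bool" where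
  "kept h \<longleftrightarrow> m h \<in> grid_halves Lx Ly a"

lemma pendants_eq: "pendants Lx Ly a = filter kept rim"
  unfolding pendants_def kept_def ..

lemma Half_in_set_rim: "Half q d \<in> set rim \<longleftrightarrow> q \<notin> R \<and> q + d \<in> R \<and> d \<in> dirs"
proof -
  obtain x y u v where q: "q = (x, y)" "d = (u, v)" by (cases q; cases d)
  have "Half (x, y) (u, v) \<in> set rim \<longleftrightarrow>
      (1 \<le> x \<and> x \<le> Lx \<and> y = 0 \<and> u = 0 \<and> v = 1) \<or> (x = Lx + 1 \<and> 1 \<le> y \<and> y \<le> Ly \<and> u = -1 \<and> v = 0) \<or>
      (1 \<le> x \<and> x \<le> Lx \<and> y = Ly + 1 \<and> u = 0 \<and> v = -1) \<or> (x = 0 \<and> 1 \<le> y \<and> y \<le> Ly \<and> u = 1 \<and> v = 0)"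
    unfolding rectangle_pendants_def by (auto simp: image_iff)
  also have "\<dots> \<longleftrightarrow> (x, y) \<notin> R \<and> (x + u, y + v) \<in> R \<and> (u, v) \<in> dirs" (is "?sides \<longleftrightarrow> ?leads_inside")
  proof
    assume ?sides
    then show ?leads_inside using size_bounds(1,2) unfolding R_iff dirs_def by (elim disjE conjE) simp_all
  next
    assume inside: ?leads_inside
    then have "(u, v) \<in> dirs" by blast
    then show ?sides by (cases rule: dirs_cases; use inside in \<open>simp add: R_iff; linarith\<close>)
  qed
  finally show ?thesis unfolding q by simp
qed

lemma rim_is_Half: "h \<in> set rim \<Longrightarrow> \<exists>q d. h = Half q d"
  by (auto simp: rectangle_pendants_def)

lemma length_rim: "length rim = nat (2 * Lx + 2 * Ly)"
  using size_bounds(1,2) by (simp add: rectangle_pendants_def)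

lemma distinct_rim: "distinct rim"
proof -
  have inj: "inj_on (\<lambda>x. Half (x, k) d) A" "inj_on (\<lambda>y. Half (k, y) d) A" for k d A by (auto simp: inj_on_def)
  show ?thesis
    unfolding rectangle_pendants_def distinct_append distinct_map distinct_rev distinct_upto set_append set_map
    by (intro conjI inj) (simp_all add: disjoint_iff image_iff, (intro allI impI, elim bexE, simp)+)
qed

text \<open>The position in \<open>rim\<close> of the pendant edge to the right of a step in direction \<open>d\<close> at \<open>p\<close>.\<close>

definition rim_index :: "int \<times> int \<Rightarrow> int \<times> int \<Rightarrow> int" where
  "rim_index p d = (if d = (1, 0) then fst p - 1 else if d = (0, 1) then Lx + snd p - 1
     else if d = (-1, 0) then 2 * Lx + Ly - fst p else 2 * Lx + 2 * Ly - snd p)"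

lemma rim_nth:
  assumes "p \<in> R" "d \<in> dirs" "p + rot d \<notin> R"
  shows "rim ! nat (rim_index p d) = Half (p + rot d) (- rot d)"
    "0 \<le> rim_index p d" "rim_index p d < 2 * Lx + 2 * Ly"
proof -
  obtain x y where p: "p = (x, y)" by (cases p)
  have bounds: "1 \<le> x" "x \<le> Lx" "1 \<le> y" "y \<le> Ly" using assms(1) unfolding p R_iff by auto
  have "rim ! nat (rim_index p d) = Half (p + rot d) (- rot d) \<and> 0 \<le> rim_index p d \<and> rim_index p d < 2 * Lx + 2 * Ly"
    using assms(2)
  proof (cases rule: dirs_cases)
    case south
    then have "x = 1" using assms(3) bounds unfolding p by (simp add: R_iff)
    moreover have "nat (2 * Lx + 2 * Ly - y) = nat Lx + (nat Ly + (nat Lx + nat (Ly - y)))" using bounds by simp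
    ultimately show ?thesis
      using south bounds unfolding p by (simp add: rim_index_def rectangle_pendants_def nth_append rev_nth)
  next
    case east
    then have "y = 1" using assms(3) bounds unfolding p by (simp add: R_iff)
    then show ?thesis using east bounds unfolding p by (simp add: rim_index_def rectangle_pendants_def nth_append)
  next
    case north
    then have "x = Lx" using assms(3) bounds unfolding p by (simp add: R_iff)
    moreover have "nat (Lx + y - 1) = nat Lx + nat (y - 1)" using bounds by simp
    ultimately show ?thesis
      using north bounds unfolding p by (simp add: rim_index_def rectangle_pendants_def nth_append)
  next
    case west
    then have "y = Ly" using assms(3) bounds unfolding p by (simp add: R_iff)
    moreover have "nat (2 * Lx + Ly - x) = nat Lx + (nat Ly + nat (Lx - x))" using bounds by simp
    ultimately show ?thesis
      using west bounds unfolding p by (simp add: rim_index_def rectangle_pendants_def nth_append rev_nth)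
  qed
  then show "rim ! nat (rim_index p d) = Half (p + rot d) (- rot d)"
    "0 \<le> rim_index p d" "rim_index p d < 2 * Lx + 2 * Ly" by auto
qed

lemma rim_index_straight:
  assumes "d \<in> dirs" shows "rim_index (p + d) d = rim_index p d + 1"
  using assms by (cases rule: dirs_cases) (simp_all add: rim_index_def)

lemma rim_index_corner:
  assumes "p \<in> R" "d \<in> dirs" "p + rot d \<notin> R" "p + d \<notin> R" "(p, d) \<noteq> ((1, 1), (0, -1))"
  shows "rim_index p (- rot d) = rim_index p d + 1"
  using assms(2)
  by (cases rule: dirs_cases; cases p) (use assms in \<open>auto simp: rim_index_def R_iff\<close>)

text \<open>The directions in which a strand coming from outside the rectangle runs through the removed
  squares.  A square that fills a whole side of the rectangle can be entered from that side only.\<close>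

definition inflow :: "nat \<Rightarrow> (int \<times> int) set" where
  "inflow i = (if i = 2 \<or> i = 3 \<and> a 3 = Lx then {- outward i, rot (outward i)}
     else if i = 4 \<or> i = 3 \<and> a 3 = Ly then {outward i, - rot (outward i)} else {})"

definition inward :: "int \<times> int \<Rightarrow> int \<times> int \<Rightarrow> bool" where
  "inward p d \<longleftrightarrow> p \<in> Gd \<or> (\<exists>i. in_square i p \<and> d \<in> inflow i)"

lemma inflow_leaves_square:
  assumes i: "in_square i p" and e: "e \<in> inflow i" "passable p e" and leaves: "\<not> in_square i (p + e)"
  shows "e = - outward i \<and> depth i p = 1 \<and> (i = 2 \<or> i = 3 \<and> a 3 = Lx) \<or>
    e = - rot (outward i) \<and> width i p = 1 \<and> (i = 4 \<or> i = 3 \<and> a 3 = Ly)"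
proof -
  have "e \<in> dirs" using e(1) by (auto simp: inflow_def outward_def dirs_def split: if_splits)
  then show ?thesis
    by (cases rule: frame_cases[of e i])
      (use i e leaves in \<open>auto simp: inflow_def passable_iff in_square_def split: if_splits\<close>)
qed

lemma inward_leaves_square:
  assumes i: "in_square i p" and e: "e \<in> inflow i" "passable p e" "\<not> in_square i (p + e)"
  shows "inward (p + e) e"
proof -
  obtain x y where p: "p = (x, y)" by (cases p)
  note sizes = size_bounds(1,2) size_bounds(3)[of 2, simplified] size_bounds(3)[of 3, simplified]
    size_bounds(3)[of 4, simplified] size_bounds(4-)
  have bounds: "1 \<le> depth i p" "depth i p \<le> a i" "1 \<le> width i p" "width i p \<le> a i"
    using i by (auto simp: in_square_def)
  consider (two) "i = 2" "e = (-1, 0)" "depth i p = 1" | (down) "i = 3" "a 3 = Lx" "e = (0, -1)" "depth i p = 1"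
    | (left) "i = 3" "a 3 = Ly" "e = (-1, 0)" "width i p = 1" | (four) "i = 4" "e = (0, -1)" "width i p = 1"
    using inflow_leaves_square[OF i e] by (auto simp: outward_def)
  then have "p + e \<in> R \<and> (\<forall>j\<in>{2, 3, 4}. in_square j (p + e) \<longrightarrow> e \<in> inflow j)"
  proof cases
    case two
    then have "p + e \<in> R" "\<not> in_square 3 (p + e)"
      using bounds sizes by (simp_all add: p R_iff in_square_def depth_width_coordinates)
    moreover have "e \<in> inflow 2" "e \<in> inflow 4" using two by (simp_all add: inflow_def outward_def)
    ultimately show ?thesis by blast
  next
    case down
    then have "p + e \<in> R" "\<not> in_square 4 (p + e)"
      using bounds sizes by (simp_all add: p R_iff in_square_def depth_width_coordinates)
    moreover have "e \<in> inflow 2" "e \<in> inflow 3" using down by (simp_all add: inflow_def outward_def)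
    ultimately show ?thesis by blast
  next
    case left
    then have "p + e \<in> R" "\<not> in_square 2 (p + e)" "a 3 \<noteq> Lx"
      using bounds sizes by (simp_all add: p R_iff in_square_def depth_width_coordinates)
    moreover have "e \<in> inflow 3" "e \<in> inflow 4" using left \<open>a 3 \<noteq> Lx\<close> by (simp_all add: inflow_def outward_def)
    ultimately show ?thesis by blast
  next
    case four
    then have "p + e \<in> R" "\<not> in_square 3 (p + e)"
      using bounds sizes by (simp_all add: p R_iff in_square_def depth_width_coordinates)
    moreover have "e \<in> inflow 2" "e \<in> inflow 4" using four by (simp_all add: inflow_def outward_def)
    ultimately show ?thesis by blast
  qed
  then show ?thesis using grid_iff removed_iff in_square_index unfolding inward_def by blast
qed

lemma reflect_in_inflow:
  assumes i: "in_square i p" and d: "d \<in> dirs" "d \<in> inflow i" "passable p (- d)" shows "rfl p d \<in> inflow i"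
proof (cases "depth i p = width i p")
  case True
  from d(1) show ?thesis
    by (cases rule: frame_cases[of d i])
      (use d(2,3) True in \<open>simp_all add: reflect_frame[OF i] passable_iff[OF i]\<close>,
        insert size_bounds(6), auto simp: inflow_def split: if_splits)
next
  case False then show ?thesis using d(2) reflect_frame(1)[OF i] by simp
qed

lemma inward_reflect:
  assumes "inward p d" "p \<in> Rm" "d \<in> dirs" "passable p (- d)" shows "inward (p + rfl p d) (rfl p d)"
proof -
  obtain i where i: "in_square i p" "d \<in> inflow i" using assms(1,2) grid_iff unfolding inward_def by blast
  then show ?thesis
    using inward_leaves_square[OF i(1)] reflect_in_inflow passable_reflect(1)[OF assms(2-4)] assms(3,4)
    unfolding inward_def by blast
qed

lemma inward_start:
  assumes q: "q \<notin> R" "q + d \<in> R" "d \<in> dirs" and passable: "passable (q + d) (- d)"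
  shows "inward (q + d) d"
proof (cases "q + d \<in> Rm")
  case False then show ?thesis using q(2) grid_iff unfolding inward_def by blast
next
  case True
  then obtain i where i: "in_square i (q + d)" using removed_iff by blast
  define p where "p = q + d"
  note i = i[folded p_def] and passable = passable[folded p_def]
  have outside: "p - d \<notin> R" using q(1) by (simp add: p_def)
  then have leaves: "\<not> in_square i (p - d)" using in_square_in_R by blast
  from q(3) have enters: "d = outward i \<and> depth i p = 1 \<or> d = rot (outward i) \<and> width i p = 1"
    using i leaves passable by (cases rule: frame_cases[of d i]) (auto simp: passable_iff in_square_def)
  obtain x y where p: "p = (x, y)" by (cases p)
  have R: "1 \<le> x" "x \<le> Lx" "1 \<le> y" "y \<le> Ly" using in_square_in_R[OF i] unfolding p R_iff by auto
  note frame = p outward_def depth_width_coordinates R_iff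
  from enters have "d \<in> inflow i"
  proof (elim disjE conjE)
    assume d: "d = outward i" "depth i p = 1"
    have "i = 4 \<or> i = 3 \<and> a 3 = Ly"
      using in_square_index[OF i] d outside R size_bounds(4) by (elim insertE emptyE) (simp_all add: frame)
    then show ?thesis using d(1) size_bounds(6) by (auto simp: inflow_def)
  next
    assume d: "d = rot (outward i)" "width i p = 1"
    have "i = 2 \<or> i = 3 \<and> a 3 = Lx"
      using in_square_index[OF i] d outside R size_bounds(5) by (elim insertE emptyE) (simp_all add: frame)
    then show ?thesis using d(1) by (simp add: inflow_def)
  qed
  then show ?thesis using i unfolding inward_def p_def by blast
qed

lemma kept_iff:
  assumes q: "q \<notin> R" "q + d \<in> R" "d \<in> dirs" shows "kept (Half q d) \<longleftrightarrow> passable (q + d) (- d)"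
proof -
  have not_removed: "q \<notin> Rm" using q(1) removed_in_R by blast
  obtain p e where p: "enters (Half q d) (p, e)" "p \<notin> Rm" "e \<in> dirs" "m (Half q d) = Half p (- e)"
    "enters (Half p (- e)) (q, - d)" by (rule first_mate_obtain[OF not_removed q(3)])
  have "kept (Half q d) \<longleftrightarrow> p \<in> Gd" unfolding kept_def p(4) Half_in_grid_halves_iff using in_dirs_minus p(3) by blast
  also have "\<dots> \<longleftrightarrow> passable (q + d) (- d)"
  proof
    assume "p \<in> Gd"
    then have "live (Half p (- e))" using live_if_in_grid in_dirs_minus[OF p(3)] by blast
    from live_passable_behind[OF p(5) this] show "passable (q + d) (- d)" by simp
  next
    assume "passable (q + d) (- d)"
    then have live: "live (Half q d)" and initial: "inward (q + d) d"
      using inward_start[OF q] not_removed q(3) unfolding live_def by blast+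
    have "inward p' d'" if "enters h (p', d')" "h = Half q d" for h p' d'
      using that
    proof (induction h "(p', d')" arbitrary: p' d' rule: enters.induct)
      case start then show ?case using initial by simp
    next
      case (step h p' d')
      then show ?case using inward_reflect[OF _ step(3)] enters_dirs live_passable live by blast
    qed
    from this[OF p(1)] show "p \<in> Gd" using p(2) removed_iff unfolding inward_def by blast
  qed
  finally show ?thesis .
qed

lemma passable_outwards_iff:
  assumes p: "p \<in> R" "d \<in> dirs" "p + d \<notin> R"
  shows "passable p d \<longleftrightarrow> (\<forall>i. in_square i p \<longrightarrow> d \<notin> {outward i, rot (outward i)})"
proof (cases "p \<in> Rm")
  case True
  then obtain i where i: "in_square i p" using removed_iff by blast
  then have unique: "in_square j p \<longleftrightarrow> j = i" for j using square_unique by blast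
  have "\<not> in_square i (p + d)" using p(3) in_square_in_R by blast
  with p(2) show ?thesis unfolding unique
    by (cases rule: frame_cases[of d i]) (use i in \<open>auto simp: passable_iff in_square_def\<close>)
next
  case False then show ?thesis using passable_if_not_removed removed_iff by blast
qed

lemma kept_sides:
  "x \<in> {1..Lx} \<Longrightarrow> kept (Half (x, 0) (0, 1)) \<longleftrightarrow> x \<le> Lx - a 2"
  "y \<in> {1..Ly} \<Longrightarrow> kept (Half (Lx + 1, y) (-1, 0)) \<longleftrightarrow> a 2 < y \<and> y \<le> Ly - a 3"
  "x \<in> {1..Lx} \<Longrightarrow> kept (Half (x, Ly + 1) (0, -1)) \<longleftrightarrow> a 4 < x \<and> x \<le> Lx - a 3"
  "y \<in> {1..Ly} \<Longrightarrow> kept (Half (0, y) (1, 0)) \<longleftrightarrow> y \<le> Ly - a 4"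
proof -
  have kept: "kept (Half q d) \<longleftrightarrow> (\<forall>i\<in>{2, 3, 4}. in_square i (q + d) \<longrightarrow> - d \<notin> {outward i, rot (outward i)})"
    if "q \<notin> R" "q + d \<in> R" "d \<in> dirs" for q d
  proof -
    have "passable (q + d) (- d) \<longleftrightarrow> (\<forall>i. in_square i (q + d) \<longrightarrow> - d \<notin> {outward i, rot (outward i)})"
      by (rule passable_outwards_iff) (use that in_dirs_minus in auto)
    then show ?thesis using kept_iff[OF that] in_square_index by blast
  qed
  note sizes = size_bounds(1,2) size_bounds(3)[of 2, simplified] size_bounds(3)[of 3, simplified]
    size_bounds(3)[of 4, simplified] size_bounds(4-)
  show "kept (Half (x, 0) (0, 1)) \<longleftrightarrow> x \<le> Lx - a 2" if "x \<in> {1..Lx}"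
    using that sizes
    by (subst kept) (auto simp: R_iff dirs_def in_square_def depth_width_coordinates outward_def)
  show "kept (Half (Lx + 1, y) (-1, 0)) \<longleftrightarrow> a 2 < y \<and> y \<le> Ly - a 3" if "y \<in> {1..Ly}"
    using that sizes
    by (subst kept) (auto simp: R_iff dirs_def in_square_def depth_width_coordinates outward_def)
  show "kept (Half (x, Ly + 1) (0, -1)) \<longleftrightarrow> a 4 < x \<and> x \<le> Lx - a 3" if "x \<in> {1..Lx}"
    using that sizes
    by (subst kept) (auto simp: R_iff dirs_def in_square_def depth_width_coordinates outward_def)
  show "kept (Half (0, y) (1, 0)) \<longleftrightarrow> y \<le> Ly - a 4" if "y \<in> {1..Ly}"
    using that sizes
    by (subst kept) (auto simp: R_iff dirs_def in_square_def depth_width_coordinates outward_def)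
qed

abbreviation "N \<equiv> nat (Lx + Ly - (\<Sum>i=1..4. a i))"

lemma N_eq: "int N = Lx + Ly - a 2 - a 3 - a 4" and N_pos: "1 \<le> N"
proof -
  have "(\<Sum>i=1..4. a i) = a 2 + a 3 + a 4"
    using a_1 by (simp add: numeral_eq_Suc atLeastAtMostSuc_conv)
  moreover have "1 \<le> Lx + Ly - (a 2 + a 3 + a 4)"
    using size_bounds(1,2) size_bounds(3)[of 2] size_bounds(3)[of 4] size_bounds(4-) by auto
  ultimately show "int N = Lx + Ly - a 2 - a 3 - a 4" "1 \<le> N" by auto
qed

lemma length_pendants: "length (pendants Lx Ly a) = 2 * N"
proof -
  note sizes = size_bounds(3)[of 2, simplified] size_bounds(3)[of 3, simplified]
    size_bounds(3)[of 4, simplified] size_bounds(4-)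
  have "length (filter (\<lambda>x. kept (Half (x, 0) (0, 1))) [1..Lx]) = nat (Lx - a 2 - 1 + 1)"
    by (rule length_filter_upto) (use kept_sides(1) sizes in auto)
  moreover have "length (filter (\<lambda>y. kept (Half (Lx + 1, y) (-1, 0))) [1..Ly]) = nat (Ly - a 3 - (a 2 + 1) + 1)"
    by (rule length_filter_upto) (use kept_sides(2) sizes in auto)
  moreover have "length (filter (\<lambda>x. kept (Half (x, Ly + 1) (0, -1))) [1..Lx]) = nat (Lx - a 3 - (a 4 + 1) + 1)"
    by (rule length_filter_upto) (use kept_sides(3) sizes in auto)
  moreover have "length (filter (\<lambda>y. kept (Half (0, y) (1, 0))) [1..Ly]) = nat (Ly - a 4 - 1 + 1)"
    by (rule length_filter_upto) (use kept_sides(4) sizes in auto)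
  ultimately have "int (length (pendants Lx Ly a)) = 2 * (Lx + Ly - a 2 - a 3 - a 4)"
    using sizes unfolding pendants_eq rectangle_pendants_def
    by (simp add: filter_map o_def rev_filter[symmetric])
  then have "int (length (pendants Lx Ly a)) = int (2 * N)" unfolding of_nat_mult N_eq by simp
  then show ?thesis by (simp only: of_nat_eq_iff)
qed

section \<open>Domains of the first kind\<close>

abbreviation "FK \<equiv> first_kind Lx Ly a"
abbreviation "H \<equiv> half_edges FK"
abbreviation "X \<equiv> ext_halves FK"
abbreviation "J \<equiv> {1..2 * N}"
abbreviation "c \<equiv> first_ccw Lx Ly a"
abbreviation "f \<equiv> face_step FK"

lemma H_eq: "H = grid_halves Lx Ly a \<union> set (pendants Lx Ly a)"
  and ccw_FK: "ccw FK = c" and mate_FK: "mate FK = m" and nblack_FK: "nblack FK = N"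
  and ext_FK: "ext FK j = pendants Lx Ly a ! (j - 1)"
  by (simp_all add: first_kind_def first_kind_map_def Let_def)

lemma X_eq: "X = set (pendants Lx Ly a)"
proof -
  have "(\<lambda>j. j - 1) ` J = {..<2 * N}"
  proof
    show "{..<2 * N} \<subseteq> (\<lambda>j. j - 1) ` J"
    proof
      fix k assume "k \<in> {..<2 * N}"
      then show "k \<in> (\<lambda>j. j - 1) ` J" by (intro image_eqI[of _ _ "Suc k"]) auto
    qed
  qed auto
  then have "X = (!) (pendants Lx Ly a) ` {..<2 * N}"
    unfolding ext_halves_def nblack_FK ext_FK by (metis image_image)
  then show ?thesis using length_pendants by (auto simp: set_conv_nth)
qed

lemma Half_in_X_iff: "Half q d \<in> X \<longleftrightarrow> d \<in> dirs \<and> q \<notin> R \<and> q + d \<in> R \<and> kept (Half q d)"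
  unfolding X_eq pendants_eq set_filter using Half_in_set_rim by blast

lemma Half_in_H_iff: "Half q d \<in> H \<longleftrightarrow> d \<in> dirs \<and> (q \<in> Gd \<or> q \<notin> R \<and> q + d \<in> R \<and> kept (Half q d))"
  unfolding H_eq Un_iff X_eq[symmetric] Half_in_X_iff Half_in_grid_halves_iff by blast

lemma Half_in_H_if_grid: "p \<in> Gd \<Longrightarrow> d \<in> dirs \<Longrightarrow> Half p d \<in> H"
  using Half_in_H_iff by blast

lemma H_cases:
  assumes "h \<in> H"
  obtains (inner) p d where "h = Half p d" "p \<in> Gd" "d \<in> dirs" "h \<notin> X"
  | (external) q d where "h = Half q d" "q \<notin> R" "q + d \<in> R" "d \<in> dirs" "kept h" "h \<in> X"
proof -
  obtain q d where h: "h = Half q d"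
    using assms rim_is_Half[of h] unfolding H_eq pendants_eq grid_halves_def by auto
  then show thesis using assms inner external Half_in_H_iff Half_in_X_iff grid_iff by metis
qed

lemma H_start:
  assumes "h \<in> H" obtains q d where "h = Half q d" "d \<in> dirs" "q \<notin> Rm" "live h" "enters h (q + d, d)"
  using assms
proof (cases rule: H_cases)
  case (inner p d)
  then show thesis using that live_if_in_grid enters.start grid_iff by metis
next
  case (external q d)
  then have "q \<notin> Rm" "passable (q + d) (- d)" using removed_in_R kept_iff by blast+
  then show thesis using that external enters.start unfolding live_def by blast
qed

lemma in_X_iff: "h \<in> H \<Longrightarrow> h = Half q d \<Longrightarrow> h \<in> X \<longleftrightarrow> q \<notin> Gd"
  using Half_in_H_iff Half_in_X_iff grid_iff by blast

lemma H_passable: "h \<in> H \<Longrightarrow> enters h (p, d) \<Longrightarrow> passable p (- d) \<and> d \<in> dirs"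
  using H_start live_passable enters_dirs by metis

lemma H_enters_from_R:
  assumes "h \<in> H" "enters h (p, d)" "p \<notin> R" shows "p - d \<in> R"
  using assms(2)
proof (cases rule: enters_cases)
  case first
  then show ?thesis using assms(1,3) Half_in_H_iff[of "p - d" d] grid_iff by auto
next
  case later then show ?thesis using removed_in_R by blast
qed

lemma mate_H:
  assumes "h \<in> H" shows "m h \<in> H" "m (m h) = h" "h \<in> X \<Longrightarrow> m h \<notin> X"
proof -
  obtain q d where h: "h = Half q d" "d \<in> dirs" "q \<notin> Rm" by (rule H_start[OF assms])
  obtain p e where p: "enters h (p, e)" "p \<notin> Rm" "e \<in> dirs" "m h = Half p (- e)" "m (Half p (- e)) = h"
    using first_mate_obtain[OF h(3,2)] h(1) by metis
  have e: "- e \<in> dirs" using p(3) by (rule in_dirs_minus)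
  show "m (m h) = h" using p by simp
  have "m h \<in> H \<and> (h \<in> X \<longrightarrow> p \<in> Gd)"
    using assms
  proof (cases rule: H_cases)
    case (inner q d)
    show ?thesis
    proof (cases "p \<in> R")
      case True
      then show ?thesis using p e inner(4) grid_iff Half_in_H_if_grid by simp
    next
      case False
      moreover have "p - e \<in> R" using H_enters_from_R[OF assms p(1) False] .
      moreover have "kept (Half p (- e))" unfolding kept_def p(5) using inner Half_in_grid_halves_iff by simp
      ultimately show ?thesis using p(4) e inner(4) Half_in_H_iff[of p "- e"] by simp
    qed
  next
    case external
    then have "p \<in> Gd" unfolding kept_def p(4) Half_in_grid_halves_iff by blast
    then show ?thesis using p(4) e Half_in_H_if_grid by simp
  qed
  then show "m h \<in> H" "h \<in> X \<Longrightarrow> m h \<notin> X" using in_X_iff[OF _ p(4)] by blast+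
qed

lemma ccw_in_grid: "p \<in> Gd \<Longrightarrow> c (Half p d) = Half p (- rot d)"
  by (cases d) (simp add: first_ccw.simps)

lemma ccw_X:
  assumes "h \<in> X" shows "c h = h"
proof -
  obtain q d where "h = Half q d" "q \<notin> Gd"
    using assms Half_in_X_iff grid_iff X_eq pendants_eq rim_is_Half by (metis filter_is_subset subsetD)
  then show ?thesis by (cases d) (simp add: first_ccw.simps)
qed

lemma quartic_in_grid:
  assumes "h \<in> H" "h \<notin> X" shows "quartic FK h"
  using assms(1)
proof (cases rule: H_cases)
  case (inner p d)
  then have "- d \<noteq> d" using dirs_distinct[OF inner(3)] by auto
  then show ?thesis using inner by (simp add: quartic_def ccw_FK ccw_in_grid)
next
  case external then show ?thesis using assms(2) by blast
qed

lemma finite_H: "finite H"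
proof -
  have "grid_halves Lx Ly a \<subseteq> (\<lambda>(p, d). Half p d) ` (R \<times> dirs)"
    unfolding grid_halves_def dirs_def using grid_iff by (auto 0 3)
  moreover have "finite (R \<times> dirs)" unfolding rectangle_def dirs_def by simp
  ultimately show ?thesis unfolding H_eq using finite_subset by blast
qed

lemma ext_FK_in_X: "j \<in> J \<Longrightarrow> ext FK j \<in> X"
  by (auto simp: ext_halves_def nblack_FK)

lemma X_subset_H: "h \<in> X \<Longrightarrow> h \<in> H"
  by (simp add: H_eq X_eq)

lemma inj_on_ext_FK: "inj_on (ext FK) J"
proof (rule inj_onI)
  fix i j assume ij: "i \<in> J" "j \<in> J" "ext FK i = ext FK j"
  have "distinct (pendants Lx Ly a)" unfolding pendants_eq using distinct_rim by (rule distinct_filter)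
  then have "i - 1 = j - 1" using ij length_pendants by (auto simp: ext_FK nth_eq_iff_index_eq)
  then show "i = j" using ij by auto
qed

lemma disk_map_FK: "disk_map FK"
proof (rule disk_map.intro, unfold ccw_FK mate_FK nblack_FK)
  show "c h \<in> H" if h: "h \<in> H" for h
    using h
  proof (cases rule: H_cases)
    case (inner p d)
    then show ?thesis using Half_in_H_if_grid in_dirs_minus in_dirs_rot by (simp add: ccw_in_grid)
  next
    case external then show ?thesis using ccw_X h by simp
  qed
  show "quartic FK (m h)" if "h \<in> X" for h
    using quartic_in_grid mate_H(1,3) X_subset_H that by blast
qed (use finite_H mate_H N_pos ext_FK_in_X X_subset_H inj_on_ext_FK ccw_X quartic_in_grid in auto)

end

sublocale dihedral \<subseteq> FK: disk_map "first_kind Lx Ly a"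
  rewrites "ccw (first_kind Lx Ly a) = first_ccw Lx Ly a" and "mate (first_kind Lx Ly a) = first_mate Lx Ly a"
    and "nblack (first_kind Lx Ly a) = nat (Lx + Ly - (\<Sum>i=1..4. a i))"
  by (fact disk_map_FK ccw_FK mate_FK nblack_FK)+

context dihedral begin

abbreviation "e \<equiv> ext FK"
abbreviation "nx \<equiv> next_ext FK"

lemma face_step_grid:
  assumes "h \<in> H" "enters h (p, d)" "p \<in> Gd"
  shows "f h = Half p (rot d)" "Half p (rot d) \<in> H" "enters (Half p (rot d)) (p + rot d, rot d)"
proof -
  have d: "rot d \<in> dirs" using enters_dirs[OF assms(2)] in_dirs_rot by blast
  have p: "p \<notin> Rm" using assms(3) grid_iff by blast
  have mate: "m h = Half p (- d)" by (rule enters_mate[OF assms(2) p])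
  then have "m h \<notin> X" using in_X_iff mate_H(1)[OF assms(1)] assms(3) by blast
  then show "f h = Half p (rot d)" using mate FK.face_step_inner ccw_in_grid[OF assms(3)] by simp
  show "Half p (rot d) \<in> H" "enters (Half p (rot d)) (p + rot d, rot d)"
    using Half_in_H_if_grid assms(3) d enters.start p by blast+
qed

lemma ext_consecutive:
  assumes "0 \<le> k" "k < k'" "k' < 2 * Lx + 2 * Ly" "kept (rim ! nat k)" "kept (rim ! nat k')"
    "\<And>i. k < i \<Longrightarrow> i < k' \<Longrightarrow> \<not> kept (rim ! nat i)"
  obtains j where "j \<in> J" "e j = rim ! nat k" "e (nx j) = rim ! nat k'"
proof -
  have "\<not> kept (rim ! i)" if "nat k < i" "i < nat k'" for i using assms(6)[of "int i"] that by simp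
  then obtain j where j: "Suc j < length (pendants Lx Ly a)" "pendants Lx Ly a ! j = rim ! nat k"
    "pendants Lx Ly a ! Suc j = rim ! nat k'"
    using filter_consecutive[of "nat k" "nat k'" rim kept] assms length_rim unfolding pendants_eq by auto
  then have "nx (Suc j) = Suc (Suc j)" using length_pendants by (simp add: next_ext_def nblack_FK)
  then show thesis using that[of "Suc j"] j length_pendants by (simp add: ext_FK)
qed

lemma ext_first: "e 1 = Half (1, 0) (0, 1)"
proof -
  obtain hs where rim: "rim = Half (1, 0) (0, 1) # hs"
    using size_bounds(1) by (simp add: rectangle_pendants_def upto_rec1)
  have "kept (Half (1, 0) (0, 1))" using kept_sides(1)[of 1] size_bounds by simp
  then show ?thesis by (simp add: ext_FK pendants_eq rim)
qed

lemma ext_last: "e (2 * N) = Half (0, 1) (1, 0)"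
proof -
  have "rev [1..Ly] = rev [2..Ly] @ [1]" using size_bounds(2) by (simp add: upto_rec1)
  then obtain hs where rim: "rim = hs @ [Half (0, 1) (1, 0)]" by (simp add: rectangle_pendants_def)
  have "kept (Half (0, 1) (1, 0))" using kept_sides(4)[of 1] size_bounds by simp
  then have "pendants Lx Ly a = filter kept hs @ [Half (0, 1) (1, 0)]" by (simp add: pendants_eq rim)
  moreover from this have "2 * N - 1 = length (filter kept hs)" using length_pendants by simp
  ultimately show ?thesis unfolding ext_FK by (metis nth_append_length)
qed

lemma mate_ext_at_first:
  "m (Half (1, 0) (0, 1)) = Half (1, 1) (0, -1)" "m (Half (0, 1) (1, 0)) = Half (1, 1) (-1, 0)"
proof -
  have "m (Half q d) = Half (1, 1) (- d)" if "q + d = (1, 1)" "q \<notin> R" "d \<in> dirs" for q d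
  proof -
    have "q \<notin> Rm" using that(2) removed_in_R by blast
    then have "enters (Half q d) ((1, 1), d)" using enters.start[of q d] that by simp
    then show ?thesis using enters_mate one_one_in_grid grid_iff by blast
  qed
  from this[of "(1, 0)" "(0, 1)"] this[of "(0, 1)" "(1, 0)"]
  show "m (Half (1, 0) (0, 1)) = Half (1, 1) (0, -1)" "m (Half (0, 1) (1, 0)) = Half (1, 1) (-1, 0)"
    by (simp_all add: R_iff dirs_def)
qed

section \<open>Parallel strands\<close>

definition reaches :: "nat \<Rightarrow> half \<Rightarrow> half \<Rightarrow> bool" where
  "reaches k h g \<longleftrightarrow> (\<exists>n\<le>k. (f ^^ n) h = g)"

lemma reaches_self: "reaches k h h"
  unfolding reaches_def by (rule exI[of _ 0]) simp

lemma reaches_Suc: "reaches k (f h) g \<Longrightarrow> reaches (Suc k) h g"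
  unfolding reaches_def by (metis Suc_le_mono funpow_Suc_right comp_apply)

lemma reaches_one: "f h = g \<Longrightarrow> 1 \<le> k \<Longrightarrow> reaches k h g"
  unfolding reaches_def by (intro exI[of _ 1]) simp

lemma reaches_two: "f (f h) = g \<Longrightarrow> reaches 2 h g"
  unfolding reaches_def by (intro exI[of _ 2]) (simp add: numeral_2_eq_2)

lemma reaches_mono: "reaches k h g \<Longrightarrow> k \<le> l \<Longrightarrow> reaches l h g"
  unfolding reaches_def using order_trans by blast

lemma enters_turn:
  assumes "h \<in> H" "enters h (p, d)" "p \<in> Rm" "d' \<in> dirs" "passable p d'" "d' \<noteq> - d"
  shows "enters h (p + d', d')"
  using enters_straight[OF assms(2,3) reflect_eqI[OF assms(3)]] H_passable[OF assms(1,2)] assms(4-6) by blast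

lemma mate_eq_if_strands_meet:
  assumes h: "h \<in> H" "enters h (p, d)" and g: "g \<in> H" "enters g (p, d')" and "p \<in> Rm" "d \<noteq> d'"
  shows "h = m g"
proof -
  have "enters h (p + - d', - d')"
    using enters_turn[OF h assms(5), of "- d'"] H_passable[OF g] in_dirs_minus[of d'] assms(6) by simp
  then show ?thesis using enters_unique enters_reverse[OF g(2)] by simp
qed

context
  fixes h g :: half
  assumes h: "h \<in> H" and g: "g \<in> H"
begin

lemma parallel_exit:
  assumes h_enters: "enters h (p, d)" "p \<notin> R" and g_enters: "enters g (p + rot d, d)" "p + rot d \<notin> R"
  shows "f h = m g"
proof -
  let ?r = "rot d"
  have dirs: "- ?r \<in> dirs" using enters_dirs[OF h_enters(1)] in_dirs_rot in_dirs_minus by blast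
  have R: "p - d \<in> R" "p - d + ?r \<in> R"
    using H_enters_from_R[OF h h_enters] H_enters_from_R[OF g g_enters] by (simp_all add: algebra_simps)
  have mates: "m h = Half p (- d)" "m g = Half (p + ?r) (- d)"
    using enters_mate h_enters g_enters removed_in_R by blast+
  have "rim ! nat (rim_index (p - d + ?r) (- ?r)) = m g" "0 \<le> rim_index (p - d + ?r) (- ?r)"
    using rim_nth[OF R(2) dirs] g_enters(2) mates by (simp_all add: algebra_simps)
  moreover have "rim ! nat (rim_index (p - d) (- ?r)) = m h" "rim_index (p - d) (- ?r) < 2 * Lx + 2 * Ly"
    using rim_nth[OF R(1) dirs] h_enters(2) mates by simp_all
  moreover have "rim_index (p - d) (- ?r) = rim_index (p - d + ?r) (- ?r) + 1"
    using rim_index_straight[OF dirs, of "p - d + ?r"] by simp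
  moreover have "kept (m h)" "kept (m g)"
    using mates mate_H(1) h g in_X_iff Half_in_X_iff h_enters(2) g_enters(2) grid_iff by metis+
  ultimately obtain j where "j \<in> J" "e j = m g" "e (nx j) = m h"
    using ext_consecutive[of "rim_index (p - d + ?r) (- ?r)" "rim_index (p - d) (- ?r)"] by auto
  then show ?thesis using FK.face_step_mate_ext[of j] mate_H(2)[OF h] by simp
qed

lemma parallel_at_grid:
  assumes h_enters: "enters h (p, d)" "p \<in> R" and g_enters: "enters g (p + rot d, d)" "p + rot d \<in> R"
    and grid: "p \<in> Gd \<or> p + rot d \<in> Gd"
  shows "reaches 2 h (m g)"
proof -
  let ?r = "rot d"
  have d: "?r \<in> dirs" "- ?r \<in> dirs" "d \<noteq> ?r" "?r \<noteq> - d"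
    using in_dirs_rot in_dirs_minus dirs_distinct[OF enters_dirs[OF h_enters(1)]] enters_dirs[OF h_enters(1)] by auto
  have mate_g: "m g = Half (p + ?r) (- d)" if "p + ?r \<in> Gd" using enters_mate[OF g_enters(1)] that grid_iff by blast
  consider (both) "p \<in> Gd" "p + ?r \<in> Gd" | (first) "p \<in> Gd" "p + ?r \<in> Rm" | (second) "p \<in> Rm" "p + ?r \<in> Gd"
    using grid h_enters(2) g_enters(2) grid_iff by blast
  then show ?thesis
  proof cases
    case both
    note step = face_step_grid[OF h h_enters(1) both(1)]
    have "f (f h) = m g" using face_step_grid(1)[OF step(2,3) both(2)] step(1) mate_g both(2) by simp
    then show ?thesis by (rule reaches_two)
  next
    case first
    note step = face_step_grid[OF h h_enters(1) first(1)]
    have "f h = m g" using mate_eq_if_strands_meet[OF step(2,3) g g_enters(1) first(2)] step(1) d(3) by simp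
    then show ?thesis by (rule reaches_one) simp
  next
    case second
    have "passable p ?r"
      using passable_sym[OF d(2) g_enters(2)] passable_if_not_removed[of "p + ?r"] second(2) grid_iff by simp
    then have "enters h (p + ?r, ?r)" using enters_turn[OF h h_enters(1) second(1) d(1)] d(4) by simp
    then have "f h = m g" using face_step_grid(1)[OF h _ second(2)] mate_g second(2) by simp
    then show ?thesis by (rule reaches_one) simp
  qed
qed

lemma parallel_bend_left:
  assumes h_enters: "enters h (p, d)" "p \<in> Rm" "rfl p d = - rot d"
    and g_enters: "enters g (p + rot d, d)" "p + rot d \<in> R"
  shows "enters h (p - rot d, - rot d)" "enters g (p - rot d + rot (- rot d), - rot d)"
    "p - rot d \<in> R \<longleftrightarrow> p - rot d + rot (- rot d) \<in> R"
proof -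
  let ?r = "rot d"
  have d: "d \<in> dirs" "passable p (- d)" using H_passable[OF h h_enters(1)] by blast+
  have "passable p (- ?r)" using passable_reflect(1)[OF h_enters(2) d] h_enters(3) by simp
  note bend = bend_left[OF d(1) h_enters(2) g_enters(2) d(2) this]
  show "enters h (p - ?r, - ?r)" using enters_straight[OF h_enters] by simp
  have "enters g (p + ?r + d, d)" by (rule enters_straight[OF g_enters(1) bend(1,2)])
  from enters_straight[OF this bend(3,4)] have "enters g (p + d, - ?r)" by (simp add: algebra_simps)
  from enters_straight[OF this bend(5,6)] show "enters g (p - ?r + rot (- ?r), - ?r)" by (simp add: algebra_simps)
  show "p - ?r \<in> R \<longleftrightarrow> p - ?r + rot (- ?r) \<in> R"
    using R_parallel[of "- ?r" p] in_dirs_minus in_dirs_rot d(1) removed_in_R h_enters(2) bend(5) by simp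
qed

lemma parallel_bend_right:
  assumes h_enters: "enters h (p, d)" "p \<in> Rm" "rfl p d = d"
    and g_enters: "enters g (p + rot d, d)" "p + rot d \<in> Rm" "rfl (p + rot d) d = rot d"
  shows "enters h (p + d + rot d + rot d, rot d)"
    "strand_length (p + d + rot d + rot d, rot d) < strand_length (p, d)"
    "enters g (p + d + rot d + rot d + rot (rot d), rot d)"
    "p + d + rot d + rot d \<in> R \<longleftrightarrow> p + d + rot d + rot d + rot (rot d) \<in> R"
proof -
  let ?r = "rot d"
  have d: "d \<in> dirs" "passable p (- d)" "passable (p + ?r) (- d)"
    using H_passable[OF h h_enters(1)] H_passable[OF g g_enters(1)] by blast+
  have turn: "passable (p + ?r) ?r" using passable_reflect(1)[OF g_enters(2) d(1,3)] g_enters(3) by simp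
  have "p + ?r - ?r \<in> R" using h_enters(2) removed_in_R by simp
  note bend = bend_right[OF d(1) g_enters(2) this d(3) turn]
  have removed: "p + d \<in> Rm" "p + d + ?r \<in> Rm" using bend(3,5) by (simp_all add: algebra_simps)
  have reflect: "rfl (p + d) d = ?r" "rfl (p + d + ?r) ?r = ?r" using bend(4,6) by (simp_all add: algebra_simps)
  have first: "enters h (p + d, d)" by (rule enters_straight[OF h_enters])
  have second: "enters h (p + d + ?r, ?r)" by (rule enters_straight[OF first removed(1) reflect(1)])
  show "enters h (p + d + ?r + ?r, ?r)" by (rule enters_straight[OF second removed(2) reflect(2)])
  show "strand_length (p + d + ?r + ?r, ?r) < strand_length (p, d)"
    using strand_length_advance[OF h_enters(1,2)] strand_length_advance[OF first removed(1)]
      strand_length_advance[OF second removed(2)] unfolding h_enters(3) reflect by linarith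
  show "enters g (p + d + ?r + ?r + rot ?r, ?r)"
    using enters_straight[OF g_enters] by (simp add: algebra_simps)
  show "p + d + ?r + ?r \<in> R \<longleftrightarrow> p + d + ?r + ?r + rot ?r \<in> R"
    using R_parallel[of ?r "p + d + ?r"] in_dirs_rot d(1) removed_in_R removed(2) g_enters(2)
    by (simp add: algebra_simps)
qed

lemma parallel_reflect_cases:
  assumes h_enters: "enters h (p, d)" "p \<in> Rm" and g_enters: "enters g (p + rot d, d)" "p + rot d \<in> Rm"
  obtains (right) "rfl p d = rot d" | (left) "rfl p d = - rot d"
    | (straight) "rfl p d = d" "rfl (p + rot d) d = d" | (bend) "rfl p d = d" "rfl (p + rot d) d = rot d"
proof -
  let ?r = "rot d"
  have d: "d \<in> dirs" "passable p (- d)" "passable (p + ?r) (- d)"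
    using H_passable h g h_enters(1) g_enters(1) by blast+
  have "rfl p d \<in> {d, ?r, - ?r}" "rfl (p + ?r) d \<in> {d, ?r, - ?r}"
    using reflect_in_dirs[OF d(1), unfolded dirs_eq[OF d(1)]] passable_reflect(2)[OF h_enters(2) d(1,2)]
      passable_reflect(2)[OF g_enters(2) d(1,3)] by blast+
  moreover have "rfl p d = ?r" if "rfl (p + ?r) d = - ?r"
  proof -
    have "passable p ?r"
      using passable_sym[of "- ?r" "p + ?r"] passable_reflect(1)[OF g_enters(2) d(1,3)] that
        in_dirs_minus in_dirs_rot d(1) removed_in_R[OF g_enters(2)] by simp
    then show ?thesis using reflect_eqI[OF h_enters(2) d(1,2) in_dirs_rot[OF d(1)]] rot_neq[OF d(1)] by blast
  qed
  ultimately show thesis using that by blast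
qed

lemma parallel_removed:
  assumes h_enters: "enters h (p, d)" "p \<in> Rm" and g_enters: "enters g (p + rot d, d)" "p + rot d \<in> Rm"
    and shorter: "\<And>p' d'. strand_length (p', d') < strand_length (p, d) \<Longrightarrow> enters h (p', d') \<Longrightarrow>
      enters g (p' + rot d', d') \<Longrightarrow> p' \<in> R \<longleftrightarrow> p' + rot d' \<in> R \<Longrightarrow> reaches 2 h (m g)"
  shows "reaches 2 h (m g)"
proof -
  let ?r = "rot d"
  have d: "d \<in> dirs" by (rule enters_dirs[OF h_enters(1)])
  have R: "p \<in> R" "p + ?r \<in> R" using h_enters(2) g_enters(2) removed_in_R by blast+
  note less = strand_length_advance[OF h_enters]
  from h_enters g_enters show ?thesis
  proof (cases rule: parallel_reflect_cases)
    case right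
    then have "h = m g"
      using mate_eq_if_strands_meet[OF h enters_straight[OF h_enters right] g g_enters] rot_neq[OF d] by blast
    then show ?thesis using reaches_self by simp
  next
    case left
    then show ?thesis using shorter[OF _ parallel_bend_left[OF h_enters left g_enters(1) R(2)]] less by simp
  next
    case straight
    have "enters g (p + d + ?r, d)"
      using enters_straight[OF g_enters straight(2)] by (simp add: algebra_simps)
    then show ?thesis
      using shorter[OF _ enters_straight[OF h_enters straight(1)]] less straight(1) R_parallel[OF d R] by simp
  next
    case bend
    note bent = parallel_bend_right[OF h_enters bend(1) g_enters bend(2)]
    show ?thesis by (rule shorter[OF bent(2,1,3,4)])
  qed
qed

text \<open>Two neighbouring parallel strands go straight on or bend together; the face between them ends
  where one of them does, or where they meet.\<close>

lemma parallel:
  assumes "enters h (p, d)" "enters g (p + rot d, d)" "p \<in> R \<longleftrightarrow> p + rot d \<in> R"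
  shows "reaches 2 h (m g)"
  using assms
proof (induction "strand_length (p, d)" arbitrary: p d rule: less_induct)
  case less
  note h_enters = less.prems(1) and g_enters = less.prems(2)
  consider (outside) "p \<notin> R" "p + rot d \<notin> R"
    | (grid) "p \<in> R" "p + rot d \<in> R" "p \<in> Gd \<or> p + rot d \<in> Gd"
    | (removed) "p \<in> Rm" "p + rot d \<in> Rm" using less.prems(3) grid_iff by blast
  then show ?case
  proof cases
    case outside
    then have "f h = m g" using parallel_exit h_enters g_enters by blast
    then show ?thesis by (rule reaches_one) simp
  next
    case grid then show ?thesis using parallel_at_grid h_enters g_enters by blast
  next
    case removed
    show ?thesis by (rule parallel_removed[OF h_enters removed(1) g_enters removed(2) less.hyps])
  qed
qed

end

section \<open>Strands along the boundary\<close>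

definition first_kept :: "int \<Rightarrow> int \<Rightarrow> bool" where
  "first_kept i k \<longleftrightarrow> i \<le> k \<and> k < 2 * Lx + 2 * Ly \<and> kept (rim ! nat k) \<and>
     (\<forall>j. i \<le> j \<and> j < k \<longrightarrow> \<not> kept (rim ! nat j))"

definition reaches_rim :: "half \<Rightarrow> int \<Rightarrow> bool" where
  "reaches_rim h i \<longleftrightarrow> (\<exists>k. first_kept i k \<and> reaches 1 h (m (rim ! nat k)))"

lemma reaches_rim_skip:
  assumes "reaches_rim h (i + 1)" "\<not> kept (rim ! nat i)" shows "reaches_rim h i"
proof -
  obtain k where k: "first_kept (i + 1) k" "reaches 1 h (m (rim ! nat k))"
    using assms(1) unfolding reaches_rim_def by blast
  have "\<not> kept (rim ! nat j)" if "i \<le> j" "j < k" for j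
    using k(1) assms(2) that unfolding first_kept_def by (cases "j = i") auto
  then have "first_kept i k" using k(1) unfolding first_kept_def by auto
  then show ?thesis using k(2) unfolding reaches_rim_def by blast
qed

lemma reaches_rim_exit:
  assumes "g \<in> H" "enters g (p + rot d, rot d)" and p: "p \<in> R" "d \<in> dirs" "p + rot d \<notin> R"
    and "reaches 1 h g"
  shows "reaches_rim h (rim_index p d)"
proof -
  have mate: "m g = Half (p + rot d) (- rot d)" using enters_mate assms(2) p(3) removed_in_R by blast
  then have "m g \<in> X" using in_X_iff mate_H(1)[OF assms(1)] p(3) grid_iff by blast
  then have "kept (m g)" using mate Half_in_X_iff by metis
  moreover have "rim ! nat (rim_index p d) = m g" using rim_nth(1)[OF p] mate by simp
  ultimately have "first_kept (rim_index p d) (rim_index p d)" "m (rim ! nat (rim_index p d)) = g"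
    using rim_nth(3)[OF p] mate_H(2)[OF assms(1)] unfolding first_kept_def by auto
  then show ?thesis using assms(6) unfolding reaches_rim_def by metis
qed

lemma kept_rim_iff:
  assumes "p \<in> R" "d \<in> dirs" "p + rot d \<notin> R"
  shows "kept (rim ! nat (rim_index p d)) \<longleftrightarrow> passable p (rot d)"
  using kept_iff[of "p + rot d" "- rot d"] rim_nth(1)[OF assms] assms in_dirs_minus in_dirs_rot by simp

lemma reaches_rim_advance:
  assumes h: "h \<in> H" "enters h (p + d, d)" and d: "d \<in> dirs" and p: "p \<in> R" "p + rot d \<notin> R" "p \<noteq> (1, 1)"
    and along: "p + d \<in> R \<Longrightarrow> p + d + rot d \<notin> R \<Longrightarrow> reaches_rim h (rim_index (p + d) d)"
  shows "reaches_rim h (rim_index p d + 1)"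
proof (cases "p + d \<in> R")
  case True
  then show ?thesis using along R_parallel_border[OF d p(1,2)] rim_index_straight[OF d] by simp
next
  case False
  have "- rot d \<in> dirs" using in_dirs_minus[OF in_dirs_rot[OF d]] .
  then have "reaches_rim h (rim_index p (- rot d))"
    using reaches_rim_exit[OF h(1) _ p(1), of "- rot d" h] h(2) False reaches_self by simp
  then show ?thesis using rim_index_corner[OF p(1) d p(2) False] p(3) by simp
qed

lemma strand_along_rim_removed:
  assumes h: "h \<in> H" "enters h (p, d)" and removed: "p \<in> Rm" and outside: "p + rot d \<notin> R"
    and along: "p + rfl p d \<in> R \<Longrightarrow> p + rfl p d + rot (rfl p d) \<notin> R \<Longrightarrow>
      reaches_rim h (rim_index (p + rfl p d) (rfl p d))"
  shows "reaches_rim h (rim_index p d)"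
proof -
  have d: "d \<in> dirs" "passable p (- d)" using H_passable[OF h] by blast+
  have dirs: "rot d \<in> dirs" "- rot d \<in> dirs" using in_dirs_rot in_dirs_minus d(1) by blast+
  have p: "p \<in> R" "p \<noteq> (1, 1)" using removed removed_in_R one_one_in_grid grid_iff by blast+
  have advance: "reaches_rim h (rim_index p d' + 1)" if "rfl p d = d'" "d' \<in> dirs" "p + rot d' \<notin> R" for d'
    using reaches_rim_advance[OF h(1) _ that(2) p(1) that(3) p(2)] enters.step[OF h(2) removed] along that(1)
    by blast
  show ?thesis
  proof (cases "passable p (rot d)")
    case True
    then have "enters h (p + rot d, rot d)" using enters_turn[OF h removed dirs(1)] rot_neq[OF d(1)] by blast
    then show ?thesis using reaches_rim_exit[OF h(1) _ p(1) d(1) outside] reaches_self by blast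
  next
    case False
    have not_kept: "\<not> kept (rim ! nat (rim_index p d))" using kept_rim_iff[OF p(1) d(1) outside] False by blast
    have "rfl p d \<noteq> rot d" using passable_reflect(1)[OF removed d] False by metis
    then consider (straight) "rfl p d = d" | (left) "rfl p d = - rot d"
      using reflect_in_dirs[OF d(1), of p] dirs_eq[OF d(1)] passable_reflect(2)[OF removed d] by auto
    then have "reaches_rim h (rim_index p d + 1)"
    proof cases
      case straight then show ?thesis using advance d(1) outside by blast
    next
      case left
      then have "passable p (- rot d)" using passable_reflect(1)[OF removed d] by simp
      then have corner: "p + d \<notin> R" by (rule bend_at_corner[OF d(1) removed d(2) _ outside])
      have "\<not> passable p d" using passable_reflect(3)[OF removed d d(1)] left dirs_distinct[OF d(1)] by auto
      then have "\<not> kept (rim ! nat (rim_index p (- rot d)))" using kept_rim_iff[OF p(1) dirs(2)] corner by simp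
      moreover have "reaches_rim h (rim_index p (- rot d) + 1)" using advance[OF left dirs(2)] corner by simp
      ultimately show ?thesis
        using reaches_rim_skip rim_index_corner[OF p(1) d(1) outside corner] p(2) by (metis Pair_inject)
    qed
    then show ?thesis using reaches_rim_skip not_kept by blast
  qed
qed

lemma strand_along_rim:
  assumes h: "h \<in> H" and "enters h (p, d)" "p \<in> R" "p + rot d \<notin> R"
  shows "reaches_rim h (rim_index p d)"
  using assms(2-)
proof (induction p d rule: enters_induct)
  case (exit p d)
  then have d: "d \<in> dirs" and p: "p \<in> Gd" using enters_dirs grid_iff by blast+
  note step = face_step_grid[OF h exit(1) p]
  have "reaches 1 h (Half p (rot d))" by (rule reaches_one[OF step(1)]) simp
  then show ?case using reaches_rim_exit[OF step(2,3) exit(3) d exit(4)] by blast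
next
  case (pass p d)
  show ?case by (rule strand_along_rim_removed[OF h pass(1,2) pass.prems(2) pass.IH])
qed

lemma next_ext_first_kept:
  assumes j: "j \<in> J" "e j = rim ! nat i" "0 \<le> i" and k: "first_kept (i + 1) k"
  shows "e (nx j) = rim ! nat k"
proof -
  have "kept (rim ! nat i)" using ext_FK_in_X[OF j(1)] j(2) unfolding X_eq pendants_eq by simp
  then obtain l where "l \<in> J" "e l = rim ! nat i" "e (nx l) = rim ! nat k"
    using ext_consecutive[of i k] j(3) k unfolding first_kept_def by auto
  then show ?thesis using FK.ext_eq_iff j(1,2) by metis
qed

context
  fixes j :: nat and p d :: "int \<times> int"
  assumes j: "j \<in> J" and h: "e j = Half (p - d) d" and d: "d \<in> dirs" and p: "p \<in> R" "p - d \<notin> R"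
begin

lemma ext_at_border:
  shows "e j \<in> H" "enters (e j) (p, d)" "passable p (- d)"
    "e j = rim ! nat (rim_index p (rot d))" "0 \<le> rim_index p (rot d)"
proof -
  show H: "e j \<in> H" by (rule X_subset_H[OF ext_FK_in_X[OF j]])
  have "p - d \<notin> Rm" using p(2) removed_in_R by blast
  then show "enters (e j) (p, d)" using enters.start[of "p - d" d] d h by simp
  then show "passable p (- d)" using H_passable[OF H] by blast
  show "e j = rim ! nat (rim_index p (rot d))" "0 \<le> rim_index p (rot d)"
    using rim_nth[OF p(1) in_dirs_rot[OF d]] p(2) h by simp_all
qed

lemma boundary_walk_via_rim:
  assumes "reaches_rim g (rim_index p (rot d) + 1)" "g = e j \<or> g = f (e j)"
  shows "reaches 2 (e j) (m (e (nx j)))"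
proof -
  obtain k where k: "first_kept (rim_index p (rot d) + 1) k" "reaches 1 g (m (rim ! nat k))"
    using assms(1) unfolding reaches_rim_def by blast
  have "reaches 2 (e j) (m (rim ! nat k))"
    using k(2) assms(2) reaches_mono[of 1 "e j" _ 2] reaches_Suc[of 1 "e j"] by (auto simp: numeral_2_eq_2)
  then show ?thesis using next_ext_first_kept[OF j ext_at_border(4,5) k(1)] by simp
qed

lemma boundary_walk_first_corner:
  assumes "p = (1, 1)" "d = (1, 0)" shows "reaches 2 (e j) (m (e (nx j)))"
proof -
  have "e j = e (2 * N)" using h assms ext_last by simp
  then have "j = 2 * N" using FK.ext_eq_iff j N_pos by simp
  then have "nx j = 1" by (simp add: next_ext_def nblack_FK)
  moreover have "f (e j) = Half (1, 1) (0, -1)"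
    using face_step_grid(1)[OF ext_at_border(1,2)] one_one_in_grid assms by simp
  ultimately have "f (e j) = m (e (nx j))" using ext_first mate_ext_at_first(1) by simp
  then show ?thesis by (rule reaches_one) simp
qed

context
  assumes neighbour: "p + rot d \<in> R"
begin

lemma neighbour_border:
  "p + rot d - d \<notin> R" "rim_index (p + rot d) (rot d) = rim_index p (rot d) + 1"
  using R_parallel_border[OF in_dirs_rot[OF d] p(1)] p(2) rim_index_straight[OF in_dirs_rot[OF d]] by simp_all

lemma boundary_walk_kept:
  assumes kept: "kept (Half (p + rot d - d) d)" shows "reaches 2 (e j) (m (e (nx j)))"
proof -
  let ?g = "Half (p + rot d - d) d"
  have g: "?g \<in> H" using Half_in_H_iff neighbour neighbour_border(1) kept d by simp
  have "p + rot d - d \<notin> Rm" using neighbour_border(1) removed_in_R by blast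
  then have "enters ?g (p + rot d, d)" using enters.start[of "p + rot d - d" d] d by simp
  then have "reaches 2 (e j) (m ?g)"
    using parallel[OF ext_at_border(1) g ext_at_border(2)] p(1) neighbour by blast
  moreover have "rim ! nat (rim_index p (rot d) + 1) = ?g" "rim_index p (rot d) + 1 < 2 * Lx + 2 * Ly"
    using rim_nth[OF neighbour in_dirs_rot[OF d]] neighbour_border by simp_all
  then have "first_kept (rim_index p (rot d) + 1) (rim_index p (rot d) + 1)"
    using kept unfolding first_kept_def by auto
  then have "e (nx j) = ?g"
    using next_ext_first_kept[OF j ext_at_border(4,5)] \<open>rim ! nat (rim_index p (rot d) + 1) = ?g\<close> by simp
  ultimately show ?thesis by simp
qed

lemma boundary_walk_dropped:
  assumes dropped: "\<not> kept (Half (p + rot d - d) d)" shows "reaches 2 (e j) (m (e (nx j)))"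
proof -
  let ?r = "rot d"
  have "\<not> passable (p + ?r) (- d)" using kept_iff[of "p + ?r - d" d] neighbour neighbour_border(1) d dropped by simp
  then have blocked: "\<not> (in_square i p \<and> in_square i (p + ?r))" for i
    using passable_along_side[OF d _ _ p(2) ext_at_border(3)] by blast
  obtain g where g: "g \<in> H" "enters g (p + ?r, ?r)" "g = e j \<or> g = f (e j)"
  proof (cases "p \<in> Gd")
    case True
    then show thesis using that face_step_grid[OF ext_at_border(1,2)] by metis
  next
    case False
    then have "p \<in> Rm" using p(1) grid_iff by blast
    moreover from this have "passable p ?r"
      using passable_if_leaves_square[OF in_dirs_rot[OF d] _ _ neighbour] blocked removed_iff by blast
    ultimately have "enters (e j) (p + ?r, ?r)"
      using enters_turn[OF ext_at_border(1,2) _ in_dirs_rot[OF d]] rot_neq[OF d] by blast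
    then show thesis using that ext_at_border(1) by blast
  qed
  have "reaches_rim g (rim_index (p + ?r) ?r)"
    using strand_along_rim[OF g(1,2) neighbour] neighbour_border(1) by simp
  then show ?thesis using boundary_walk_via_rim g(3) neighbour_border(2) by metis
qed

end

end

lemma boundary_walk:
  assumes j: "j \<in> J" shows "reaches 2 (e j) (m (e (nx j)))"
proof -
  have X: "e j \<in> X" by (rule ext_FK_in_X[OF j])
  from X_subset_H[OF this] obtain q d where "e j = Half q d" "d \<in> dirs" by (rule H_start)
  moreover from this have "q \<notin> R" "q + d \<in> R" using X Half_in_X_iff by metis+
  ultimately obtain p where h: "e j = Half (p - d) d" "d \<in> dirs" "p \<in> R" "p - d \<notin> R"
    by (metis add_diff_cancel_right')
  show ?thesis
  proof (cases "p + rot d \<in> R")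
    case True then show ?thesis using boundary_walk_kept[OF j h] boundary_walk_dropped[OF j h] by blast
  next
    case False
    show ?thesis
    proof (cases "(p, rot d) = ((1, 1), (0, -1))")
      case True
      then have "d = (1, 0)" by (cases d) simp
      then show ?thesis using boundary_walk_first_corner[OF j h] True by blast
    next
      case not_first: False
      have "rim_index p d = rim_index p (rot d) + 1"
        using rim_index_corner[OF h(3) in_dirs_rot[OF h(2)] _ False not_first] h(4) by simp
      then have "reaches_rim (e j) (rim_index p (rot d) + 1)"
        using strand_along_rim[OF ext_at_border(1,2)[OF j h] h(3) False] by simp
      then show ?thesis using boundary_walk_via_rim[OF j h] by blast
    qed
  qed
qed

lemma boundary_face_FK:
  assumes j: "j \<in> J"
  shows "c (m (e j)) = m (e (nx j)) \<or> c (m (c (m (e j)))) = m (e (nx j))"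
proof -
  let ?h = "e j" and ?g = "m (e (nx j))"
  have X: "?h \<in> X" "e (nx j) \<in> X" using ext_FK_in_X[OF j] FK.ext_in_X[OF FK.next_ext_in] by blast+
  have g: "?g \<notin> X" using FK.mate_notin_X[OF X(2)] .
  have first_step: "f ?h = c (m ?h)" using FK.face_step_inner[OF FK.mate_notin_X[OF X(1)]] .
  obtain n where n: "n \<le> 2" "(f ^^ n) ?h = ?g" using boundary_walk[OF j] unfolding reaches_def by blast
  then consider (zero) "?h = ?g" | (one) "f ?h = ?g" | (two) "f (f ?h) = ?g" by (auto simp: numeral_2_eq_2 le_Suc_eq)
  then show ?thesis
  proof cases
    case zero then show ?thesis using X(1) g by metis
  next
    case one then show ?thesis using first_step by simp
  next
    case two
    then have "m (f ?h) \<notin> X" using FK.face_step_in_X_iff[OF FK.face_step_in[OF X_subset_H[OF X(1)]]] g by simp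
    then show ?thesis using two FK.face_step_inner first_step by simp
  qed
qed

section \<open>Every face has at most four sides\<close>

definition short :: "half \<Rightarrow> bool" where
  "short h \<longleftrightarrow> (\<exists>n\<in>{1..4}. (f ^^ n) h = h)"

lemma short_face_step: "h \<in> H \<Longrightarrow> short (f h) \<longleftrightarrow> short h"
  unfolding short_def using funpow_eq_self_in_orbit FK.face_sym[OF _ orbit.base] orbit.base by metis

lemma short_if_reaches:
  assumes "reaches 2 h g" "f g = h \<or> f (f g) = h" shows "short h"
proof -
  obtain n where n: "n \<le> 2" "(f ^^ n) h = g" using assms(1) unfolding reaches_def by blast
  from assms(2) have "(f ^^ Suc n) h = h \<or> (f ^^ Suc (Suc n)) h = h" using n(2) by simp
  moreover have "Suc n \<in> {1..4}" "Suc (Suc n) \<in> {1..4}" using n(1) by auto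
  ultimately show ?thesis unfolding short_def by blast
qed

lemma short_ext:
  assumes "h \<in> X" shows "short h"
proof -
  obtain j where "j \<in> J" "h = e j" using assms unfolding ext_halves_def nblack_FK by blast
  then show ?thesis using short_if_reaches[OF boundary_walk] FK.face_step_mate_ext by blast
qed

lemma grid_strand:
  assumes "p \<in> Gd" "d \<in> dirs"
  shows "Half p d \<in> H" "enters (Half p d) (p + d, d)" "f (m (Half p d)) = Half p (- rot d)"
proof -
  show H: "Half p d \<in> H" by (rule Half_in_H_if_grid[OF assms])
  show "enters (Half p d) (p + d, d)" using enters.start assms grid_iff by blast
  show "f (m (Half p d)) = Half p (- rot d)"
    using FK.face_step_mate_inner[OF H] in_X_iff[OF H refl] assms(1) ccw_in_grid by simp
qed

lemma short_along_edge:
  assumes p: "p \<in> Gd" "p + rot d \<in> Gd" and d: "d \<in> dirs" shows "short (Half p d)"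
proof -
  let ?g = "Half (p + rot d) d"
  have left_dir: "- rot d \<in> dirs" using d in_dirs_rot in_dirs_minus by blast
  have "p + d \<in> R \<longleftrightarrow> p + d + rot d \<in> R" using R_parallel[OF d] p grid_iff by blast
  moreover have "enters ?g (p + d + rot d, d)" using grid_strand(2)[OF p(2) d] by (simp add: algebra_simps)
  ultimately have "reaches 2 (Half p d) (m ?g)"
    using parallel[OF grid_strand(1)[OF p(1) d] grid_strand(1)[OF p(2) d] grid_strand(2)[OF p(1) d]] by blast
  moreover have "f (f (m ?g)) = Half p d"
    using grid_strand(3)[OF p(2) d] face_step_grid(1)[OF grid_strand(1,2)[OF p(2) left_dir]] p(1) by simp
  ultimately show ?thesis using short_if_reaches by blast
qed

lemma reaches_between_removed:
  assumes p: "p \<in> Gd" and d: "d \<in> dirs" and removed: "p + d \<in> Rm" "p + rot d \<in> Rm"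
  shows "reaches 2 (Half p d) (m (Half p (rot d)))"
proof -
  let ?h = "Half p d" and ?r = "rot d"
  let ?g = "Half p ?r"
  have r: "?r \<in> dirs" using in_dirs_rot[OF d] .
  note h = grid_strand(1,2)[OF p d] and g = grid_strand(1,2)[OF p r]
  have R: "p + d \<in> R" "p + ?r \<in> R" "p + d + ?r \<in> R"
    using removed removed_in_R R_parallel[OF d] p grid_iff by blast+
  consider (left) "passable (p + ?r) d" | (right) "passable (p + d) ?r"
    | (blocked) "\<not> passable (p + ?r) d" "\<not> passable (p + d) ?r" by blast
  then show ?thesis
  proof cases
    case left
    then have "enters ?g (p + d + ?r, d)"
      using enters_turn[OF g removed(2) d] dirs_distinct[OF d] by (auto simp: algebra_simps)
    then show ?thesis using parallel[OF h(1) g(1) h(2)] R by blast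
  next
    case right
    then have "enters ?h (p + d + ?r, ?r)"
      using enters_turn[OF h removed(1) r] dirs_distinct[OF d] by auto
    then show ?thesis
      using parallel[OF h(1) g(1), of "p + d + ?r" ?r] g(2) R by (simp add: algebra_simps)
  next
    case blocked
    obtain i k where "in_square i (p + ?r)" "in_square k (p + d)" using removed removed_iff by blast
    moreover from this have "in_square i (p + d + ?r)" "in_square k (p + d + ?r)"
      using passable_if_leaves_square[OF d, of i "p + ?r"] passable_if_leaves_square[OF r, of k "p + d"]
        blocked R by (auto simp: algebra_simps)
    ultimately have "in_square i p" using in_square_product[OF d] square_unique by blast
    then show ?thesis using p grid_iff removed_iff by blast
  qed
qed

lemma short_grid:
  assumes p: "p \<in> Gd" and d: "d \<in> dirs" shows "short (Half p d)"
proof -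
  let ?h = "Half p d" and ?r = "rot d"
  let ?g = "Half p ?r"
  have r: "?r \<in> dirs" using in_dirs_rot[OF d] .
  note h = grid_strand[OF p d] and g = grid_strand[OF p r]
  have closing: "f (m ?g) = ?h" using g(3) by simp
  consider (ahead_outside) "p + d \<notin> R" | (right_outside) "p + ?r \<notin> R" | (right_grid) "p + ?r \<in> Gd"
    | (ahead_grid) "p + d \<in> Gd" | (removed) "p + d \<in> Rm" "p + ?r \<in> Rm" using grid_iff by blast
  then show ?thesis
  proof cases
    case ahead_outside
    then have "m ?h \<in> X" using enters_mate[OF h(2)] in_X_iff mate_H(1)[OF h(1)] removed_in_R grid_iff by blast
    then have "f ?h \<in> X" using FK.face_step_in_X_iff[OF h(1)] by blast
    then show ?thesis using short_ext short_face_step[OF h(1)] by blast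
  next
    case right_outside
    then have "m ?g \<in> X" using enters_mate[OF g(2)] in_X_iff mate_H(1)[OF g(1)] removed_in_R grid_iff by blast
    then show ?thesis using short_ext short_face_step[OF mate_H(1)[OF g(1)]] closing by metis
  next
    case right_grid then show ?thesis using short_along_edge p d by blast
  next
    case ahead_grid
    then have "short (Half (p + d) ?r)" using short_along_edge[OF ahead_grid _ r] p by simp
    then show ?thesis using face_step_grid(1)[OF h(1,2) ahead_grid] short_face_step[OF h(1)] by metis
  next
    case removed
    then show ?thesis using short_if_reaches reaches_between_removed[OF p d] closing by blast
  qed
qed

lemma face_period_FK:
  assumes "h \<in> H" shows "\<exists>n\<in>{1..4}. (f ^^ n) h = h"
proof -
  have "short h" using assms by (cases rule: H_cases) (use short_grid short_ext in auto)
  then show ?thesis unfolding short_def .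
qed

section \<open>Connectedness\<close>

definition southwest :: "int \<times> int \<Rightarrow> int \<times> int \<Rightarrow> bool" where
  "southwest p d \<longleftrightarrow> d \<in> {(-1, 0), (0, -1)} \<and> p \<in> R \<and> \<not> in_square 3 p"

lemma southwest_step:
  assumes "p \<in> R" "\<not> in_square 3 p" "d \<in> {(-1, 0), (0, -1)}" "p + d \<in> R" shows "southwest (p + d) d"
proof -
  have "in_square 3 p" if square: "in_square 3 (p + d)"
  proof -
    have "d = - outward 3 \<or> d = - rot (outward 3)" using assms(3) by (auto simp: outward_def)
    then show ?thesis
      using square outer_neighbour_in_R_iff[OF square] assms(1) by (auto simp: in_square_def)
  qed
  then show ?thesis using assms unfolding southwest_def by blast
qed

lemma southwest_reflect:
  assumes "southwest p d" "p \<in> Rm" "passable p (- d)" shows "southwest (p + rfl p d) (rfl p d)"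
proof -
  have d: "d \<in> dirs" "d \<in> {(-1, 0), (0, -1)}" and p: "p \<in> R" "\<not> in_square 3 p"
    using assms(1) by (auto simp: southwest_def dirs_def)
  obtain i where i: "in_square i p" using assms(2) removed_iff by blast
  then have "i = 2 \<or> i = 4" using in_square_index[OF i] p(2) by auto
  then have inflow: "inflow i = {(-1, 0), (0, -1)}" by (auto simp: inflow_def outward_def)
  then have reflected: "rfl p d \<in> {(-1, 0), (0, -1)}" using reflect_in_inflow[OF i d(1) _ assms(3)] d(2) by simp
  have "inward (p + rfl p d) (rfl p d)"
    using inward_reflect[OF _ assms(2) d(1) assms(3)] i inflow d(2) unfolding inward_def by blast
  then have "p + rfl p d \<in> R" using grid_iff in_square_in_R unfolding inward_def by blast
  then show ?thesis using southwest_step[OF p reflected] by blast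
qed

lemma southwest_strand:
  assumes "h \<in> H" "enters h (p, d)" "southwest p d"
  shows "\<exists>q e. q \<in> Gd \<and> e \<in> dirs \<and> m h = Half q e \<and> fst q + snd q \<le> fst p + snd p"
  using assms(2,3)
proof (induction p d rule: enters_induct)
  case (exit p d)
  then have "p \<in> Gd" "- d \<in> dirs" "m h = Half p (- d)"
    using enters_mate enters_dirs in_dirs_minus grid_iff unfolding southwest_def by blast+
  then show ?case by blast
next
  case (pass p d)
  then have next_step: "southwest (p + rfl p d) (rfl p d)"
    using southwest_reflect H_passable[OF assms(1) pass(1)] by blast
  then have "fst (p + rfl p d) + snd (p + rfl p d) < fst p + snd p" by (auto simp: southwest_def)
  then show ?case using pass.IH[OF next_step] by force
qed

lemma southwest_neighbour:
  assumes p: "p \<in> Gd" "p \<noteq> (1, 1)"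
  obtains d q e where "d \<in> dirs" "q \<in> Gd" "e \<in> dirs" "m (Half p d) = Half q e" "fst q + snd q < fst p + snd p"
proof -
  obtain x y where "p = (x, y)" by (cases p)
  then have "p + (if x = 1 then (0, -1) else (-1, 0)) \<in> R" using p grid_iff[of p] by (auto simp: R_iff)
  then obtain d where d: "d \<in> {(-1, 0), (0, -1)}" "p + d \<in> R" by (metis insertCI)
  then have dirs: "d \<in> dirs" by (auto simp: dirs_def)
  have "southwest (p + d) d" using southwest_step[OF _ _ d] p(1) grid_iff removed_iff by blast
  from southwest_strand[OF grid_strand(1,2)[OF p(1) dirs] this] obtain q e where
    "q \<in> Gd" "e \<in> dirs" "m (Half p d) = Half q e" "fst q + snd q \<le> fst (p + d) + snd (p + d)" by blast
  moreover from this have "fst q + snd q < fst p + snd p" using d(1) by auto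
  ultimately show thesis using that dirs by blast
qed

lemma connected_FK:
  assumes invariant: "\<And>h. h \<in> H \<Longrightarrow> \<chi> (m h) = \<chi> h \<and> \<chi> (c h) = (\<chi> h :: bool)" and hg: "h \<in> H" "g \<in> H"
  shows "\<chi> g = \<chi> h"
proof -
  let ?root = "Half (1, 1) (0, -1)"
  have vertex: "\<chi> (Half p d') = \<chi> (Half p d)" if p: "p \<in> Gd" and d: "d \<in> dirs" "d' \<in> dirs" for p d d'
  proof -
    have step: "\<chi> (Half p (- rot d)) = \<chi> (Half p d)" if "d \<in> dirs" for d
      using invariant[OF Half_in_H_if_grid[OF p that]] ccw_in_grid[OF p] by simp
    have "\<chi> (Half p (- rot d)) = \<chi> (Half p d)" "\<chi> (Half p d) = \<chi> (Half p (rot d))"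
      "\<chi> (Half p (rot d)) = \<chi> (Half p (- d))"
      using step[OF d(1)] step[OF in_dirs_rot[OF d(1)]] step[OF in_dirs_minus[OF d(1)]] by simp_all
    then show ?thesis using d(2) unfolding dirs_eq[OF d(1)] by auto
  qed
  have grid: "\<chi> (Half p d) = \<chi> ?root" if "p \<in> Gd" "d \<in> dirs" for p d
    using that
  proof (induction "nat (fst p + snd p)" arbitrary: p d rule: less_induct)
    case less
    show ?case
    proof (cases "p = (1, 1)")
      case True then show ?thesis using vertex[OF one_one_in_grid _ less.prems(2)] by (simp add: dirs_def)
    next
      case False
      obtain d' q e where q: "d' \<in> dirs" "q \<in> Gd" "e \<in> dirs" "m (Half p d') = Half q e"
        "fst q + snd q < fst p + snd p" by (rule southwest_neighbour[OF less.prems(1) False])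
      have "0 < fst p + snd p" using less.prems(1) grid_iff by (cases p) (auto simp: R_iff)
      then have "\<chi> (Half q e) = \<chi> ?root" using less.hyps[OF _ q(2,3)] q(5) by simp
      then have "\<chi> (Half p d') = \<chi> ?root"
        using invariant[OF Half_in_H_if_grid[OF less.prems(1) q(1)]] q(4) by simp
      then show ?thesis using vertex[OF less.prems(1) q(1) less.prems(2)] by simp
    qed
  qed
  have inner: "\<chi> h = \<chi> ?root" if "h \<in> H" "h \<notin> X" for h
    using that(1) by (cases rule: H_cases) (use that(2) grid in auto)
  have "\<chi> h = \<chi> ?root" if "h \<in> H" for h
    using inner[OF that] inner[OF mate_H(1)[OF that] mate_H(3)[OF that]] invariant[OF that] by metis
  then show ?thesis using hg by metis
qed

end

section \<open>Planarity\<close>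

lemma even_card_upto:
  fixes i :: int assumes "1 \<le> i"
  shows "even (card {x. 1 \<le> x \<and> x \<le> i \<and> P x}) \<longleftrightarrow> (even (card {x. 1 \<le> x \<and> x \<le> i - 1 \<and> P x}) \<noteq> P i)"
proof -
  have "finite {x. 1 \<le> x \<and> x \<le> i - 1 \<and> P x}" by (rule finite_subset[of _ "{1..i}"]) auto
  moreover have "{x. 1 \<le> x \<and> x \<le> i \<and> P x} =
      (if P i then insert i {x. 1 \<le> x \<and> x \<le> i - 1 \<and> P x} else {x. 1 \<le> x \<and> x \<le> i - 1 \<and> P x})"
    using assms by (auto simp: order.order_iff_strict)
  ultimately show ?thesis by simp
qed

text \<open>A cycle, extended by the edges of the full rectangle that its strands follow, is crossed an even
  number of times by every closed lattice path.  Counting the crossings from the bottom-left corner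
  therefore tells on which side of the cycle a cell lies.\<close>

locale dihedral_cycle = dihedral +
  fixes C :: "half set"
  assumes C_subset: "C \<subseteq> H" and C_mate: "\<And>h. h \<in> C \<Longrightarrow> m h \<in> C"
    and C_even: "\<And>h. h \<in> H - X \<Longrightarrow> even (card (C \<inter> vertex_of FK h))"
begin

definition crossed :: "int \<times> int \<Rightarrow> int \<times> int \<Rightarrow> bool" where
  "crossed p d \<longleftrightarrow> (\<exists>h\<in>C. enters h (p + d, d))"

lemma crossed_sym: "crossed (p + d) (- d) \<longleftrightarrow> crossed p d"
proof -
  have reverse: "crossed (p + d) (- d)" if "crossed p d" for p d
    using that C_mate enters_reverse[of _ "p + d" d] unfolding crossed_def by fastforce
  show ?thesis using reverse[of p d] reverse[of "p + d" "- d"] by auto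
qed

lemma crossed_iff_in_C: "p \<notin> Rm \<Longrightarrow> d \<in> dirs \<Longrightarrow> crossed p d \<longleftrightarrow> Half p d \<in> C"
  using enters.start[of p d] unfolding crossed_def by (auto elim: enters_cases)

lemma crossed_passable:
  assumes "crossed p d" shows "passable p d"
proof -
  obtain h where h: "h \<in> C" "enters h (p + d, d)" using assms unfolding crossed_def by blast
  then have "live h" using C_subset H_start by blast
  then show ?thesis using live_passable_behind[OF h(2)] by simp
qed

lemma crossed_even_grid:
  assumes p: "p \<in> Gd"
  shows "(crossed p (0, -1) = crossed p (1, 0)) = (crossed p (0, 1) = crossed p (-1, 0))"
proof -
  let ?h = "Half p (0, -1)"
  have d: "(0, -1) \<in> dirs" "(1, 0) \<in> dirs" "(0, 1) \<in> dirs" "(-1, 0) \<in> dirs" by (simp_all add: dirs_def)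
  have h: "?h \<in> H" "?h \<notin> X" using Half_in_H_if_grid[OF p d(1)] in_X_iff p by blast+
  note vertex = vertex_of_quartic[OF quartic_in_grid[OF h], unfolded ccw_FK ccw_in_grid[OF p]]
  have "even (card {g \<in> vertex_of FK ?h. g \<in> C})" using C_even[of ?h] h by (simp add: Int_def conj_commute)
  then have "(?h \<in> C \<longleftrightarrow> Half p (1, 0) \<in> C) = (Half p (0, 1) \<in> C \<longleftrightarrow> Half p (-1, 0) \<in> C)"
    using card_filter_four(2)[OF vertex(2), of "\<lambda>g. g \<in> C"] unfolding vertex(1) by simp
  then show ?thesis using crossed_iff_in_C d p grid_iff by simp
qed

lemma crossed_removed_iff:
  assumes p: "p \<in> Rm" and h: "h \<in> C" "enters h (p, d)" and d': "d' \<in> dirs"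
  shows "crossed p d' \<longleftrightarrow> d' = - d \<or> d' = rfl p d"
proof -
  have d: "d \<in> dirs" "passable p (- d)" using H_passable h C_subset by blast+
  have "crossed p (rfl p d)" using enters.step[OF h(2) p] h(1) unfolding crossed_def by blast
  moreover have "crossed (p - d) d" using h unfolding crossed_def by auto
  then have "crossed p (- d)" using crossed_sym[of "p - d" d] by simp
  ultimately show ?thesis using crossed_passable passable_reflect(3)[OF p d d'] by blast
qed

lemma crossed_even:
  assumes "p \<in> R"
  shows "(crossed p (0, -1) = crossed p (1, 0)) = (crossed p (0, 1) = crossed p (-1, 0))"
proof (cases "p \<in> Rm")
  case False then show ?thesis using crossed_even_grid assms grid_iff by blast
next
  case p: True
  show ?thesis
  proof (cases "\<exists>e\<in>dirs. crossed p e")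
    case False then show ?thesis by (simp add: dirs_def)
  next
    case True
    then obtain e h where h: "h \<in> C" "enters h (p + e, e)" unfolding crossed_def by blast
    from h(2) obtain d where d: "enters h (p, d)" by (cases rule: enters_cases) (use p in auto)
    then have "d \<in> dirs" "rfl p d \<in> dirs" "rfl p d \<noteq> - d"
      using reflect_in_dirs passable_reflect(2)[OF p] H_passable h(1) C_subset by blast+
    moreover have "crossed p (0, -1) \<longleftrightarrow> (0, -1) = - d \<or> (0, -1) = rfl p d"
      "crossed p (1, 0) \<longleftrightarrow> (1, 0) = - d \<or> (1, 0) = rfl p d"
      "crossed p (0, 1) \<longleftrightarrow> (0, 1) = - d \<or> (0, 1) = rfl p d"
      "crossed p (-1, 0) \<longleftrightarrow> (-1, 0) = - d \<or> (-1, 0) = rfl p d"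
      by (rule crossed_removed_iff[OF p h(1) d]; simp add: dirs_def)+
    ultimately show ?thesis unfolding dirs_def by (elim insertE emptyE; simp)
  qed
qed

text \<open>The cell with corners \<open>(i, j)\<close> and \<open>(i + 1, j + 1)\<close> is reached from the one at \<open>(0, 0)\<close> by \<open>j\<close> steps
  up and \<open>i\<close> steps to the right.\<close>

definition cell_side :: "int \<Rightarrow> int \<Rightarrow> bool" where
  "cell_side i j \<longleftrightarrow> (even (card {x. 1 \<le> x \<and> x \<le> i \<and> crossed (x, j) (0, 1)}) =
    even (card {y. 1 \<le> y \<and> y \<le> j \<and> crossed (0, y) (1, 0)}))"

lemma cell_side_right:
  assumes "1 \<le> i" shows "cell_side (i - 1) j \<noteq> cell_side i j \<longleftrightarrow> crossed (i, j) (0, 1)"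
  unfolding cell_side_def even_card_upto[OF assms, of "\<lambda>x. crossed (x, j) (0, 1)"] by blast

lemma cell_side_up:
  assumes "0 \<le> i" "i \<le> Lx" "1 \<le> j" "j \<le> Ly"
  shows "cell_side i (j - 1) \<noteq> cell_side i j \<longleftrightarrow> crossed (i, j) (1, 0)"
  using assms(1,2)
proof (induction i rule: int_ge_induct)
  case base
  have empty: "{x. 1 \<le> x \<and> x \<le> (0 :: int) \<and> crossed (x, j') (0, 1)} = {}" for j' by auto
  show ?case unfolding cell_side_def even_card_upto[OF assms(3), of "\<lambda>y. crossed (0, y) (1, 0)"] empty by auto
next
  case (step i)
  have "cell_side i (j - 1) \<noteq> cell_side (i + 1) (j - 1) \<longleftrightarrow> crossed (i + 1, j) (0, -1)"
    using cell_side_right[of "i + 1" "j - 1"] crossed_sym[of "(i + 1, j - 1)" "(0, 1)"] step.hyps by simp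
  moreover have "cell_side i j \<noteq> cell_side (i + 1) j \<longleftrightarrow> crossed (i + 1, j) (0, 1)"
    using cell_side_right[of "i + 1" j] step.hyps by simp
  moreover have "cell_side i (j - 1) \<noteq> cell_side i j \<longleftrightarrow> crossed (i + 1, j) (-1, 0)"
    using step.IH step.prems crossed_sym[of "(i, j)" "(1, 0)"] by simp
  moreover have "(i + 1, j) \<in> R" using step assms(3,4) by (simp add: R_iff)
  ultimately show ?case using crossed_even[of "(i + 1, j)"] by argo
qed

text \<open>The cell on the right of a step from \<open>p\<close> in direction \<open>d\<close>.\<close>

definition right_side :: "int \<times> int \<Rightarrow> int \<times> int \<Rightarrow> bool" where
  "right_side p d = cell_side (fst p + (fst d + snd d - 1) div 2) (snd p + (snd d - fst d - 1) div 2)"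

lemma right_side_move:
  assumes "d \<in> dirs" shows "right_side (p - d) d = right_side p (rot d)"
  using assms by (cases p; cases rule: dirs_cases) (simp_all add: right_side_def)

lemma right_side_rot:
  assumes "p \<in> R" "d \<in> dirs" shows "right_side p d \<noteq> right_side p (rot d) \<longleftrightarrow> crossed p (rot d)"
proof -
  obtain x y where p: "p = (x, y)" by (cases p)
  have bounds: "1 \<le> x" "x \<le> Lx" "1 \<le> y" "y \<le> Ly" using assms(1) unfolding p R_iff by auto
  have "cell_side x (y - 1) \<noteq> cell_side x y \<longleftrightarrow> crossed (x, y) (1, 0)"
    "cell_side (x - 1) (y - 1) \<noteq> cell_side (x - 1) y \<longleftrightarrow> crossed (x, y) (-1, 0)"
    "cell_side (x - 1) y \<noteq> cell_side x y \<longleftrightarrow> crossed (x, y) (0, 1)"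
    "cell_side (x - 1) (y - 1) \<noteq> cell_side x (y - 1) \<longleftrightarrow> crossed (x, y) (0, -1)"
    using cell_side_up[of x y] cell_side_up[of "x - 1" y] cell_side_right[of x y] cell_side_right[of x "y - 1"]
      crossed_sym[of "(x, y - 1)" "(0, 1)"] crossed_sym[of "(x - 1, y)" "(1, 0)"] bounds by simp_all
  with assms(2) show ?thesis by (cases rule: dirs_cases) (auto simp: right_side_def p)
qed

fun side :: "half \<Rightarrow> bool" where
  "side (Half p d) = right_side p d" | "side (Mid p d) = False"

lemma right_side_reflect:
  assumes p: "p \<in> Rm" and d: "d \<in> dirs" "passable p (- d)" shows "right_side p (rfl p d) = right_side p (rot d)"
proof -
  have R: "p \<in> R" by (rule removed_in_R[OF p])
  have uncrossed: "\<not> crossed p d'" if "d' \<in> dirs" "d' \<noteq> - d" "d' \<noteq> rfl p d" for d'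
    using crossed_passable passable_reflect(3)[OF p d that(1)] that by blast
  have dirs: "rot d \<in> dirs" "- rot d \<in> dirs" using d(1) in_dirs_rot in_dirs_minus by blast+
  have right: "right_side p d = right_side p (rot d)" if "rfl p d \<noteq> rot d"
    using right_side_rot[OF R d(1)] uncrossed[OF dirs(1)] that dirs_distinct[OF d(1)] by auto
  have left: "right_side p (- rot d) = right_side p d" if "rfl p d \<noteq> d"
    using right_side_rot[OF R dirs(2)] uncrossed[OF d(1)] that dirs_distinct[OF d(1)] by auto
  have "rfl p d \<in> {d, rot d, - rot d}"
    using reflect_in_dirs[OF d(1), of p] passable_reflect(2)[OF p d] unfolding dirs_eq[OF d(1)] by blast
  then show ?thesis using right left dirs_distinct[OF d(1)] by auto
qed

lemma side_along_strand:
  assumes "h \<in> H" "enters h (p, d)" shows "right_side p (rot d) = side h"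
  using assms(2,1)
proof (induction h "(p, d)" arbitrary: p d rule: enters.induct)
  case (start q d) then show ?case using right_side_move[of d "q + d"] by simp
next
  case (step h p d)
  have d: "d \<in> dirs" "passable p (- d)" using H_passable step by blast+
  show ?case
    using right_side_move[of "rfl p d" "p + rfl p d"] reflect_in_dirs[OF d(1)]
      right_side_reflect[OF step(3) d] step by simp
qed

lemma side_mate:
  assumes h: "h \<in> H" and mate: "m h \<notin> X"
  shows "side (c (m h)) = side h" "side (m h) \<noteq> side h \<longleftrightarrow> h \<in> C"
proof -
  obtain q d where q: "h = Half q d" "d \<in> dirs" "q \<notin> Rm" by (rule H_start[OF h])
  obtain p e where p: "enters h (p, e)" "p \<notin> Rm" "e \<in> dirs" "m h = Half p (- e)"
    using first_mate_obtain[OF q(3,2)] q(1) by metis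
  have grid: "p \<in> Gd" using in_X_iff[OF mate_H(1)[OF h] p(4)] mate by blast
  have along: "right_side p (rot e) = side h" by (rule side_along_strand[OF h p(1)])
  show "side (c (m h)) = side h" using along by (simp add: p(4) ccw_in_grid[OF grid])
  have "right_side p (rot e) \<noteq> right_side p (- e) \<longleftrightarrow> crossed p (- e)"
    using right_side_rot[OF _ in_dirs_rot[OF p(3)]] grid grid_iff by simp
  moreover have "crossed p (- e) \<longleftrightarrow> m h \<in> C" using crossed_iff_in_C[OF p(2) in_dirs_minus[OF p(3)]] p(4) by simp
  moreover have "m h \<in> C \<longleftrightarrow> h \<in> C" using C_mate mate_H(2)[OF h] by metis
  ultimately show "side (m h) \<noteq> side h \<longleftrightarrow> h \<in> C" using along by (auto simp: p(4))
qed

lemma bounds_side: "bounds FK C side"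
proof -
  have "side (m h) \<noteq> side h \<longleftrightarrow> h \<in> C" if h: "h \<in> H" for h
  proof (cases "m h \<in> X")
    case False then show ?thesis by (rule side_mate(2)[OF h])
  next
    case True
    have "side (m (m h)) \<noteq> side (m h) \<longleftrightarrow> m h \<in> C"
      by (rule side_mate(2)[OF mate_H(1)[OF h] mate_H(3)[OF mate_H(1)[OF h] True]])
    then show ?thesis using C_mate mate_H(2)[OF h] by metis
  qed
  then show ?thesis unfolding bounds_def ccw_FK mate_FK using side_mate(1) by blast
qed

end

context dihedral begin

section \<open>Domains of the first kind are plane\<close>

lemma half_parity_ccw:
  assumes "h \<in> H - X" shows "half_parity (c h) \<longleftrightarrow> \<not> half_parity h"
proof -
  have "h \<in> H" using assms by blast
  then show ?thesis
  proof (cases rule: H_cases)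
    case (inner p d)
    from inner(3) show ?thesis
      using inner(1,2) by (cases p; cases rule: dirs_cases) (simp_all add: ccw_in_grid)
  next
    case external then show ?thesis using assms by blast
  qed
qed

lemma corner_FK: "c (m (e (2 * N))) = m (e 1)"
  using ccw_in_grid[OF one_one_in_grid, of "(-1, 0)"] by (simp only: ext_first ext_last mate_ext_at_first) simp

lemma puncture_FK: "puncture_ok FK"
proof -
  let ?S = "small_face_halves (first_kind_map Lx Ly a)"
  have puncture: "puncture FK = (if ?S = {} then Unpunctured else In_Face (SOME h. h \<in> ?S))"
    by (simp add: first_kind_def Let_def)
  show ?thesis
  proof (cases "?S = {}")
    case True then show ?thesis using quartic_in_grid unfolding puncture_ok_def puncture by auto
  next
    case False
    define p where "p = (SOME h. h \<in> ?S)"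
    have "p \<in> ?S" unfolding p_def using False by (simp add: some_in_eq)
    then have p: "p \<in> H" "inner_face FK (face_of FK p)" "card (face_of FK p) \<le> 2"
      unfolding small_face_halves_def inner_face_def face_of_def ext_halves_def
      by (simp_all add: first_kind_def first_kind_map_def Let_def)
    note face = FK.inner_face_of[OF p(1,2)]
    have "f p \<in> FK.face p" "p \<in> FK.face p" by (rule orbit.base, rule FK.self_in_face[OF p(1)])
    moreover have "\<exists>n\<in>{1..2}. (f ^^ n) p = p"
      by (rule FK.period_if_invariant[of p "FK.face p"])
        (use p(3) face(1) FK.self_in_face[OF p(1)] FK.face_subset_H[OF p(1)] in \<open>auto intro: orbit.step\<close>)
    then have "f (f p) = p" by (auto simp: numeral_2_eq_2 le_Suc_eq)
    ultimately show ?thesis using quartic_in_grid p(1) face(2) False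
      unfolding puncture_ok_def puncture p_def[symmetric] by auto
  qed
qed

theorem plane_domain_FK: "plane_domain FK half_parity"
proof (rule plane_domain.intro[OF disk_map_FK plane_domain_axioms.intro], unfold ccw_FK mate_FK nblack_FK)
  show "half_parity (m h) \<longleftrightarrow> \<not> half_parity h" if "h \<in> H" for h
    using H_start[OF that] half_parity_first_mate by metis
  show "\<exists>\<chi>. bounds FK C \<chi>" if "C \<subseteq> H" "\<And>h. h \<in> C \<Longrightarrow> m h \<in> C"
    "\<And>h. h \<in> H - X \<Longrightarrow> even (card (C \<inter> vertex_of FK h))" for C
  proof -
    interpret dihedral_cycle Lx Ly a C by unfold_locales (use that in blast)+
    show ?thesis using bounds_side by blast
  qed
  show "\<chi> g = \<chi> h" if "\<And>h. h \<in> H \<Longrightarrow> \<chi> (m h) = \<chi> h \<and> \<chi> (c h) = \<chi> h" "h \<in> H" "g \<in> H"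
    for \<chi> :: "half \<Rightarrow> bool" and h g by (rule connected_FK[OF that])
qed (use half_parity_ccw boundary_face_FK face_period_FK corner_FK puncture_FK in blast)+

end

section \<open>Subdividing an edge\<close>

locale subdivision = plane_domain +
  fixes h :: half
  assumes h: "h \<in> H"
    and fresh: "mid h \<notin> H" "mid (m h) \<notin> H" "mid h \<noteq> mid (m h)"
    and par_mid: "par (mid h) \<longleftrightarrow> \<not> par h" "par (mid (m h)) \<longleftrightarrow> \<not> par (m h)"
    and all_quartic: "\<And>x. x \<in> H - X \<Longrightarrow> quartic \<Lambda> x"
    and inner: "\<And>x. x \<in> {h, m h} \<Longrightarrow> face x \<inter> X = {}"
    and sides: "\<And>x. x \<in> {h, m h} \<Longrightarrow> card (face x) \<le> 3"
begin

abbreviation "g \<equiv> m h"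
abbreviation "h' \<equiv> mid h"
abbreviation "g' \<equiv> mid g"
abbreviation "\<Lambda>' \<equiv> subdivide \<Lambda> h"
abbreviation "H' \<equiv> half_edges \<Lambda>'"
abbreviation "c' \<equiv> ccw \<Lambda>'"
abbreviation "m' \<equiv> mate \<Lambda>'"
abbreviation "f' \<equiv> face_step \<Lambda>'"

lemma g: "g \<in> H" "m g = h" "g \<noteq> h" "par g \<longleftrightarrow> \<not> par h"
  using mate_in[OF h] mate_mate[OF h] par_mate[OF h] by auto

lemma notin_X: "h \<notin> X" "g \<notin> X" "h' \<notin> X" "g' \<notin> X"
  using inner[of h] inner[of g] self_in_face h g(1) fresh X_subset_H by blast+

lemma fresh_neq: "h' \<noteq> h" "h' \<noteq> g" "g' \<noteq> h" "g' \<noteq> g"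
  using fresh h g(1) by auto

lemma subdivide_simps:
  "H' = H \<union> {h', g'}" "c' = c(h' := g', g' := h')" "m' = m(h := h', h' := h, g := g', g' := g)"
  "nblack \<Lambda>' = N" "ext \<Lambda>' = e" "puncture \<Lambda>' = At_Vertex h'" "next_ext \<Lambda>' = nx" "ext_halves \<Lambda>' = X"
  "prev_ext \<Lambda>' = prev_ext \<Lambda>"
  by (auto simp: subdivide_def Let_def next_ext_def ext_halves_def prev_ext_def fun_eq_iff)

lemma ccw_old: "x \<in> H \<Longrightarrow> c' x = c x"
  using fresh unfolding subdivide_simps by auto

lemma ccw_new: "c' h' = g'" "c' g' = h'"
  using fresh(3) unfolding subdivide_simps by auto

lemma mate_old: "x \<in> H \<Longrightarrow> x \<noteq> h \<Longrightarrow> x \<noteq> g \<Longrightarrow> m' x = m x"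
  using fresh unfolding subdivide_simps by auto

lemma mate_new: "m' h = h'" "m' h' = h" "m' g = g'" "m' g' = g"
  using fresh fresh_neq g(3) unfolding subdivide_simps by auto

lemma mate_old_neq: "x \<in> H \<Longrightarrow> x \<noteq> h \<Longrightarrow> x \<noteq> g \<Longrightarrow> m x \<noteq> h \<and> m x \<noteq> g"
  using mate_mate g(2) by metis

lemma mate_X: "x \<in> X \<Longrightarrow> m' x = m x"
  using mate_old X_subset_H notin_X by blast

lemma half_cases:
  assumes "x \<in> H'"
  obtains (new_h) "x = h'" | (new_g) "x = g'" | (h) "x = h" | (g) "x = g" | (old) "x \<in> H" "x \<noteq> h" "x \<noteq> g"
  using assms unfolding subdivide_simps by blast

lemma quartic_old: "quartic \<Lambda> x \<Longrightarrow> x \<in> H \<Longrightarrow> quartic \<Lambda>' x"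
  using ccw_old ccw_in unfolding quartic_def by metis

lemma bivalent_new: "bivalent \<Lambda>' h'" "bivalent \<Lambda>' g'"
  unfolding bivalent_def ccw_new using fresh(3) by auto

lemma disk_map_subdivide: "disk_map \<Lambda>'"
proof (rule disk_map.intro, unfold subdivide_simps(4,5,8))
  have in_H': "x \<in> H'" if "x \<in> H \<or> x = h' \<or> x = g'" for x using that unfolding subdivide_simps by blast
  show "finite H'" unfolding subdivide_simps using finite_halves by simp
  show "m' x \<in> H'" if "x \<in> H'" for x
    using that by (cases rule: half_cases) (use mate_new mate_old mate_in h g(1) in_H' in auto)
  show "m' (m' x) = x" if "x \<in> H'" for x
    using that by (cases rule: half_cases) (simp_all add: mate_new mate_old mate_old_neq mate_in mate_mate)
  show "c' x \<in> H'" if "x \<in> H'" for x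
    using that by (cases rule: half_cases) (use ccw_new ccw_old ccw_in h g(1) in_H' in auto)
  show "e j \<in> H'" if "j \<in> J" for j using ext_in[OF that] in_H' by blast
  show "c' x = x" if "x \<in> X" for x using ccw_ext[OF that] ccw_old[OF X_subset_H[OF that]] by simp
  show "quartic \<Lambda>' (m' x)" if "x \<in> X" for x
    using quartic_old[OF quartic_mate_ext[OF that] mate_in[OF X_subset_H[OF that]]] mate_X[OF that] by simp
  show "quartic \<Lambda>' x \<or> bivalent \<Lambda>' x" if "x \<in> H' - X" for x
    using that quartic_old[OF all_quartic] bivalent_new unfolding subdivide_simps by blast
qed (rule nblack_pos inj_ext)+

sublocale sub: disk_map \<Lambda>' by (rule disk_map_subdivide)

lemma face_step_old: "x \<in> H \<Longrightarrow> x \<noteq> h \<Longrightarrow> x \<noteq> g \<Longrightarrow> f' x = f x"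
  using mate_old mate_in ccw_old unfolding face_step_def turn_def subdivide_simps(4,5,8,9) by simp

lemma face_step_new: "f' h = g'" "f' g' = f h" "f' g = h'" "f' h' = f g"
  using notin_X ccw_new ccw_old h g
  unfolding face_step_def mate_new turn_def subdivide_simps(4,5,8,9) by simp_all

lemma split_face_invariant:
  assumes y: "y \<in> {h, g}" shows "f' ` insert (f' y) (face y) \<subseteq> insert (f' y) (face y)"
proof -
  have H: "y \<in> H" using y h g(1) by blast
  have other: "x \<notin> {h, g} - {y}" if "x \<in> face y" for x using par_face[OF that H] y g(4) by auto
  have "f' x \<in> face y" if x: "x \<in> face y" "x \<noteq> y" for x
  proof -
    have "x \<noteq> h" "x \<noteq> g" using other[OF x(1)] x(2) y by auto
    then show ?thesis using face_step_old[OF face_subset_H[OF H x(1)]] orbit.step[OF x(1)] by simp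
  qed
  moreover have "f' (f' y) \<in> face y" using y face_step_new orbit.base[of f y] by auto
  ultimately show ?thesis by blast
qed

lemma card_face_le_four:
  assumes "x \<in> H" shows "card (face x) \<le> 4"
proof -
  obtain n where n: "n \<in> {1..4}" "(f ^^ n) x = x" using face_period[OF assms] by blast
  then have "face x = (\<lambda>k. (f ^^ k) x) ` {..<n}" by (intro orbit_eq_image_funpow) auto
  then show ?thesis using card_image_le[of "{..<n}" "\<lambda>k. (f ^^ k) x"] n(1) by auto
qed

lemma face_period_subdivide:
  assumes x: "x \<in> H'" shows "\<exists>n\<in>{1..4}. (f' ^^ n) x = x"
proof -
  have split: ?thesis if y: "y \<in> {h, g}" "x \<in> insert (f' y) (face y)" for y
  proof (rule sub.period_if_invariant[OF y(2) split_face_invariant[OF y(1)]])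
    have H: "y \<in> H" using y(1) h g(1) by blast
    show "insert (f' y) (face y) \<subseteq> H'"
      using sub.face_step_in[of y] face_subset_H[OF H] H unfolding subdivide_simps(1) by blast
    show "card (insert (f' y) (face y)) \<le> 4" using card_insert_le_m1[of 4 "face y" "f' y"] sides[OF y(1)] by simp
  qed
  show ?thesis
  proof (cases "\<exists>y\<in>{h, g}. x \<in> insert (f' y) (face y)")
    case True then show ?thesis using split by blast
  next
    case False
    then have H: "x \<in> H" using x face_step_new unfolding subdivide_simps(1) by auto
    have "f' z \<in> face x" if z: "z \<in> face x" for z
    proof -
      have "z \<noteq> h" "z \<noteq> g" using False face_sym[OF H z] by auto
      then show ?thesis using face_step_old[OF face_subset_H[OF H z]] orbit.step[OF z] by simp
    qed
    then have "f' ` face x \<subseteq> face x" by blast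
    moreover have "face x \<subseteq> H'" using face_subset_H[OF H] unfolding subdivide_simps(1) by blast
    ultimately show ?thesis
      using sub.period_if_invariant[OF self_in_face[OF H] _ _ card_face_le_four[OF H]] by blast
  qed
qed

lemma boundary_face_subdivide:
  assumes j: "j \<in> J"
  shows "c' (m' (e j)) = m' (e (nx j)) \<or> c' (m' (c' (m' (e j)))) = m' (e (nx j))"
proof -
  have X: "e j \<in> X" "e (nx j) \<in> X" using ext_in_X j next_ext_in by blast+
  have mates: "m' (e j) = m (e j)" "m' (e (nx j)) = m (e (nx j))" using mate_X X by blast+
  have step: "c' (m' (e j)) = c (m (e j))" using ccw_old mates(1) mate_in ext_in[OF j] by simp
  from j show ?thesis
  proof (cases rule: boundary_cases)
    case two then show ?thesis using step mates(2) by simp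
  next
    case three
    have in_H: "f (e j) \<in> H" using face_step_in ext_in[OF j] by blast
    have "e j \<in> face (f (e j))" using face_sym[OF ext_in[OF j] orbit.base] .
    then have "f (e j) \<noteq> h" "f (e j) \<noteq> g" using inner[of h] inner[of g] X(1) by auto
    then have "m' (f (e j)) = m (f (e j))" using mate_old in_H by blast
    then show ?thesis using three(1,2) step mates(2) ccw_old mate_in[OF in_H] by simp
  qed
qed

lemma connected_subdivide:
  assumes invariant: "\<And>x. x \<in> H' \<Longrightarrow> \<chi> (m' x) = \<chi> x \<and> \<chi> (c' x) = (\<chi> x :: bool)"
    and xy: "x \<in> H'" "y \<in> H'"
  shows "\<chi> y = \<chi> x"
proof -
  have in_H': "x \<in> H'" if "x \<in> H \<or> x = h' \<or> x = g'" for x using that unfolding subdivide_simps by blast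
  have new: "\<chi> h' = \<chi> h" "\<chi> g' = \<chi> g" "\<chi> g' = \<chi> h'"
    using invariant[of h] invariant[of g] invariant[of h'] in_H' h g(1) mate_new ccw_new by auto
  have "\<chi> (m z) = \<chi> z \<and> \<chi> (c z) = \<chi> z" if z: "z \<in> H" for z
    using invariant[of z] in_H' z ccw_old mate_old new g(2) by metis
  then have "\<chi> z = \<chi> h" if "z \<in> H" for z using connected h that by blast
  then show ?thesis using xy new unfolding subdivide_simps(1) by auto
qed

context
  fixes C :: "half set"
  assumes C: "C \<subseteq> H'" "\<And>x. x \<in> C \<Longrightarrow> m' x \<in> C"
    and C_even: "\<And>x. x \<in> H' - X \<Longrightarrow> even (card (C \<inter> vertex_of \<Lambda>' x))"
begin

lemma new_in_cycle_iff: "h' \<in> C \<longleftrightarrow> h \<in> C" "g' \<in> C \<longleftrightarrow> g \<in> C" "h' \<in> C \<longleftrightarrow> g' \<in> C"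
proof -
  show "h' \<in> C \<longleftrightarrow> h \<in> C" "g' \<in> C \<longleftrightarrow> g \<in> C" using C(2) mate_new by metis+
  have "even (card (C \<inter> vertex_of \<Lambda>' h'))" using C_even notin_X unfolding subdivide_simps(1) by blast
  moreover have "C \<inter> vertex_of \<Lambda>' h' = {x \<in> {h', g'}. x \<in> C}"
    using vertex_of_bivalent[OF bivalent_new(1)] ccw_new by auto
  ultimately have "card {x \<in> {h', g'}. x \<in> C} \<noteq> 1" by auto
  then show "h' \<in> C \<longleftrightarrow> g' \<in> C" using card_filter_two[OF fresh(3), of "\<lambda>x. x \<in> C"] by blast
qed

lemma bounds_restrict: "\<exists>\<chi>. bounds \<Lambda> (C \<inter> H) \<chi>"
proof (rule planar)
  show "m x \<in> C \<inter> H" if "x \<in> C \<inter> H" for x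
  proof (cases "x = h \<or> x = g")
    case True then show ?thesis using that new_in_cycle_iff h g(1,2) by auto
  next
    case False then show ?thesis using that C(2)[of x] mate_old mate_in by auto
  qed
  show "even (card (C \<inter> H \<inter> vertex_of \<Lambda> x))" if x: "x \<in> H - X" for x
  proof -
    have "(c' ^^ n) x = (c ^^ n) x \<and> (c ^^ n) x \<in> H" for n
      using x ccw_old ccw_in by (induction n) auto
    then have "vertex_of \<Lambda>' x = vertex_of \<Lambda> x" unfolding vertex_of_def by simp
    moreover have "C \<inter> H \<inter> vertex_of \<Lambda> x = C \<inter> vertex_of \<Lambda> x" using vertex_of_subset_H[of x] x by blast
    ultimately show ?thesis using C_even[of x] x unfolding subdivide_simps(1) by simp
  qed
qed simp

lemma bounds_subdivide: "\<exists>\<chi>. bounds \<Lambda>' C \<chi>"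
proof -
  obtain \<chi> where "bounds \<Lambda> (C \<inter> H) \<chi>" using bounds_restrict by blast
  then have \<chi>: "x \<in> H \<Longrightarrow> m x \<notin> X \<Longrightarrow> \<chi> (c (m x)) = \<chi> x" "x \<in> H \<Longrightarrow> \<chi> (m x) \<noteq> \<chi> x \<longleftrightarrow> x \<in> C" for x
    unfolding bounds_def by blast+
  define \<xi> where "\<xi> = \<chi>(h' := \<chi> g, g' := \<chi> h)"
  have restrict: "\<xi> x = \<chi> x" if "x \<in> H" for x using fresh that unfolding \<xi>_def by auto
  have new: "\<xi> h' = \<chi> g" "\<xi> g' = \<chi> h" unfolding \<xi>_def using fresh(3) by auto
  have around: "\<xi> (c' g) = \<chi> h" "\<xi> (c' h) = \<chi> g"
    using \<chi>(1)[of h] \<chi>(1)[of g] h g notin_X ccw_old restrict ccw_in by auto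
  have cross: "\<chi> g \<noteq> \<chi> h \<longleftrightarrow> h \<in> C" using \<chi>(2)[OF h] .
  have "\<xi> (c' (m' x)) = \<xi> x" if "x \<in> H'" "m' x \<notin> X" for x
    using that(1)
  proof (cases rule: half_cases)
    case old
    then show ?thesis
      using \<chi>(1)[of x] that(2) mate_old ccw_old[of "m x"] mate_in ccw_in restrict by simp
  qed (simp_all add: mate_new ccw_new new around restrict h g(1))
  moreover have "\<xi> (m' x) \<noteq> \<xi> x \<longleftrightarrow> x \<in> C" if "x \<in> H'" for x
    using that
  proof (cases rule: half_cases)
    case old
    then show ?thesis using \<chi>(2)[of x] mate_old mate_in restrict by simp
  qed (use mate_new new restrict h g(1) cross new_in_cycle_iff in auto)
  ultimately show ?thesis unfolding bounds_def subdivide_simps(8) by blast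
qed

end

theorem plane_domain_subdivide: "plane_domain \<Lambda>' par"
proof (rule plane_domain.intro[OF disk_map_subdivide plane_domain_axioms.intro], unfold subdivide_simps(4,5,7,8))
  show "par (m' x) \<longleftrightarrow> \<not> par x" if "x \<in> H'" for x
    using that by (cases rule: half_cases) (use mate_new mate_old par_mate par_mid in auto)
  show "par (c' x) \<longleftrightarrow> \<not> par x" if "x \<in> H' - X" for x
    using that par_ccw[of x] ccw_old[of x] ccw_new par_mid g(4) unfolding subdivide_simps(1) by auto
  have "m' (e (2 * N)) = m (e (2 * N))" "m' (e 1) = m (e 1)" using mate_X ext_in_X nblack_pos by auto
  then show "c' (m' (e (2 * N))) = m' (e 1)"
    using corner ccw_old[OF mate_in[OF ext_in]] nblack_pos by simp
  show "puncture_ok \<Lambda>'"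
    using bivalent_new notin_X quartic_old[OF all_quartic] ccw_new
    unfolding puncture_ok_def subdivide_simps(1,6,8) by auto
  show "\<chi> y = \<chi> x" if "\<And>x. x \<in> H' \<Longrightarrow> \<chi> (m' x) = \<chi> x \<and> \<chi> (c' x) = \<chi> x" "x \<in> H'" "y \<in> H'"
    for \<chi> :: "half \<Rightarrow> bool" and x y by (rule connected_subdivide[OF that])
qed (fact boundary_face_subdivide face_period_subdivide bounds_subdivide)+

end

context dihedral begin

lemma plane_domain_subdivide_FK:
  assumes h: "h \<in> H" and faces: "\<forall>x\<in>edge_of FK h. inner_face FK (face_of FK x) \<and> card (face_of FK x) \<le> 3"
  shows "plane_domain (subdivide FK h) half_parity"
proof -
  interpret plane: plane_domain FK half_parity by (rule plane_domain_FK)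
  have edge: "x \<in> H" "inner_face FK (face_of FK x)" "card (face_of FK x) \<le> 3" if "x \<in> {h, m h}" for x
    using faces that h mate_H(1) unfolding edge_of_def mate_FK by auto
  have is_Half: "\<exists>p d. x = Half p d" if "x \<in> H" for x using H_start[OF that] by metis
  have mid: "mid x \<notin> H" "half_parity (mid x) \<longleftrightarrow> \<not> half_parity x" if "x \<in> H" for x
  proof -
    obtain p d where x: "x = Half p d" using is_Half \<open>x \<in> H\<close> by blast
    show "mid x \<notin> H" using is_Half[of "mid x"] x by auto
    show "half_parity (mid x) \<longleftrightarrow> \<not> half_parity x" unfolding x by (cases p; cases d) simp
  qed
  have "h \<noteq> m h" using plane.par_mate[OF h] by (auto simp: mate_FK)
  then have "mid h \<noteq> mid (m h)" using is_Half[OF h] is_Half[OF mate_H(1)[OF h]] by auto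
  then interpret subdivision FK half_parity h
    by unfold_locales (use mid h edge mate_H(1) quartic_in_grid FK.inner_face_of in \<open>auto simp: mate_FK\<close>)
  show ?thesis by (rule plane_domain_subdivide)
qed

end

theorem theorem3:
  fixes \<Lambda> :: fpl_domain and t :: complex
  assumes "dihedral_domain \<Lambda>"
  shows "Sym \<Lambda> (Psi' \<Lambda> t) = Sym \<Lambda> (Psi \<Lambda> t)"
proof -
  from assms have "\<exists>par. plane_domain \<Lambda> par"
  proof cases
    case (first Lx Ly a)
    interpret dihedral Lx Ly a by unfold_locales (rule first(2))
    show ?thesis unfolding first(1) using plane_domain_FK by blast
  next
    case (second Lx Ly a \<Lambda>' h)
    interpret dihedral Lx Ly a by unfold_locales (rule second(2))
    show ?thesis unfolding second(1,3) using plane_domain_subdivide_FK second(3-5) by blast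
  qed
  then obtain par where "plane_domain \<Lambda> par" by blast
  then show ?thesis by (rule plane_domain.Sym_Psi'_eq_Sym_Psi)
qed

end
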